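(* Let $\alpha,\beta>0$, let $g\in GH_\beta\cap H_\alpha([0,1])$ with $g(0)=0$ and $g([0,1])\subset[c,d]$, put $K_g=[0,1]\times[c,d]$ and $\gamma(t)=(t,g(t))$, $t\in[0,1]$. Let $s\in(0,1]$ and let $\theta=\theta(s)$ be the line segment in the plane connecting $\gamma(0)$ and $\gamma(s)=(s,g(s))$. This segment consists of the closed set $\theta\cap\gamma$ and of open segments $J_k=(\gamma(a_k),\gamma(b_k))$, $k>0$ (with $a_k<b_k$ in $[0,s]$), $\bigcup_kJ_k=\theta\setminus\gamma$, such that $(+\gamma([a_k,b_k]))\cup(-J_k)$ or $(-\gamma([a_k,b_k]))\cup(+J_k)$ is the (positively oriented) Jordan boundary of a bounded domain $G_k$. Let $f:[0,1]\times\mathbb{R}\to\mathbb{R}$ be continuous with $\sup_{x\in[c,d]}|f(\cdot,x),H_\beta([0,1])|<\infty$, let $f$ be absolutely continuous on lines (ACL), and let $\partial f/\partial t\in L(K_g)$. Then $$\int_0^s f(t,g(t))\,dg(t)=\sum_k\sigma_k\int_{G_k}\frac{\partial}{\partial t}f(t,x)\,dt\,dx+\frac{g(s)}{s}\int_0^s f\Big(t,\frac{g(s)}{s}t\Big)dt,$$ where $\sigma_k=1$ if $\partial G_k=(+\gamma([a_k,b_k]))\cup(-J_k)$ and $\sigma_k=-1$ if $\partial G_k=(-\gamma([a_k,b_k]))\cup(+J_k)$. If $\beta>1/2$, the formula is valid for $W$-almost every $g\in C([0,1])$.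
   Context: For $0<\beta\le1$, $H_\beta([0,1])$ is the class of functions with finite seminorm $|f,H_\beta([0,1])|=\sup_{s\ne t\in[0,1]}|f(s)-f(t)|/|s-t|^\beta$ (Hölder exponents always lie in $(0,1]$). $W$ is the Wiener measure on $C([0,1])$ (the law of standard Brownian motion started at $0$). $L(K_g)$ is the space of Lebesgue summable functions on $K_g$. ACL means absolutely continuous on almost all segments parallel to the coordinate axes. The plane has coordinates $(t,x)$; $+\gamma([a_k,b_k])$ and $+J_k$ denote the arc and the segment traversed from $\gamma(a_k)$ to $\gamma(b_k)$ (increasing $t$), a minus sign denotes reversed orientation, and Jordan boundaries of bounded domains are oriented positively (counterclockwise). For $g\in C([0,1])$ put $t_{k,n}=n2^{-k}$ and $h_{k,n}=h_{k,n}(g)=2^k\int_{t_{k,n}}^{t_{k,n+1}}g(\tau)\,d\tau$ for $k\ge0$, $0\le n<2^k$. For $0\le a<b\le1$ and $k\ge1$ let $n_k(a)$ and $n_k(b)$ be the smallest and the largest element of the set of consecutive integers $\{n:\ 0\le n\le 2^k,\ [t_{k-1,\lfloor n/2\rfloor},t_{k-1,\lfloor n/2\rfloor+1}]\subset[a,b]\}$ (if this set is empty, the sum below is $0$). By definition, $$\int_a^b f(t,g(t))\,dg(t)=\lim_{k\to\infty}\sum_{n=n_k(a)+1}^{n_k(b)}\int_{h_{k,n-1}}^{h_{k,n}}f(t_{k,n},x)\,dx .$$ $GH_\beta=\{g\in C([0,1]):\ \sum_{k=1}^\infty 2^{k(1-\beta)}|B_{k-1}(g)|<\infty\}$, where $|B_k(g)|=2^{-(k+1)}\sum_{n=0}^{2^k-1}|h_{k+1,2n+1}(g)-h_{k+1,2n}(g)|$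 ($k\ge0$) is the area between the polygonal step curves with heights $h_{k,n}(g)$ and $h_{k+1,n}(g)$. *)

theory Defs
  imports "HOL-Probability.Probability" "HOL-Complex_Analysis.Complex_Analysis"
begin

text \<open>
  Functions on $[0,1]$ are total functions \<^typ>\<open>real \<Rightarrow> real\<close> of which only the values on
  \<^term>\<open>{0..1::real}\<close> matter; functions on $[0,1] \times \mathbb{R}$ are treated likewise.
\<close>

section \<open>Function classes\<close>

definition holder_seminorm :: "real \<Rightarrow> (real \<Rightarrow> real) \<Rightarrow> ennreal" where
  "holder_seminorm \<beta> u =
     (SUP (s, t) \<in> {(s, t). s \<in> {0..1} \<and> t \<in> {0..1} \<and> s \<noteq> t}.
        ennreal (\<bar>u s - u t\<bar> / \<bar>s - t\<bar> powr \<beta>))"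

definition holder_class :: "real \<Rightarrow> (real \<Rightarrow> real) set" where
  "holder_class \<beta> = {u. holder_seminorm \<beta> u < \<infinity>}"

definition dyadic :: "nat \<Rightarrow> nat \<Rightarrow> real" where
  "dyadic k n = real n / 2 ^ k"

definition dyadic_mean :: "(real \<Rightarrow> real) \<Rightarrow> nat \<Rightarrow> nat \<Rightarrow> real" where
  "dyadic_mean g k n = 2 ^ k * (LBINT \<tau>=dyadic k n..dyadic k (n + 1). g \<tau>)"

definition step_area :: "(real \<Rightarrow> real) \<Rightarrow> nat \<Rightarrow> real" where
  "step_area g k =
     (\<Sum>n<2 ^ k. \<bar>dyadic_mean g (k + 1) (2 * n + 1) - dyadic_mean g (k + 1) (2 * n)\<bar>) / 2 ^ (k + 1)"

text \<open>The series runs over $k \ge 1$, hence the shift by one.\<close>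

definition GH :: "real \<Rightarrow> (real \<Rightarrow> real) set" where
  "GH \<beta> = {g. continuous_on {0..1} g \<and>
              summable (\<lambda>k. 2 powr (real (Suc k) * (1 - \<beta>)) * step_area g k)}"

section \<open>The integral along \<open>g\<close>\<close>

text \<open>
  Only $k \ge 1$ is meaningful here; the value at $k = 0$ does not affect the limit.
  The interval integral \<open>LBINT x=p..q\<close> is oriented (it changes sign if $q < p$).
\<close>

definition dyadic_indices :: "real \<Rightarrow> real \<Rightarrow> nat \<Rightarrow> nat set" where
  "dyadic_indices a b k =
     {n. n \<le> 2 ^ k \<and> {dyadic (k - 1) (n div 2)..dyadic (k - 1) (n div 2 + 1)} \<subseteq> {a..b}}"

definition path_sum :: "(real \<times> real \<Rightarrow> real) \<Rightarrow> (real \<Rightarrow> real) \<Rightarrow> real \<Rightarrow> real \<Rightarrow> nat \<Rightarrow> real" where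
  "path_sum f g a b k =
     (if dyadic_indices a b k = {} then 0
      else \<Sum>n = Min (dyadic_indices a b k) + 1..Max (dyadic_indices a b k).
             LBINT x=dyadic_mean g k (n - 1)..dyadic_mean g k n. f (dyadic k n, x))"

definition path_integral :: "(real \<times> real \<Rightarrow> real) \<Rightarrow> (real \<Rightarrow> real) \<Rightarrow> real \<Rightarrow> real \<Rightarrow> real" where
  "path_integral f g a b = lim (path_sum f g a b)"

section \<open>Integrands\<close>

definition abs_continuous_on :: "real \<Rightarrow> real \<Rightarrow> (real \<Rightarrow> real) \<Rightarrow> bool" where
  "abs_continuous_on p q u \<longleftrightarrow>
     (\<forall>\<epsilon>>0. \<exists>\<delta>>0. \<forall>D :: (real \<times> real) set.
        finite D \<longrightarrow>
        (\<forall>(x, y)\<in>D. p \<le> x \<and> x < y \<and> y \<le> q) \<longrightarrow>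
        disjoint_family_on (\<lambda>(x, y). {x<..<y}) D \<longrightarrow>
        (\<Sum>(x, y)\<in>D. y - x) < \<delta> \<longrightarrow>
        (\<Sum>(x, y)\<in>D. \<bar>u y - u x\<bar>) < \<epsilon>)"

text \<open>Absolute continuity on lines in the strip $[0,1] \times \mathbb{R}$.\<close>

definition ACL :: "(real \<times> real \<Rightarrow> real) \<Rightarrow> bool" where
  "ACL f \<longleftrightarrow>
     (AE x in lborel. abs_continuous_on 0 1 (\<lambda>t. f (t, x))) \<and>
     (AE t in lborel. t \<in> {0..1} \<longrightarrow> (\<forall>p q. p < q \<longrightarrow> abs_continuous_on p q (\<lambda>x. f (t, x))))"

text \<open>
  At points where the derivative does not exist \<^const>\<open>deriv\<close> has an unspecified value. For an
  ACL function these points form a null subset of the strip, as do the lines $t = 0$ and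
  $t = 1$, where \<^const>\<open>deriv\<close> would also depend on values of \<open>f\<close> outside the strip.
\<close>

definition partial_t :: "(real \<times> real \<Rightarrow> real) \<Rightarrow> real \<times> real \<Rightarrow> real" where
  "partial_t f p = deriv (\<lambda>t. f (t, snd p)) (fst p)"

definition integrand :: "real \<Rightarrow> real \<Rightarrow> real \<Rightarrow> (real \<times> real \<Rightarrow> real) \<Rightarrow> bool" where
  "integrand \<beta> c d f \<longleftrightarrow>
     continuous_on ({0..1} \<times> UNIV) f \<and>
     (SUP x\<in>{c..d}. holder_seminorm \<beta> (\<lambda>t. f (t, x))) < \<infinity> \<and>
     ACL f \<and>
     set_integrable lebesgue ({0..1} \<times> {c..d}) (partial_t f)"

section \<open>The chord and the domains cut off by it\<close>

definition graph_path :: "(real \<Rightarrow> real) \<Rightarrow> real \<Rightarrow> real \<times> real" where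
  "graph_path g t = (t, g t)"

definition chord :: "(real \<Rightarrow> real) \<Rightarrow> real \<Rightarrow> (real \<times> real) set" where
  "chord g s = closed_segment (graph_path g 0) (graph_path g s)"

text \<open>
  \<open>c\<close> is a positively oriented parametrization of the boundary of the bounded Jordan domain
  \<open>G\<close>. The plane with coordinates $(t,x)$ is identified with the complex plane by $t + ix$.
\<close>

definition positive_jordan_boundary :: "(real \<Rightarrow> real \<times> real) \<Rightarrow> (real \<times> real) set \<Rightarrow> bool" where
  "positive_jordan_boundary c G \<longleftrightarrow>
     simple_path c \<and> pathfinish c = pathstart c \<and>
     open G \<and> connected G \<and> bounded G \<and> frontier G = path_image c \<and>
     (\<forall>(t, x)\<in>G. winding_number (\<lambda>u. Complex (fst (c u)) (snd (c u))) (Complex t x) = 1)"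

text \<open>
  The open segments $J_k = (\gamma(a_k), \gamma(b_k))$ are indexed by the pairs $(a_k, b_k)$.
  As the end points of such a segment lie on the graph, it is a whole component of the chord
  minus the graph.
\<close>

definition chord_gaps :: "(real \<Rightarrow> real) \<Rightarrow> real \<Rightarrow> (real \<times> real) set" where
  "chord_gaps g s =
     {(a, b). 0 \<le> a \<and> a < b \<and> b \<le> s \<and>
              open_segment (graph_path g a) (graph_path g b)
                \<subseteq> chord g s - path_image (graph_path g)}"

text \<open>
  \<open>G\<close> and \<open>\<sigma>\<close> are the domain and the sign that belong to the gap $(a,b)$: \<open>\<sigma> = 1\<close> if the
  boundary of \<open>G\<close> is $(+\gamma([a,b])) \cup (-J)$, and \<open>\<sigma> = -1\<close> if it is
  $(-\gamma([a,b])) \cup (+J)$.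
\<close>

definition gap_domain :: "(real \<Rightarrow> real) \<Rightarrow> real \<times> real \<Rightarrow> (real \<times> real) set \<Rightarrow> real \<Rightarrow> bool" where
  "gap_domain g = (\<lambda>(a, b) G \<sigma>.
     \<sigma> = 1 \<and> positive_jordan_boundary
       (subpath a b (graph_path g) +++ linepath (graph_path g b) (graph_path g a)) G \<or>
     \<sigma> = - 1 \<and> positive_jordan_boundary
       (subpath b a (graph_path g) +++ linepath (graph_path g a) (graph_path g b)) G)"

definition chord_decomposition :: "(real \<Rightarrow> real) \<Rightarrow> real \<Rightarrow> bool" where
  "chord_decomposition g s \<longleftrightarrow>
     closed (chord g s \<inter> path_image (graph_path g)) \<and>
     countable (chord_gaps g s) \<and>
     disjoint_family_on (\<lambda>(a, b). open_segment (graph_path g a) (graph_path g b)) (chord_gaps g s) \<and>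
     (\<Union>(a, b)\<in>chord_gaps g s. open_segment (graph_path g a) (graph_path g b))
       = chord g s - path_image (graph_path g) \<and>
     (\<forall>k\<in>chord_gaps g s. \<exists>G \<sigma>. gap_domain g k G \<sigma>)"

text \<open>
  The sum over the gaps is unconditional, since the segments come in no particular order.
\<close>

definition area_formula :: "(real \<times> real \<Rightarrow> real) \<Rightarrow> (real \<Rightarrow> real) \<Rightarrow> real \<Rightarrow> bool" where
  "area_formula f g s \<longleftrightarrow>
     convergent (path_sum f g 0 s) \<and>
     (\<forall>G \<sigma>. (\<forall>k\<in>chord_gaps g s. gap_domain g k (G k) (\<sigma> k)) \<longrightarrow>
        (\<lambda>k. \<sigma> k * (LINT p:G k|lebesgue. partial_t f p)) summable_on chord_gaps g s \<and>
        path_integral f g 0 s =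
          (\<Sum>\<^sub>\<infinity>k\<in>chord_gaps g s. \<sigma> k * (LINT p:G k|lebesgue. partial_t f p)) +
          g s / s * (LBINT t=0..s. f (t, g s / s * t)))"

section \<open>Wiener measure\<close>

text \<open>
  Elements of $C([0,1])$ are represented by functions that are continuous on $[0,1]$ and
  \<^const>\<open>undefined\<close> elsewhere. The Borel sets of $C([0,1])$ are generated by the evaluations.
  The predicate says that under \<open>W\<close> the evaluation process is a standard Brownian motion on
  $[0,1]$; this determines \<open>W\<close>.
\<close>

definition wiener_measure :: "(real \<Rightarrow> real) measure \<Rightarrow> bool" where
  "wiener_measure W \<longleftrightarrow>
     prob_space W \<and>
     sets W = sets (restrict_space (Pi\<^sub>M {0..1} (\<lambda>_. borel)) {g. continuous_on {0..1} g}) \<and>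
     (AE g in W. g 0 = 0) \<and>
     (\<forall>s t. 0 \<le> s \<and> s < t \<and> t \<le> 1 \<longrightarrow>
        distributed W lborel (\<lambda>g. g t - g s) (normal_density 0 (sqrt (t - s)))) \<and>
     (\<forall>(n :: nat) (\<tau> :: nat \<Rightarrow> real).
        \<tau> ` {..n} \<subseteq> {0..1} \<and> strict_mono_on {..n} \<tau> \<longrightarrow>
        prob_space.indep_vars W (\<lambda>_. borel) (\<lambda>i g. g (\<tau> (Suc i)) - g (\<tau> i)) {..<n})"

end

theory Submission
  imports Defs
begin

text \<open>
  For a continuous function \<open>u\<close> on \<open>[0, s]\<close> with values in \<open>[c, d]\<close> let \<open>under c s u\<close> be the
  region below its graph, and let \<open>F t y\<close> be the integral of \<open>f (t, \<cdot>)\<close> over \<open>[c, y]\<close>. If \<open>u\<close> is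
  smooth, then \<open>d/dt F t (u t) = f (t, u t) * u' t + (\<integral> x = c..u t. \<partial>f/\<partial>t (t, x))\<close>, and therefore

  \<open>(\<integral> t = 0..s. f (t, u t) du t) = F s (u s) - F 0 (u 0) - (\<integral> p \<in> under c s u. \<partial>f/\<partial>t p)\<close>.

  The right-hand side involves no derivative of \<open>u\<close>, and it is continuous with respect to uniform
  convergence of \<open>u\<close>: \<open>F\<close> is jointly continuous, and the region integral converges by dominated
  convergence because a graph is a null set. For a step function in place of \<open>u\<close>, this formula is
  summation by parts combined with Fubini's theorem on the rectangles below the steps
  (\<open>step_path_integral\<close>). So whenever step functions converge uniformly to \<open>u\<close>, their sums tend to
  its right-hand side (\<open>step_path_integral_tendsto\<close>).

  This is applied twice. For the dyadic means of \<open>g\<close> the sums are those that define the integral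
  along \<open>g\<close> (\<open>path_sum_tendsto\<close>). For step functions inscribed in the chord \<open>x = m * t\<close>, where
  \<open>m = g s / s\<close>, they are Riemann sums of \<open>m * (\<integral> t = 0..s. f (t, m * t))\<close> (\<open>chord_integral\<close>). Graph
  and chord have the same end points, so on subtraction the terms with \<open>F\<close> cancel, and the integral
  of \<open>\<partial>f/\<partial>t\<close> over the region below the chord minus the one over the region below the graph remains.
  Up to null sets the points that lie in exactly one of the two regions form the disjoint union of
  the domains of the gaps, with sign \<open>+1\<close> where the graph is below the chord; countable additivity
  gives the sum (\<open>gap_areas_has_sum\<close>).

  Two facts support this. Fubini's theorem on a rectangle needs
  \<open>f (t\<^sub>2, x) - f (t\<^sub>1, x) = (\<integral> t = t\<^sub>1..t\<^sub>2. \<partial>f/\<partial>t (t, x))\<close> for almost every \<open>x\<close>. This is Lebesgue's theorem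
  that an absolutely continuous function is differentiable almost everywhere and is the integral of
  its derivative; it is derived here from the Vitali covering theorem (\<open>AC_deriv_has_integral\<close>). The
  other one is topological: the Jordan domain of a gap is the set of points strictly between graph
  and chord, and its orientation is decided by which of the two is on top (\<open>gap_domain_iff\<close>). The
  winding number is found by deforming the arc vertically into two sides of a triangle.

  Functions in \<open>GH \<beta>\<close> are continuous, and so are the elements of the Wiener space, almost all of which
  start at \<open>0\<close>; so both parts of the theorem are instances of \<open>area_formula_continuous\<close>.
\<close>

section \<open>Vitali coverings by intervals\<close>

text \<open>
  The intervals \<open>{y..z}\<close> with property \<open>P\<close> cover \<open>x\<close> finely, as the Vitali covering theorem requires.
  Having \<open>x\<close> in the interior makes the set of such points a \<open>G\<^sub>\<delta>\<close>, so measurability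
  comes for free.
\<close>

definition fine_at :: "(real \<Rightarrow> real \<Rightarrow> bool) \<Rightarrow> real \<Rightarrow> bool" where
  "fine_at P x \<longleftrightarrow> (\<forall>d>0. \<exists>y z. y < x \<and> x < z \<and> z - y < d \<and> P y z)"

lemma sets_fine_at: "{x. fine_at P x} \<in> sets borel"
proof -
  have "{x. fine_at P x} =
          (\<Inter>n::nat. \<Union>{{y<..<z} |y z. z - y < 1 / real (Suc n) \<and> P y z})" (is "_ = ?R")
  proof (intro equalityI subsetI)
    fix x assume "x \<in> {x. fine_at P x}"
    then have x: "fine_at P x" by simp
    show "x \<in> ?R"
    proof
      fix n :: nat
      have "1 / real (Suc n) > 0" by simp
      with x obtain y z where "y < x" "x < z" "z - y < 1 / real (Suc n)" "P y z"
        unfolding fine_at_def by blast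
      then show "x \<in> \<Union>{{y<..<z} |y z. z - y < 1 / real (Suc n) \<and> P y z}"
        by (intro UnionI[of "{y<..<z}"]) auto
    qed
  next
    fix x assume x: "x \<in> ?R"
    have "fine_at P x" unfolding fine_at_def
    proof (intro allI impI)
      fix d :: real assume "d > 0"
      then obtain n where n: "1 / real (Suc n) < d"
        using nat_approx_posE by blast
      from x have "x \<in> \<Union>{{y<..<z} |y z. z - y < 1 / real (Suc n) \<and> P y z}" by blast
      then obtain y z where "x \<in> {y<..<z}" "z - y < 1 / real (Suc n)" "P y z" by blast
      with n show "\<exists>y z. y < x \<and> x < z \<and> z - y < d \<and> P y z"
        by (intro exI[of _ y] exI[of _ z]) auto
    qed
    then show "x \<in> {x. fine_at P x}" by simp
  qed
  also have "\<dots> \<in> sets borel"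
    by (intro sets.countable_INT'' borel_open open_Union) auto
  finally show ?thesis .
qed

text \<open>
  Vitali's theorem yields countably many disjoint intervals that cover \<open>S\<close> up to a null set; by
  continuity of the measure finitely many of them already carry all but \<open>e\<close> of its measure.
\<close>

lemma Vitali_finite_intervals:
  assumes S: "S \<in> lmeasurable" and O: "open Q" "S \<subseteq> Q"
    and fine: "\<And>x. x \<in> S \<Longrightarrow> fine_at P x" and "e > 0"
  obtains D where "finite D"
    "\<And>y z. (y, z) \<in> D \<Longrightarrow> y < z \<and> {y..z} \<subseteq> Q \<and> P y z"
    "disjoint_family_on (\<lambda>(y, z). {y..z}) D"
    "measure lebesgue S < (\<Sum>(y, z)\<in>D. z - y) + e"
proof -
  define K where "K = {(y, z). y < z \<and> {y..z} \<subseteq> Q \<and> P y z}"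
  define a where "a = (\<lambda>(y, z). (y + z) / 2 :: real)"
  define r where "r = (\<lambda>(y, z). (z - y) / 2 :: real)"
  have cb: "cball (a i) (r i) = {fst i..snd i}" for i
    by (auto simp: a_def r_def cball_def dist_real_def split: prod.splits; simp add: abs_le_iff field_simps)
  have 1: "0 < r i" if "i \<in> K" for i using that by (auto simp: K_def r_def)
  have 2: "\<exists>i. i \<in> K \<and> x \<in> cball (a i) (r i) \<and> r i < d" if "x \<in> S" "0 < d" for x d
  proof -
    from that O obtain e where "e > 0" and e: "ball x e \<subseteq> Q" using open_contains_ball by blast
    from fine[OF \<open>x \<in> S\<close>] obtain y z where yz: "y < x" "x < z" "z - y < min d e" "P y z"
      unfolding fine_at_def using \<open>e > 0\<close> \<open>0 < d\<close> by (metis min_less_iff_conj)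
    then have "{y..z} \<subseteq> ball x e" by (auto simp: dist_real_def)
    with e yz have "(y, z) \<in> K" by (auto simp: K_def)
    with yz show ?thesis by (intro exI[of _ "(y, z)"]) (simp add: cb, simp add: r_def)
  qed
  obtain C where C: "countable C" "C \<subseteq> K"
     "pairwise (\<lambda>i j. disjnt (cball (a i) (r i)) (cball (a j) (r j))) C"
     "negligible(S - (\<Union>i \<in> C. cball (a i) (r i)))"
    using Vitali_covering_theorem_cballs[of K r S a, OF 1 2] by blast
  show thesis
  proof (cases "C = {}")
    case True
    with C(4) have "negligible S" by simp
    then have "measure lebesgue S = 0" by (rule negligible_imp_measure0)
    with \<open>e > 0\<close> show thesis by (intro that[of "{}"]) (auto simp: disjoint_family_on_def)
  next
    case False
    define A where "A n = (\<Union>i\<in>from_nat_into C ` {..<n}. {fst i..snd i}) \<inter> S" for n :: nat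
    have A: "A n \<in> lmeasurable" for n
      unfolding A_def using S by (intro fmeasurable_Int_fmeasurable sets.finite_UN)
        (auto intro!: sets.finite_UN fmeasurable_Int_fmeasurable simp: Int_commute)
    have UA: "(\<Union>n. A n) = (\<Union>i\<in>C. {fst i..snd i}) \<inter> S"
    proof -
      have "(\<Union>n. from_nat_into C ` {..<n}) = from_nat_into C ` UNIV" by auto
      also have "\<dots> = C" using C(1) False by (simp add: range_from_nat_into)
      finally have "(\<Union>n. from_nat_into C ` {..<n}) = C" .
      then show ?thesis unfolding A_def by blast
    qed
    have meq: "measure lebesgue (\<Union>n. A n) = measure lebesgue S"
    proof -
      have "sym_diff (\<Union>n. A n) S = S - (\<Union>i \<in> C. cball (a i) (r i))"
        unfolding UA cb by blast
      with C(4) have "negligible (sym_diff (\<Union>n. A n) S)" by simp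
      moreover have "(\<Union>n. A n) \<in> lmeasurable"
        unfolding UA using S C(1)
        by (subst Int_commute) (intro fmeasurable_Int_fmeasurable sets.countable_UN', auto)
      ultimately show ?thesis
        by (metis measure_negligible_symdiff Un_commute)
    qed
    have "(\<lambda>n. measure lebesgue (A n)) \<longlonglongrightarrow> measure lebesgue (\<Union>n. A n)"
    proof (rule Lim_measure_incseq)
      show "range A \<subseteq> sets lebesgue" using A by auto
      show "incseq A" unfolding A_def incseq_def by fastforce
      have "(\<Union>n. A n) \<subseteq> S" using UA by blast
      then have "emeasure lebesgue (\<Union>n. A n) \<le> emeasure lebesgue S"
        using S by (intro emeasure_mono) auto
      then show "emeasure lebesgue (\<Union>n. A n) \<noteq> \<infinity>"
        using S fmeasurableD2[OF S] by (auto simp: top_unique)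
    qed
    then have "\<forall>\<^sub>F n in sequentially. measure lebesgue S - e < measure lebesgue (A n)"
      unfolding meq by (rule order_tendstoD) (use \<open>e > 0\<close> in simp)
    then obtain n where n: "measure lebesgue S - e < measure lebesgue (A n)"
      using eventually_happens by force
    define D where "D = from_nat_into C ` {..<n}"
    have DC: "D \<subseteq> C" unfolding D_def using False from_nat_into by blast
    have fD: "finite D" unfolding D_def by simp
    have "measure lebesgue (A n) \<le> measure lebesgue (\<Union>i\<in>D. {fst i..snd i})"
      unfolding A_def D_def[symmetric] using fD
      by (intro measure_mono_fmeasurable) (auto intro!: fmeasurable.finite_UN sets.Int sets.finite_UN simp: S fmeasurableD)
    also have "\<dots> \<le> (\<Sum>i\<in>D. measure lebesgue {fst i..snd i})"
      by (rule measure_UNION_le[OF fD]) auto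
    also have "\<dots> = (\<Sum>(y, z)\<in>D. z - y)"
      using DC C(2) by (intro sum.cong) (auto simp: K_def)
    finally have "measure lebesgue S < (\<Sum>(y, z)\<in>D. z - y) + e" using n by linarith
    moreover have "disjoint_family_on (\<lambda>(y, z). {y..z}) D"
    proof -
      have "{fst i..snd i} \<inter> {fst j..snd j} = {}" if "i \<in> D" "j \<in> D" "i \<noteq> j" for i j
        using C(3) DC that unfolding pairwise_def disjnt_def cb by blast
      then show ?thesis unfolding disjoint_family_on_def by (auto simp: split_beta simp del: Int_atLeastAtMost)
    qed
    ultimately show thesis using DC C(2) by (intro that[OF fD]) (auto simp: K_def)
  qed
qed

text \<open>
  The components of \<open>[a, b]\<close> minus finitely many intervals. The last clause, for all \<open>u\<close> at once,
  says that increments are additive; \<open>u = (\<lambda>x. x)\<close> gives the total length. The induction splits off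
  the interval of \<open>D\<close> that is farthest to the right.
\<close>

lemma complementary_intervals:
  fixes a b :: real
  assumes "finite D" "\<forall>(x, y)\<in>D. a \<le> x \<and> x < y \<and> y \<le> b"
    and "disjoint_family_on (\<lambda>(x, y). {x<..<y}) D" and "a \<le> b"
  shows "\<exists>D'. finite D' \<and> (\<forall>(x, y)\<in>D'. a \<le> x \<and> x < y \<and> y \<le> b) \<and> D \<inter> D' = {} \<and>
           disjoint_family_on (\<lambda>(x, y). {x<..<y}) (D \<union> D') \<and>
           (\<forall>u::real \<Rightarrow> real. (\<Sum>(x, y)\<in>D'. u y - u x) = (u b - u a) - (\<Sum>(x, y)\<in>D. u y - u x))"
  using assms
proof (induction "card D" arbitrary: D b)
  case 0
  then have "D = {}" by simp
  show ?case
  proof (cases "a = b")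
    case True
    then show ?thesis using \<open>D = {}\<close> by (intro exI[of _ "{}"]) (auto simp: disjoint_family_on_def)
  next
    case False
    then show ?thesis using \<open>D = {}\<close> 0 by (intro exI[of _ "{(a, b)}"]) (auto simp: disjoint_family_on_def)
  qed
next
  case (Suc n)
  then have fin: "finite D" and ne: "D \<noteq> {}" by auto
  define m where "m = Max (snd ` D)"
  have "m \<in> snd ` D" unfolding m_def using fin ne by (intro Max_in) auto
  then obtain x where xm: "(x, m) \<in> D" by force
  have mx: "y \<le> m" if "(w, y) \<in> D" for w y
    unfolding m_def using that fin by (intro Max_ge) force+
  have xmb: "a \<le> x" "x < m" "m \<le> b" using Suc.prems(2) xm by auto
  define D0 where "D0 = D - {(x, m)}"
  have D: "D = insert (x, m) D0" "(x, m) \<notin> D0" "finite D0" using xm fin by (auto simp: D0_def)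
  have left: "y \<le> x" if "(w, y) \<in> D0" for w y
  proof (rule ccontr)
    assume "\<not> y \<le> x"
    moreover have "w < y" "(w, y) \<in> D" using that Suc.prems(2) D by auto
    moreover have "y \<le> m" using mx \<open>(w, y) \<in> D\<close> by blast
    ultimately have "(max x w + y) / 2 \<in> {w<..<y} \<inter> {x<..<m}" by (auto simp: max_def)
    moreover have "{w<..<y} \<inter> {x<..<m} = {}"
      using Suc.prems(3) xm \<open>(w, y) \<in> D\<close> that D(2) unfolding disjoint_family_on_def by fastforce
    ultimately show False by blast
  qed
  have "n = card D0" using Suc.hyps(2) D by simp
  moreover have "\<forall>(w, y)\<in>D0. a \<le> w \<and> w < y \<and> y \<le> x" using left Suc.prems(2) D by auto
  moreover have "disjoint_family_on (\<lambda>(x, y). {x<..<y}) D0"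
    using Suc.prems(3) by (rule disjoint_family_on_mono[rotated]) (auto simp: D)
  ultimately obtain D1 where D1: "finite D1" "\<forall>(w, y)\<in>D1. a \<le> w \<and> w < y \<and> y \<le> x" "D0 \<inter> D1 = {}"
     "disjoint_family_on (\<lambda>(x, y). {x<..<y}) (D0 \<union> D1)"
     "\<And>u::real \<Rightarrow> real. (\<Sum>(w, y)\<in>D1. u y - u w) = (u x - u a) - (\<Sum>(w, y)\<in>D0. u y - u w)"
    using Suc.hyps(1)[of D0 x] D(3) xmb by blast
  define D2 where "D2 = (if m = b then {} else {(m, b)})"
  have b0: "\<And>w y. (w, y) \<in> D0 \<union> D1 \<Longrightarrow> w < y \<and> y \<le> x"
    using D1(2) left Suc.prems(2) D(1) by auto
  have "D0 \<union> D1 \<union> {(x, m)} \<union> D2 = D \<union> (D1 \<union> D2)" using D by auto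
  moreover have dj: "disjoint_family_on (\<lambda>(x, y). {x<..<y}) (D0 \<union> D1 \<union> {(x, m)} \<union> D2)"
    unfolding disjoint_family_on_def
  proof (intro ballI impI)
    fix i j assume i: "i \<in> D0 \<union> D1 \<union> {(x, m)} \<union> D2" and j: "j \<in> D0 \<union> D1 \<union> {(x, m)} \<union> D2"
      and "i \<noteq> j"
    obtain i1 i2 j1 j2 where ij: "i = (i1, i2)" "j = (j1, j2)" by fastforce
    consider "i \<in> D0 \<union> D1 \<and> j \<in> D0 \<union> D1" | "i2 \<le> j1" | "j2 \<le> i1"
      using i j \<open>i \<noteq> j\<close> b0 xmb unfolding ij D2_def by (fastforce split: if_splits)
    then show "(case i of (x, y) \<Rightarrow> {x<..<y}) \<inter> (case j of (x, y) \<Rightarrow> {x<..<y}) = {}"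
    proof cases
      case 1
      then show ?thesis using D1(4) \<open>i \<noteq> j\<close> unfolding disjoint_family_on_def by blast
    qed (auto simp: ij)
  qed
  moreover have "D \<inter> (D1 \<union> D2) = {}"
    using D1(2,3) b0 xmb unfolding D(1) D2_def by (fastforce split: if_splits)
  moreover have "(\<Sum>(x, y)\<in>D1 \<union> D2. u y - u x) = (u b - u a) - (\<Sum>(x, y)\<in>D. u y - u x)"
    for u :: "real \<Rightarrow> real"
  proof -
    have "D1 \<inter> D2 = {}" using b0 xmb unfolding D2_def by (fastforce split: if_splits)
    then have "(\<Sum>(x, y)\<in>D1 \<union> D2. u y - u x) = (\<Sum>(x, y)\<in>D1. u y - u x) + (u b - u m)"
      using D1(1) by (subst sum.union_disjoint) (auto simp: D2_def)
    then show ?thesis using D1(5)[of u] D(2,3) by (simp add: D(1))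
  qed
  moreover have "finite (D1 \<union> D2)" "\<forall>(x, y)\<in>D1 \<union> D2. a \<le> x \<and> x < y \<and> y \<le> b"
    using D1 xmb by (auto simp: D2_def)
  ultimately show ?case by (intro exI[of _ "D1 \<union> D2"] conjI allI) simp_all
qed

section \<open>Differentiability of absolutely continuous functions\<close>

lemma AC_modulus:
  assumes "abs_continuous_on a b u" "e > 0"
  shows "\<exists>\<delta>>0. \<forall>D. finite D \<and> (\<forall>(x, y)\<in>D. a \<le> x \<and> x < y \<and> y \<le> b) \<and>
        disjoint_family_on (\<lambda>(x, y). {x<..<y}) D \<and> (\<Sum>(x, y)\<in>D. y - x) < \<delta> \<longrightarrow>
        (\<Sum>(x, y)\<in>D. \<bar>u y - u x\<bar>) < e"
proof -
  from assms obtain \<delta> where "\<delta> > 0" and "\<forall>D. finite D \<longrightarrow> (\<forall>(x, y)\<in>D. a \<le> x \<and> x < y \<and> y \<le> b) \<longrightarrow>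
        disjoint_family_on (\<lambda>(x, y). {x<..<y}) D \<longrightarrow> (\<Sum>(x, y)\<in>D. y - x) < \<delta> \<longrightarrow>
        (\<Sum>(x, y)\<in>D. \<bar>u y - u x\<bar>) < e"
    unfolding abs_continuous_on_def by blast
  then show ?thesis by (intro exI[of _ \<delta>]) simp
qed

lemma measure_disjoint_intervals:
  fixes D :: "(real \<times> real) set"
  assumes "finite D" "\<And>x y. (x, y) \<in> D \<Longrightarrow> x < y"
    and "disjoint_family_on (\<lambda>(x, y). {x<..<y}) D"
  shows "measure lebesgue (\<Union>(x, y)\<in>D. {x<..<y}) = (\<Sum>(x, y)\<in>D. y - x)"
proof -
  have "measure lebesgue (\<Union>(x, y)\<in>D. {x<..<y}) = (\<Sum>i\<in>D. measure lebesgue (case i of (x, y) \<Rightarrow> {x<..<y}))"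
    using assms by (intro measure_finite_Union) (auto split: prod.splits simp: less_imp_le emeasure_lborel_Ioo)
  also have "\<dots> = (\<Sum>(x, y)\<in>D. y - x)"
    using assms(2) by (intro sum.cong) (auto simp: less_imp_le)
  finally show ?thesis .
qed

lemma sum_lengths_le_measure:
  fixes D :: "(real \<times> real) set"
  assumes "finite D" "\<And>x y. (x, y) \<in> D \<Longrightarrow> x < y \<and> {x<..<y} \<subseteq> Q"
    and "disjoint_family_on (\<lambda>(x, y). {x<..<y}) D" and "Q \<in> lmeasurable"
  shows "(\<Sum>(x, y)\<in>D. y - x) \<le> measure lebesgue Q"
proof -
  have "measure lebesgue (\<Union>(x, y)\<in>D. {x<..<y}) \<le> measure lebesgue Q"
    using assms by (intro measure_mono_fmeasurable) (auto intro!: sets.finite_UN split: prod.splits)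
  then show ?thesis using measure_disjoint_intervals[of D] assms by auto
qed

lemma disjoint_open_of_closed:
  fixes D :: "(real \<times> real) set"
  assumes "disjoint_family_on (\<lambda>(x, y). {x..y}) D"
  shows "disjoint_family_on (\<lambda>(x, y). {x<..<y}) D"
  unfolding disjoint_family_on_def
proof (intro ballI impI)
  fix i j assume "i \<in> D" "j \<in> D" "i \<noteq> j"
  then have "(case i of (x, y) \<Rightarrow> {x..y}) \<inter> (case j of (x, y) \<Rightarrow> {x..y}) = {}"
    using assms unfolding disjoint_family_on_def by blast
  then show "(case i of (x, y) \<Rightarrow> {x<..<y}) \<inter> (case j of (x, y) \<Rightarrow> {x<..<y}) = {}"
    using greaterThanLessThan_subseteq_atLeastAtMost_iff by (cases i; cases j) fastforce
qed

lemma outer_open_in: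
  fixes S :: "real set"
  assumes "S \<in> sets lebesgue" "S \<subseteq> {a<..<b}" "e > 0"
  obtains Q where "open Q" "S \<subseteq> Q" "Q \<subseteq> {a<..<b}" "measure lebesgue (Q - S) < e"
proof -
  obtain T where T: "open T" "S \<subseteq> T" "T - S \<in> lmeasurable" "emeasure lebesgue (T - S) < ennreal e"
    using sets_lebesgue_outer_open[OF assms(1,3)] by metis
  have lt: "measure lebesgue (T - S) < e"
    using T(3,4) \<open>e > 0\<close> by (simp add: emeasure_eq_measure2 ennreal_less_iff)
  have "measure lebesgue (T \<inter> {a<..<b} - S) \<le> measure lebesgue (T - S)"
    using T assms(1) by (intro measure_mono_fmeasurable) auto
  with lt T assms(2) show thesis by (intro that[of "T \<inter> {a<..<b}"]) auto
qed

text \<open>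
  Let \<open>E\<close> be the set in question and \<open>Q\<close> an open set around \<open>E\<close> that is hardly larger. Disjoint
  intervals \<open>D1\<close> in \<open>Q\<close> of slope below \<open>p\<close> cover most of \<open>E\<close>, and so do intervals \<open>D2\<close> of slope above
  \<open>q\<close> inside them. The part of \<open>D1\<close> that \<open>D2\<close> misses consists of finitely many intervals of small
  total length, over which \<open>u\<close> hardly changes by absolute continuity. Hence the increments over \<open>D1\<close>
  and \<open>D2\<close> nearly agree, although they are at most \<open>p\<close> and at least \<open>q\<close> times nearly the same length;
  this forces \<open>E\<close> to be null.
\<close>

lemma AC_two_slopes_negligible:
  assumes ac: "abs_continuous_on a b u" and pq: "p < q"
  shows "negligible {x\<in>{a<..<b}. fine_at (\<lambda>y z. u z - u y < p * (z - y)) x \<and>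
                                   fine_at (\<lambda>y z. u z - u y > q * (z - y)) x}"
proof -
  define P1 where "P1 = (\<lambda>y z. u z - u y < p * (z - y))"
  define P2 where "P2 = (\<lambda>y z. u z - u y > q * (z - y))"
  define E where "E = {x\<in>{a<..<b}. fine_at P1 x \<and> fine_at P2 x}"
  have Eeq: "E = {a<..<b} \<inter> {x. fine_at P1 x} \<inter> {x. fine_at P2 x}" by (auto simp: E_def)
  have Es: "E \<in> sets lebesgue" unfolding Eeq using sets_fine_at by (intro sets.Int) auto
  have E: "E \<in> lmeasurable"
    using Es by (intro bounded_set_imp_lmeasurable) (auto simp: E_def intro: bounded_subset[of "{a..b}"])
  define m where "m = measure lebesgue E"
  have False if "\<not> negligible E"
  proof -
    have m: "m > 0" using that E by (simp add: m_def negligible_iff_measure zero_less_measure_iff)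
    define \<eta> where "\<eta> = (q - p) * m / 2"
    have "\<eta> > 0" using m pq by (simp add: \<eta>_def)
    obtain \<delta> where \<delta>: "\<delta> > 0" and acd: "\<forall>D. finite D \<and> (\<forall>(x, y)\<in>D. a \<le> x \<and> x < y \<and> y \<le> b) \<and>
        disjoint_family_on (\<lambda>(x, y). {x<..<y}) D \<and> (\<Sum>(x, y)\<in>D. y - x) < \<delta> \<longrightarrow>
        (\<Sum>(x, y)\<in>D. \<bar>u y - u x\<bar>) < \<eta>"
      using AC_modulus[OF ac \<open>\<eta> > 0\<close>] by auto
    \<comment> \<open>The lengths involved are known up to \<open>4 * e\<close>; in the final estimate these errors add up to \<open>e * c\<close>.\<close>
    define c where "c = (q - p) + 4 * \<bar>q\<bar>"
    have c: "c > 0" using pq by (simp add: c_def)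
    define e where "e = min (\<delta> / 5) (\<eta> / (2 * c))"
    have e: "e > 0" "4 * e < \<delta>" "e * c < \<eta>"
    proof -
      show "e > 0" using \<delta> \<open>\<eta> > 0\<close> c by (simp add: e_def)
      have "e \<le> \<delta> / 5" by (simp add: e_def)
      then show "4 * e < \<delta>" using \<delta> by simp
      have "e \<le> \<eta> / (2 * c)" by (simp add: e_def)
      then have "e * c \<le> \<eta> / (2 * c) * c" using c by (intro mult_right_mono) auto
      also have "\<dots> < \<eta>" using c \<open>\<eta> > 0\<close> by (simp add: field_simps)
      finally show "e * c < \<eta>" .
    qed
    obtain Q where Q: "open Q" "E \<subseteq> Q" "Q \<subseteq> {a<..<b}" "measure lebesgue (Q - E) < e"
      using outer_open_in[OF Es _ e(1)] Eeq by (metis Int_lower1 le_infI1)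
    have Ql: "Q \<in> lmeasurable"
      using Q(1,3) greaterThanLessThan_subseteq_atLeastAtMost_iff[of a b a b]
      by (intro bounded_set_imp_lmeasurable bounded_subset[of "{a..b}" Q]) auto
    have mQ: "measure lebesgue Q < m + e"
    proof -
      have "measure lebesgue Q \<le> measure lebesgue (E \<union> (Q - E))"
        using Ql E by (intro measure_mono_fmeasurable) auto
      also have "\<dots> \<le> measure lebesgue E + measure lebesgue (Q - E)"
        using Ql E by (intro measure_Un_le) auto
      finally show ?thesis using Q(4) by (simp add: m_def)
    qed
    obtain D1 where D1: "finite D1" "\<And>y z. (y, z) \<in> D1 \<Longrightarrow> y < z \<and> {y..z} \<subseteq> Q \<and> P1 y z"
      "disjoint_family_on (\<lambda>(y, z). {y..z}) D1" "m < (\<Sum>(y, z)\<in>D1. z - y) + e"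
      using Vitali_finite_intervals[OF E Q(1,2), of P1 e] e(1) unfolding m_def by (auto simp: E_def)
    define L1 where "L1 = (\<Sum>(y, z)\<in>D1. z - y)"
    note dj1 = disjoint_open_of_closed[OF D1(3)]
    define Q' where "Q' = (\<Union>(y, z)\<in>D1. {y<..<z})"
    have Q': "open Q'" "Q' \<subseteq> Q" "measure lebesgue Q' = L1"
    proof -
      show "open Q'" unfolding Q'_def by auto
      show "Q' \<subseteq> Q" using D1(2) unfolding Q'_def by fastforce
      show "measure lebesgue Q' = L1"
        unfolding Q'_def L1_def using measure_disjoint_intervals[OF D1(1) _ dj1] D1(2) by blast
    qed
    have L1: "m - e < L1" "L1 < m + e"
      using D1(4) mQ sum_lengths_le_measure[OF D1(1) _ dj1 Ql] D1(2)
      unfolding L1_def by (fastforce)+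
    have Q'l: "Q' \<in> lmeasurable"
      using fmeasurable_Int_fmeasurable[OF Ql, of Q'] Q' by (simp add: Int_absorb1)
    have "L1 \<le> measure lebesgue (E \<inter> Q') + e"
    proof -
      have "measure lebesgue Q' \<le> measure lebesgue ((E \<inter> Q') \<union> (Q - E))"
        using Q'l Q' E Ql by (intro measure_mono_fmeasurable) auto
      also have "\<dots> \<le> measure lebesgue (E \<inter> Q') + measure lebesgue (Q - E)"
        using Ql Es Q'l by (intro measure_Un_le) auto
      finally show ?thesis using Q' Q(4) by simp
    qed
    then have Q'E: "L1 \<le> measure lebesgue (E \<inter> Q') + e" .
    have EQ': "E \<inter> Q' \<in> lmeasurable" using E Q'l by (intro fmeasurable_Int_fmeasurable fmeasurableD)
    obtain D2 where D2: "finite D2" "\<And>y z. (y, z) \<in> D2 \<Longrightarrow> y < z \<and> {y..z} \<subseteq> Q' \<and> P2 y z"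
      "disjoint_family_on (\<lambda>(y, z). {y..z}) D2" "measure lebesgue (E \<inter> Q') < (\<Sum>(y, z)\<in>D2. z - y) + e"
    proof (rule Vitali_finite_intervals[OF EQ' Q'(1) _ _ e(1), of P2])
      show "E \<inter> Q' \<subseteq> Q'" "\<And>x. x \<in> E \<inter> Q' \<Longrightarrow> fine_at P2 x" by (auto simp: E_def)
    qed (blast intro: that)
    define L2 where "L2 = (\<Sum>(y, z)\<in>D2. z - y)"
    note dj2 = disjoint_open_of_closed[OF D2(3)]
    have L2: "L2 > L1 - 2 * e" using Q'E D2(4) unfolding L2_def by linarith
    have "{a<..<b} \<noteq> {}" using m Q(2,3) by (force simp: m_def)
    then have ab: "a < b" by auto
    have in1: "\<forall>(x, y)\<in>D1. a \<le> x \<and> x < y \<and> y \<le> b" "\<forall>(x, y)\<in>D2. a \<le> x \<and> x < y \<and> y \<le> b"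
    proof -
      have "a \<le> x \<and> y \<le> b" if "x < y" "{x..y} \<subseteq> {a<..<b}" for x y
        using that by (auto simp: subset_iff less_imp_le)
      then show "\<forall>(x, y)\<in>D1. a \<le> x \<and> x < y \<and> y \<le> b" "\<forall>(x, y)\<in>D2. a \<le> x \<and> x < y \<and> y \<le> b"
        using D1(2) D2(2) Q(3) Q'(2) by blast+
    qed
    \<comment> \<open>\<open>D'\<close> is the complement of \<open>D2\<close> in \<open>D1\<close>, obtained by complementing twice: \<open>H\<close> is the complement of
      \<open>D1\<close> in \<open>[a, b]\<close>, and \<open>D'\<close> is that of \<open>H \<union> D2\<close>.\<close>
    obtain H where H: "finite H" "\<forall>(x, y)\<in>H. a \<le> x \<and> x < y \<and> y \<le> b" "D1 \<inter> H = {}"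
      "disjoint_family_on (\<lambda>(x, y). {x<..<y}) (D1 \<union> H)"
      "\<And>u::real \<Rightarrow> real. (\<Sum>(x, y)\<in>H. u y - u x) = (u b - u a) - (\<Sum>(x, y)\<in>D1. u y - u x)"
      using complementary_intervals[OF D1(1) in1(1) dj1 less_imp_le[OF ab]] by blast
    have HD1: "{x<..<y} \<inter> Q' = {}" if "(x, y) \<in> H" for x y
    proof -
      have "{x<..<y} \<inter> {x'<..<y'} = {}" if "(x', y') \<in> D1" for x' y'
      proof -
        have "(x, y) \<noteq> (x', y')" using H(3) that \<open>(x, y) \<in> H\<close> by blast
        then show ?thesis using H(4) that \<open>(x, y) \<in> H\<close> unfolding disjoint_family_on_def by fastforce
      qed
      then show ?thesis unfolding Q'_def by blast
    qed
    have HD2: "{x<..<y} \<inter> {x'<..<y'} = {}" if "(x, y) \<in> H" "(x', y') \<in> D2" for x y x' y'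
      using HD1[OF that(1)] D2(2)[OF that(2)] by fastforce
    have H2: "H \<inter> D2 = {}"
    proof -
      have False if "(x, y) \<in> H" "(x, y) \<in> D2" for x y
        using HD2[OF that] H(2) that(1) by auto
      then show ?thesis by auto
    qed
    have djH2: "disjoint_family_on (\<lambda>(x, y). {x<..<y}) (H \<union> D2)"
      unfolding disjoint_family_on_def
    proof (intro ballI impI)
      fix i j assume ij: "i \<in> H \<union> D2" "j \<in> H \<union> D2" "i \<noteq> j"
      consider "i \<in> H" "j \<in> H" | "i \<in> D2" "j \<in> D2" | "i \<in> H" "j \<in> D2" | "i \<in> D2" "j \<in> H" using ij by blast
      then show "(case i of (x, y) \<Rightarrow> {x<..<y}) \<inter> (case j of (x, y) \<Rightarrow> {x<..<y}) = {}"
      proof cases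
        case 1
        then show ?thesis using H(4) ij(3) unfolding disjoint_family_on_def by blast
      next
        case 2
        then show ?thesis using dj2 ij(3) unfolding disjoint_family_on_def by blast
      next
        case 3
        then show ?thesis using HD2 by (cases i; cases j) auto
      next
        case 4
        then obtain x y x' y' where "i = (x, y)" "j = (x', y')" "(x', y') \<in> H" "(x, y) \<in> D2" by (metis surj_pair)
        then show ?thesis using HD2[of x' y' x y] by (simp only: prod.case) blast
      qed
    qed
    have fHD: "finite (H \<union> D2)" and inHD: "\<forall>(x, y)\<in>H \<union> D2. a \<le> x \<and> x < y \<and> y \<le> b"
      using H(1,2) D2(1) in1(2) by auto
    obtain D' where D': "finite D'" "\<forall>(x, y)\<in>D'. a \<le> x \<and> x < y \<and> y \<le> b"
      "disjoint_family_on (\<lambda>(x, y). {x<..<y}) (H \<union> D2 \<union> D')"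
      "\<And>u::real \<Rightarrow> real. (\<Sum>(x, y)\<in>D'. u y - u x) = (u b - u a) - (\<Sum>(x, y)\<in>H \<union> D2. u y - u x)"
      using complementary_intervals[OF fHD inHD djH2 less_imp_le[OF ab]] by blast
    have sums: "(\<Sum>(x, y)\<in>D'. v y - v x) = (\<Sum>(x, y)\<in>D1. v y - v x) - (\<Sum>(x, y)\<in>D2. v y - v x)" for v :: "real \<Rightarrow> real"
      using D'(4)[of v] H(5)[of v] sum.union_disjoint[OF H(1) D2(1) H2, of "\<lambda>(x, y). v y - v x"] by simp
    have djD': "disjoint_family_on (\<lambda>(x, y). {x<..<y}) D'"
      using D'(3) by (rule disjoint_family_on_mono[rotated]) auto
    have "(\<Sum>(x, y)\<in>D'. y - x) = L1 - L2" using sums[of "\<lambda>x. x"] by (simp add: L1_def L2_def)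
    also have "\<dots> < \<delta>" using L2 e by linarith
    finally have "(\<Sum>(x, y)\<in>D'. \<bar>u y - u x\<bar>) < \<eta>" using acd D'(1,2) djD' by blast
    moreover have "\<bar>\<Sum>(x, y)\<in>D'. u y - u x\<bar> \<le> (\<Sum>(x, y)\<in>D'. \<bar>u y - u x\<bar>)"
      using sum_abs[of "\<lambda>(x, y). u y - u x" D'] by (simp add: split_beta)
    ultimately have "(\<Sum>(x, y)\<in>D2. u y - u x) - (\<Sum>(x, y)\<in>D1. u y - u x) < \<eta>"
      using sums[of u] by linarith
    moreover have "(\<Sum>(x, y)\<in>D1. u y - u x) \<le> p * L1"
      unfolding L1_def sum_distrib_left using D1(2) by (intro sum_mono) (auto simp: P1_def less_imp_le)
    moreover have "q * L2 \<le> (\<Sum>(x, y)\<in>D2. u y - u x)"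
      unfolding L2_def sum_distrib_left using D2(2) by (intro sum_mono) (auto simp: P2_def less_imp_le)
    ultimately have *: "q * L2 - p * L1 < \<eta>" by linarith
    have "\<bar>q\<bar> * (L1 - L2) \<le> \<bar>q\<bar> * (4 * e)" using L2 e(1) by (intro mult_left_mono) auto
    moreover have "q * (L1 - L2) \<le> \<bar>q\<bar> * (L1 - L2)"
    proof -
      have "measure lebesgue Q' \<ge> L2"
        unfolding L2_def using D2(2) by (intro sum_lengths_le_measure[OF D2(1) _ dj2 Q'l]) fastforce
      then show ?thesis using Q'(3) by (intro mult_right_mono) auto
    qed
    moreover have "(q - p) * (m - e) \<le> (q - p) * L1" using L1 pq by (intro mult_left_mono) auto
    ultimately have "(q - p) * m - e * c < \<eta>" using * by (simp add: c_def algebra_simps)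
    then show False using e(3) unfolding \<eta>_def by linarith
  qed
  then show ?thesis unfolding E_def P1_def P2_def by blast
qed

lemma AC_uminus: "abs_continuous_on a b u \<Longrightarrow> abs_continuous_on a b (\<lambda>x. - u x)"
  unfolding abs_continuous_on_def by (simp add: abs_minus_commute)

text \<open>
  Locally, on an interval shorter than the \<open>\<delta>\<close> that belongs to \<open>\<epsilon> = 1\<close>, the total variation is at most
  1, so intervals of slope above \<open>n\<close> have total length at most \<open>1 / n\<close>.
\<close>

lemma AC_infinite_slope_negligible:
  assumes ac: "abs_continuous_on a b u"
  shows "negligible {x\<in>{a<..<b}. \<forall>n::nat. fine_at (\<lambda>y z. u z - u y > real n * (z - y)) x}"
proof -
  define P where "P = (\<lambda>n::nat. \<lambda>y z. u z - u y > real n * (z - y))"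
  define E where "E = {x\<in>{a<..<b}. \<forall>n. fine_at (P n) x}"
  have Eeq: "E = {a<..<b} \<inter> (\<Inter>n. {x. fine_at (P n) x})" by (auto simp: E_def)
  have Es: "E \<in> sets lebesgue"
    unfolding Eeq using sets_fine_at by (intro sets.Int sets.countable_INT'') auto
  obtain \<delta> where \<delta>: "\<delta> > 0" and acd: "\<forall>D. finite D \<and> (\<forall>(x, y)\<in>D. a \<le> x \<and> x < y \<and> y \<le> b) \<and>
        disjoint_family_on (\<lambda>(x, y). {x<..<y}) D \<and> (\<Sum>(x, y)\<in>D. y - x) < \<delta> \<longrightarrow>
        (\<Sum>(x, y)\<in>D. \<bar>u y - u x\<bar>) < 1"
    using AC_modulus[OF ac zero_less_one] by auto
  have "negligible (E \<inter> ball x (\<delta> / 3))" if "x \<in> E" for x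
  proof (rule ccontr)
    assume "\<not> negligible (E \<inter> ball x (\<delta> / 3))"
    let ?S = "E \<inter> ball x (\<delta> / 3)" and ?Q = "{a<..<b} \<inter> ball x (\<delta> / 3)"
    have S: "?S \<in> lmeasurable"
      using Es by (intro bounded_set_imp_lmeasurable) (auto intro: bounded_subset[of "ball x (\<delta> / 3)"])
    define m where "m = measure lebesgue ?S"
    have m: "m > 0" using S \<open>\<not> negligible ?S\<close> by (simp add: m_def negligible_iff_measure zero_less_measure_iff)
    obtain n :: nat where n: "real n > 2 / m" using reals_Archimedean2 by blast
    obtain D where D: "finite D" "\<And>y z. (y, z) \<in> D \<Longrightarrow> y < z \<and> {y..z} \<subseteq> ?Q \<and> P n y z"
      "disjoint_family_on (\<lambda>(y, z). {y..z}) D" "m < (\<Sum>(y, z)\<in>D. z - y) + m / 2"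
    proof (rule Vitali_finite_intervals[OF S, of ?Q "P n" "m / 2"])
      show "open ?Q" "?S \<subseteq> ?Q" "\<And>x. x \<in> ?S \<Longrightarrow> fine_at (P n) x" "m / 2 > 0"
        using m by (auto simp: E_def)
    qed (auto simp: m_def intro: that)
    note dj = disjoint_open_of_closed[OF D(3)]
    have "(\<Sum>(y, z)\<in>D. z - y) \<le> measure lebesgue (ball x (\<delta> / 3))"
    proof (rule sum_lengths_le_measure[OF D(1) _ dj lmeasurable_ball])
      fix y z assume "(y, z) \<in> D"
      then have "y < z \<and> {y..z} \<subseteq> ?Q" using D(2) by blast
      moreover have "{y<..<z} \<subseteq> {y..z}" by auto
      ultimately show "y < z \<and> {y<..<z} \<subseteq> ball x (\<delta> / 3)" by blast
    qed
    also have "ball x (\<delta> / 3) = {x - \<delta> / 3<..<x + \<delta> / 3}" by (rule ball_eq_greaterThanLessThan)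
    also have "measure lebesgue \<dots> < \<delta>" using \<delta> by simp
    finally have len: "(\<Sum>(y, z)\<in>D. z - y) < \<delta>" .
    have in_ab: "\<forall>(x, y)\<in>D. a \<le> x \<and> x < y \<and> y \<le> b"
    proof -
      have "a \<le> x \<and> y \<le> b" if "x < y" "{x..y} \<subseteq> {a<..<b}" for x y
        using that by (auto simp: subset_iff less_imp_le)
      then show ?thesis using D(2) by blast
    qed
    have "(\<Sum>(x, y)\<in>D. \<bar>u y - u x\<bar>) < 1"
      using D(1) dj in_ab len acd by blast
    moreover have "real n * (\<Sum>(y, z)\<in>D. z - y) \<le> (\<Sum>(x, y)\<in>D. \<bar>u y - u x\<bar>)"
      unfolding sum_distrib_left using D(2) by (intro sum_mono) (fastforce simp: P_def)
    moreover have "real n * (m / 2) \<le> real n * (\<Sum>(y, z)\<in>D. z - y)"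
      using D(4) by (intro mult_left_mono) auto
    moreover have "1 < real n * (m / 2)" using n m by (simp add: field_simps)
    ultimately show False by linarith
  qed
  then have "negligible E"
    unfolding locally_negligible_alt[of E]
    using \<delta> by (metis openin_open_Int open_ball IntI centre_in_ball divide_pos_pos zero_less_numeral)
  then show ?thesis by (simp add: E_def P_def)
qed

lemma AC_imp_continuous_on:
  assumes ac: "abs_continuous_on a b u"
  shows "continuous_on {a..b} u"
  unfolding continuous_on_iff
proof (intro ballI allI impI)
  fix x e :: real assume x: "x \<in> {a..b}" and "e > 0"
  obtain \<delta> where \<delta>: "\<delta> > 0" and acd: "\<forall>D. finite D \<and> (\<forall>(x, y)\<in>D. a \<le> x \<and> x < y \<and> y \<le> b) \<and>
        disjoint_family_on (\<lambda>(x, y). {x<..<y}) D \<and> (\<Sum>(x, y)\<in>D. y - x) < \<delta> \<longrightarrow>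
        (\<Sum>(x, y)\<in>D. \<bar>u y - u x\<bar>) < e"
    using AC_modulus[OF ac \<open>e > 0\<close>] by auto
  have *: "\<bar>u z - u y\<bar> < e" if "a \<le> y" "y < z" "z \<le> b" "z - y < \<delta>" for y z
    using acd[rule_format, of "{(y, z)}"] that by (auto simp: disjoint_family_on_def)
  show "\<exists>d>0. \<forall>x'\<in>{a..b}. dist x' x < d \<longrightarrow> dist (u x') (u x) < e"
  proof (intro exI conjI ballI impI)
    fix x' assume x': "x' \<in> {a..b}" "dist x' x < \<delta>"
    consider "x' = x" | "x' < x" | "x < x'" by linarith
    then show "dist (u x') (u x) < e"
      using *[of x x'] *[of x' x] x x' \<open>e > 0\<close> by cases (auto simp: dist_real_def)
  qed (rule \<delta>)
qed

text \<open>
  Differentiability in the form in which it is used for Riemann sums and obtained from coverings: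
  the difference quotients over small intervals around \<open>x\<close> tend to \<open>L\<close>.
\<close>

definition straddle_deriv :: "(real \<Rightarrow> real) \<Rightarrow> real \<Rightarrow> real \<Rightarrow> bool" where
  "straddle_deriv u L x \<longleftrightarrow> (\<forall>e>0. \<exists>d>0. \<forall>y z. y < x \<longrightarrow> x < z \<longrightarrow> z - y < d \<longrightarrow>
      \<bar>u z - u y - L * (z - y)\<bar> \<le> e * (z - y))"

text \<open>
  By continuity of \<open>u\<close> at \<open>x\<close>, intervals with end point \<open>x\<close> may be admitted. This turns a straddled
  derivative into an ordinary one, and it allows tags at the ends of an interval.
\<close>

lemma straddle_deriv_closed:
  assumes s: "straddle_deriv u L x" and c: "isCont u x" and "e > 0"
  obtains d where "d > 0" "\<And>y z. y \<le> x \<Longrightarrow> x \<le> z \<Longrightarrow> z - y < d \<Longrightarrow>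
      \<bar>u z - u y - L * (z - y)\<bar> \<le> e * (z - y)"
proof -
  from s \<open>e > 0\<close> obtain d where "d > 0" and d: "\<And>y z. y < x \<Longrightarrow> x < z \<Longrightarrow> z - y < d \<Longrightarrow>
      \<bar>u z - u y - L * (z - y)\<bar> \<le> e * (z - y)"
    unfolding straddle_deriv_def by metis
  have "\<bar>u z - u y - L * (z - y)\<bar> \<le> e * (z - y)" if yz: "y \<le> x" "x \<le> z" "z - y < d" for y z
  proof (cases "y < z")
    case False
    then have "y = x" "z = x" using yz by auto
    then show ?thesis by simp
  next
    case True
    define r where "r = (d - (z - y)) / 2"
    have r: "r > 0" using yz by (simp add: r_def)
    define Y where "Y n = (if y < x then y else x - r / real (Suc n))" for n
    define Z where "Z n = (if x < z then z else x + r / real (Suc n))" for n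
    have lim: "(\<lambda>n. r / real (Suc n)) \<longlonglongrightarrow> 0" by (rule LIMSEQ_Suc[OF lim_const_over_n])
    have Y: "Y \<longlonglongrightarrow> y"
    proof (cases "y < x")
      case False
      then have "y = x" using yz by simp
      then show ?thesis using tendsto_diff[OF tendsto_const[of x] lim] by (simp add: Y_def[abs_def])
    qed (simp add: Y_def[abs_def])
    have Z: "Z \<longlonglongrightarrow> z"
    proof (cases "x < z")
      case False
      then have "z = x" using yz by simp
      then show ?thesis using tendsto_add[OF tendsto_const[of x] lim] by (simp add: Z_def[abs_def])
    qed (simp add: Z_def[abs_def])
    have uY: "(\<lambda>n. u (Y n)) \<longlonglongrightarrow> u y"
    proof (cases "y < x")
      case False
      then have "y = x" using yz by simp
      then show ?thesis using isCont_tendsto_compose[OF c] Y by blast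
    qed (simp add: Y_def[abs_def])
    have uZ: "(\<lambda>n. u (Z n)) \<longlonglongrightarrow> u z"
    proof (cases "x < z")
      case False
      then have "z = x" using yz by simp
      then show ?thesis using isCont_tendsto_compose[OF c] Z by blast
    qed (simp add: Z_def[abs_def])
    have "\<bar>u (Z n) - u (Y n) - L * (Z n - Y n)\<bar> \<le> e * (Z n - Y n)" for n
    proof (rule d)
      show "Y n < x" "x < Z n" using r by (auto simp: Y_def Z_def)
      have "r / real (Suc n) \<le> r" using r by (simp add: field_simps)
      then have "y - r \<le> Y n" "Z n \<le> z + r" using yz r by (auto simp: Y_def Z_def)
      have "Z n - Y n < d" if "y < x"
        using that \<open>Z n \<le> z + r\<close> r by (simp add: Y_def r_def field_simps)
      moreover have "Z n - Y n < d" if "x < z"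
        using that \<open>y - r \<le> Y n\<close> r by (simp add: Z_def r_def field_simps)
      ultimately show "Z n - Y n < d" using yz True by linarith
    qed
    moreover have "(\<lambda>n. \<bar>u (Z n) - u (Y n) - L * (Z n - Y n)\<bar>) \<longlonglongrightarrow> \<bar>u z - u y - L * (z - y)\<bar>"
      by (intro tendsto_intros uZ uY Z Y)
    moreover have "(\<lambda>n. e * (Z n - Y n)) \<longlonglongrightarrow> e * (z - y)" by (intro tendsto_intros Z Y)
    ultimately show ?thesis by (meson LIMSEQ_le)
  qed
  then show thesis using that \<open>d > 0\<close> by blast
qed

lemma straddle_deriv_imp_deriv:
  assumes s: "straddle_deriv u L x" and c: "isCont u x"
  shows "(u has_real_derivative L) (at x)"
  unfolding has_field_derivative_def has_derivative_within_alt
proof (intro conjI allI impI)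
  show "bounded_linear ((*) L)" by (rule bounded_linear_mult_right)
  fix e :: real assume "e > 0"
  from straddle_deriv_closed[OF s c this] obtain d where d: "d > 0" "\<And>y z. y \<le> x \<Longrightarrow> x \<le> z \<Longrightarrow> z - y < d \<Longrightarrow>
      \<bar>u z - u y - L * (z - y)\<bar> \<le> e * (z - y)" by blast
  show "\<exists>d>0. \<forall>y\<in>UNIV. norm (y - x) < d \<longrightarrow> norm (u y - u x - L * (y - x)) \<le> e * norm (y - x)"
  proof (intro exI conjI ballI impI)
    fix y assume "norm (y - x) < d"
    then show "norm (u y - u x - L * (y - x)) \<le> e * norm (y - x)"
      using d(2)[of x y] d(2)[of y x] by (cases "x \<le> y") (auto simp: abs_if algebra_simps split: if_splits)
  qed (rule d)
qed

lemma not_fine_at: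
  "\<not> fine_at P x \<longleftrightarrow> (\<exists>d>0. \<forall>y z. y < x \<longrightarrow> x < z \<longrightarrow> z - y < d \<longrightarrow> \<not> P y z)"
  unfolding fine_at_def by blast

text \<open>
  The derivative is the supremum of the eventual lower bounds of the difference quotients: a number
  slightly above this supremum is not an eventual lower bound, so by the hypothesis \<open>two\<close> a slightly
  larger number is an eventual upper bound.
\<close>

lemma straddle_deriv_of_slopes:
  assumes two: "\<And>p q. p \<in> \<rat> \<Longrightarrow> q \<in> \<rat> \<Longrightarrow> p < q \<Longrightarrow>
      \<not> (fine_at (\<lambda>y z. u z - u y < p * (z - y)) x \<and> fine_at (\<lambda>y z. u z - u y > q * (z - y)) x)"
    and up: "\<not> fine_at (\<lambda>y z. u z - u y > M * (z - y)) x"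
    and dn: "\<not> fine_at (\<lambda>y z. u z - u y < K * (z - y)) x"
  shows "\<exists>L. straddle_deriv u L x"
proof -
  define A where "A = {p. \<not> fine_at (\<lambda>y z. u z - u y < p * (z - y)) x}"
  have bd: "p \<le> M" if "p \<in> A" for p
  proof (rule ccontr)
    assume "\<not> p \<le> M"
    from that obtain d where d: "d > 0" "\<And>y z. y < x \<Longrightarrow> x < z \<Longrightarrow> z - y < d \<Longrightarrow> \<not> u z - u y < p * (z - y)"
      unfolding A_def not_fine_at by auto
    from up obtain d' where d': "d' > 0" "\<And>y z. y < x \<Longrightarrow> x < z \<Longrightarrow> z - y < d' \<Longrightarrow> \<not> u z - u y > M * (z - y)"
      unfolding not_fine_at by auto
    define r where "r = min d d' / 3"
    have r: "r > 0" "2 * r < d" "2 * r < d'" using d d' by (auto simp: r_def)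
    have "\<not> u (x + r) - u (x - r) < p * (2 * r)" using d(2)[of "x - r" "x + r"] r by simp
    moreover have "\<not> u (x + r) - u (x - r) > M * (2 * r)" using d'(2)[of "x - r" "x + r"] r by simp
    moreover have "M * (2 * r) < p * (2 * r)" using \<open>\<not> p \<le> M\<close> r by simp
    ultimately show False by linarith
  qed
  have ne: "K \<in> A" using dn by (simp add: A_def)
  define L where "L = Sup A"
  have bdd: "bdd_above A" using bd by (auto simp: bdd_above_def)
  have "straddle_deriv u L x"
    unfolding straddle_deriv_def
  proof (intro allI impI)
    fix e :: real assume "e > 0"
    then have "L - e < L" by simp
    then obtain p where p: "p \<in> A" "L - e < p" unfolding L_def using ne less_cSupE by blast
    from p(1) obtain d where d: "d > 0" "\<And>y z. y < x \<Longrightarrow> x < z \<Longrightarrow> z - y < d \<Longrightarrow> \<not> u z - u y < p * (z - y)"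
      unfolding A_def not_fine_at by auto
    obtain p1 where p1: "p1 \<in> \<rat>" "L < p1" "p1 < L + e" using Rats_dense_in_real[of L "L + e"] \<open>e > 0\<close> by auto
    obtain q1 where q1: "q1 \<in> \<rat>" "p1 < q1" "q1 < L + e" using Rats_dense_in_real[of p1 "L + e"] p1 by auto
    have "p1 \<notin> A" using p1(2) cSup_upper[OF _ bdd, of p1] unfolding L_def by linarith
    then have "\<not> fine_at (\<lambda>y z. u z - u y > q1 * (z - y)) x"
      using two[OF p1(1) q1(1,2)] by (simp add: A_def)
    then obtain d' where d': "d' > 0" "\<And>y z. y < x \<Longrightarrow> x < z \<Longrightarrow> z - y < d' \<Longrightarrow> \<not> u z - u y > q1 * (z - y)"
      unfolding not_fine_at by auto
    show "\<exists>d>0. \<forall>y z. y < x \<longrightarrow> x < z \<longrightarrow> z - y < d \<longrightarrow> \<bar>u z - u y - L * (z - y)\<bar> \<le> e * (z - y)"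
    proof (intro exI[of _ "min d d'"] conjI allI impI)
      fix y z assume yz: "y < x" "x < z" "z - y < min d d'"
      have "p * (z - y) \<ge> (L - e) * (z - y)" "q1 * (z - y) \<le> (L + e) * (z - y)"
        using p q1 yz by (auto intro: mult_right_mono)
      moreover have "p * (z - y) \<le> u z - u y" "u z - u y \<le> q1 * (z - y)"
        using d(2)[OF yz(1,2)] d'(2)[OF yz(1,2)] yz(3) by auto
      ultimately show "\<bar>u z - u y - L * (z - y)\<bar> \<le> e * (z - y)" by (simp add: abs_le_iff algebra_simps)
    qed (use d d' in auto)
  qed
  then show ?thesis by blast
qed

lemma AC_straddle_deriv_AE:
  assumes ac: "abs_continuous_on a b u"
  obtains N where "negligible N" "\<And>x. x \<in> {a..b} - N \<Longrightarrow> a < x \<and> x < b \<and> (\<exists>L. straddle_deriv u L x)"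
proof -
  define E where "E = (\<lambda>(p, q). {x\<in>{a<..<b}. fine_at (\<lambda>y z. u z - u y < p * (z - y)) x \<and>
                                   fine_at (\<lambda>y z. u z - u y > q * (z - y)) x})"
  define F where "F v = {x\<in>{a<..<b}. \<forall>n::nat. fine_at (\<lambda>y z. v z - v y > real n * (z - y)) x}" for v :: "real \<Rightarrow> real"
  define N where "N = (\<Union>i\<in>{(p, q). p \<in> \<rat> \<and> q \<in> \<rat> \<and> p < q}. E i) \<union> F u \<union> F (\<lambda>x. - u x) \<union> {a, b}"
  have "countable {(p, q). p \<in> \<rat> \<and> q \<in> \<rat> \<and> p < (q::real)}"
    by (rule countable_subset[of _ "\<rat> \<times> \<rat>"]) (auto intro: countable_rat)
  then have "negligible (\<Union>i\<in>{(p, q). p \<in> \<rat> \<and> q \<in> \<rat> \<and> p < q}. E i)"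
    using AC_two_slopes_negligible[OF ac] by (intro negligible_countable_Union) (auto simp: E_def)
  then have 1: "negligible N"
    unfolding N_def F_def using AC_infinite_slope_negligible[OF ac] AC_infinite_slope_negligible[OF AC_uminus[OF ac]]
    by (intro negligible_Un) auto
  have 2: "a < x \<and> x < b \<and> (\<exists>L. straddle_deriv u L x)" if x: "x \<in> {a..b} - N" for x
  proof -
    have ab: "x \<in> {a<..<b}" using x by (auto simp: N_def)
    have "x \<notin> F u" using x by (auto simp: N_def)
    then obtain n where n: "\<not> fine_at (\<lambda>y z. u z - u y > real n * (z - y)) x"
      using ab unfolding F_def by blast
    have "x \<notin> F (\<lambda>x. - u x)" using x by (auto simp: N_def)
    then obtain k where "\<not> fine_at (\<lambda>y z. - u z - - u y > real k * (z - y)) x"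
      using ab unfolding F_def by blast
    moreover have "(- u z - - u y > real k * (z - y)) = (u z - u y < - real k * (z - y))" for y z
      by (simp add: algebra_simps)
    ultimately have k: "\<not> fine_at (\<lambda>y z. u z - u y < - real k * (z - y)) x" by simp
    have "\<not> (fine_at (\<lambda>y z. u z - u y < p * (z - y)) x \<and> fine_at (\<lambda>y z. u z - u y > q * (z - y)) x)"
      if "p \<in> \<rat>" "q \<in> \<rat>" "p < q" for p q
    proof -
      have "x \<notin> E (p, q)" using x that unfolding N_def by blast
      then show ?thesis using ab by (simp add: E_def)
    qed
    from straddle_deriv_of_slopes[OF this n k] ab show ?thesis by auto
  qed
  show thesis using that[OF 1 2] .
qed

text \<open>
  The gauge distinguishes the tags. At a point of differentiability it makes the increment of \<open>u\<close>
  over the interval agree with derivative times length up to \<open>\<epsilon>\<close> times length. At a point of the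
  exceptional null set \<open>N\<close> it keeps the interval inside an open set \<open>U\<close> of measure below \<open>\<delta>\<close>, so that
  absolute continuity makes the increments over all these intervals small together.
\<close>

theorem AC_deriv_has_integral:
  assumes ac: "abs_continuous_on a b u" and "a \<le> b"
  shows "(deriv u has_integral u b - u a) {a..b}"
proof -
  obtain N where N: "negligible N" and D: "\<And>x. x \<in> {a..b} - N \<Longrightarrow> a < x \<and> x < b \<and> (\<exists>L. straddle_deriv u L x)"
    using AC_straddle_deriv_AE[OF ac] by blast
  have ct: "isCont u x" if "x \<in> {a..b} - N" for x
    using AC_imp_continuous_on[OF ac] D[OF that] by (intro continuous_on_interior) auto
  have sd: "straddle_deriv u (deriv u x) x" if x: "x \<in> {a..b} - N" for x
  proof -
    from D[OF x] obtain L where L: "straddle_deriv u L x" by blast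
    from straddle_deriv_imp_deriv[OF L ct[OF x]] have "deriv u x = L" by (rule DERIV_imp_deriv)
    with L show ?thesis by simp
  qed
  define v where "v x = (if x \<in> N then 0 else deriv u x)" for x
  have "(v has_integral u b - u a) {a..b}"
    unfolding has_integral_real
  proof (intro allI impI)
    fix e :: real assume "e > 0"
    define \<epsilon> where "\<epsilon> = e / (2 * (b - a + 1))"
    have \<epsilon>: "\<epsilon> > 0" using \<open>e > 0\<close> \<open>a \<le> b\<close> by (simp add: \<epsilon>_def)
    have "e / 2 > 0" using \<open>e > 0\<close> by simp
    obtain \<delta> where \<delta>: "\<delta> > 0" and acd: "\<forall>D. finite D \<and> (\<forall>(x, y)\<in>D. a \<le> x \<and> x < y \<and> y \<le> b) \<and>
          disjoint_family_on (\<lambda>(x, y). {x<..<y}) D \<and> (\<Sum>(x, y)\<in>D. y - x) < \<delta> \<longrightarrow>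
          (\<Sum>(x, y)\<in>D. \<bar>u y - u x\<bar>) < e / 2"
      using AC_modulus[OF ac \<open>e / 2 > 0\<close>] by auto
    obtain U where U: "open U" "N \<subseteq> U" "U \<in> lmeasurable" "measure lebesgue U < \<delta>"
    proof -
      obtain T where T: "open T" "N \<subseteq> T" "T - N \<in> lmeasurable" "emeasure lebesgue (T - N) < ennreal \<delta>"
        using sets_lebesgue_outer_open[OF _ \<delta>, of N] N negligible_imp_sets by metis
      have "T = (T - N) \<union> N" using T by auto
      then have "T \<in> lmeasurable" using T(3) N by (metis fmeasurable.Un negligible_imp_measurable)
      moreover have "measure lebesgue T = measure lebesgue (T - N)"
        using N by (simp add: measure_Diff_null_set negligible_iff_null_sets \<open>T \<in> lmeasurable\<close> fmeasurableD)
      moreover have "measure lebesgue (T - N) < \<delta>"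
        using T(3,4) \<delta> by (simp add: emeasure_eq_measure2 ennreal_less_iff)
      ultimately show thesis using T that by metis
    qed
    have "\<exists>d>0. if x \<in> N then ball x d \<subseteq> U
       else x \<in> {a..b} \<longrightarrow> (\<forall>y z. y \<le> x \<longrightarrow> x \<le> z \<longrightarrow> z - y < d \<longrightarrow> \<bar>u z - u y - v x * (z - y)\<bar> \<le> \<epsilon> * (z - y))" for x
    proof (cases "x \<in> N")
      case True
      then show ?thesis using U open_contains_ball by (metis subsetD)
    next
      case False
      show ?thesis
      proof (cases "x \<in> {a..b}")
        case True
        with False have x: "x \<in> {a..b} - N" by simp
        show ?thesis using straddle_deriv_closed[OF sd[OF x] ct[OF x] \<epsilon>] False
          by (smt (verit, best) v_def)
      qed (use False in \<open>auto intro: exI[of _ 1]\<close>)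
    qed
    then obtain d where d0: "\<And>x. d x > 0" and dN: "\<And>x. x \<in> N \<Longrightarrow> ball x (d x) \<subseteq> U"
      and dn: "\<And>x y z. x \<notin> N \<Longrightarrow> x \<in> {a..b} \<Longrightarrow> y \<le> x \<Longrightarrow> x \<le> z \<Longrightarrow> z - y < d x \<Longrightarrow>
          \<bar>u z - u y - v x * (z - y)\<bar> \<le> \<epsilon> * (z - y)"
      by metis
    define \<gamma> where "\<gamma> x = ball x (d x / 2)" for x
    have "gauge \<gamma>" unfolding \<gamma>_def using d0 by (intro gauge_ball_dependent) auto
    moreover have "norm ((\<Sum>(x, k)\<in>\<D>. measure lborel k *\<^sub>R v x) - (u b - u a)) < e"
      if p: "\<D> tagged_division_of {a..b}" "\<gamma> fine \<D>" for \<D>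
    proof -
      note tag = tagged_division_ofD[OF p(1)[folded cbox_interval]]
      define I where "I = (\<lambda>(x :: real, k :: real set). (Inf k, Sup k))"
      have k: "\<exists>y z. k = {y..z} \<and> y \<le> x \<and> x \<le> z \<and> a \<le> y \<and> z \<le> b \<and> Inf k = y \<and> Sup k = z \<and> z - y < d x"
        if xk: "(x, k) \<in> \<D>" for x k
      proof -
        from tag(4)[OF xk] obtain y z where yz: "k = {y..z}" by (auto simp: cbox_interval)
        have "x \<in> k" "k \<subseteq> {a..b}" using tag(2,3)[OF xk] by (auto simp: cbox_interval)
        moreover have "k \<subseteq> ball x (d x / 2)" using p(2) xk unfolding fine_def \<gamma>_def by blast
        ultimately show ?thesis unfolding yz
          by (intro exI[of _ y] exI[of _ z]) (auto simp: dist_real_def subset_iff abs_if split: if_splits; smt (verit))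
      qed
      have tele: "(\<Sum>(x, k)\<in>\<D>. u (Sup k) - u (Inf k)) = u b - u a"
        using additive_tagged_division_1[OF \<open>a \<le> b\<close> p(1), of u] by simp
      have len: "(\<Sum>(x, k)\<in>\<D>. Sup k - Inf k) = b - a"
        using additive_tagged_division_1[OF \<open>a \<le> b\<close> p(1), of "\<lambda>x. x"] by simp
      define \<D>N where "\<D>N = {(x, k)\<in>\<D>. x \<in> N \<and> Inf k < Sup k}"
      have fin: "finite \<D>" "\<D>N \<subseteq> \<D>" "finite \<D>N" using tag(1) by (auto simp: \<D>N_def intro: finite_subset)
      have dj: "{Inf k<..<Sup k} \<inter> {Inf k'<..<Sup k'} = {}"
        if xk: "(x, k) \<in> \<D>" and xk': "(x', k') \<in> \<D>" and ne: "(x, k) \<noteq> (x', k')" for x k x' k'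
      proof -
        obtain y z where yz: "k = {y..z}" "Inf k = y" "Sup k = z" using k[OF xk] by blast
        obtain y' z' where yz': "k' = {y'..z'}" "Inf k' = y'" "Sup k' = z'" using k[OF xk'] by blast
        show ?thesis using tag(5)[OF xk xk' ne] unfolding yz(2,3) yz'(2,3) unfolding yz(1) yz'(1) by simp
      qed
      have inj: "inj_on I \<D>N"
      proof (rule inj_onI, rule ccontr)
        fix i j assume ij: "i \<in> \<D>N" "j \<in> \<D>N" "I i = I j" "i \<noteq> j"
        obtain x k x' k' where e: "i = (x, k)" "j = (x', k')" by fastforce
        then have "{Inf k<..<Sup k} \<inter> {Inf k'<..<Sup k'} = {}" using dj ij fin(2) by blast
        then show False using ij(1-3) by (auto simp: e I_def \<D>N_def)
      qed
      have djI: "disjoint_family_on (\<lambda>(x, y). {x<..<y}) (I ` \<D>N)"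
        unfolding disjoint_family_on_def
      proof (intro ballI impI)
        fix i j assume ij: "i \<in> I ` \<D>N" "j \<in> I ` \<D>N" "i \<noteq> j"
        then obtain x k x' k' where e: "(x, k) \<in> \<D>N" "i = (Inf k, Sup k)" "(x', k') \<in> \<D>N" "j = (Inf k', Sup k')"
          unfolding I_def by force
        then have "(x, k) \<noteq> (x', k')" using ij by auto
        then show "(case i of (x, y) \<Rightarrow> {x<..<y}) \<inter> (case j of (x, y) \<Rightarrow> {x<..<y}) = {}"
          using dj[of x k x' k'] e fin(2) by auto
      qed
      have reidx: "(\<Sum>(x, y)\<in>I ` \<D>N. h x y) = (\<Sum>(x, k)\<in>\<D>N. h (Inf k) (Sup k))" for h :: "real \<Rightarrow> real \<Rightarrow> real"
        by (subst sum.reindex[OF inj]) (auto simp: I_def o_def split_beta)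
      have "(\<Sum>(x, y)\<in>I ` \<D>N. y - x) \<le> measure lebesgue U"
      proof (rule sum_lengths_le_measure[OF _ _ djI U(3)])
        fix x y assume "(x, y) \<in> I ` \<D>N"
        then obtain t k where tk: "(t, k) \<in> \<D>" "t \<in> N" "Inf k < Sup k" "x = Inf k" "y = Sup k"
          by (auto simp: I_def \<D>N_def)
        obtain y' z' where "k = {y'..z'}" "Inf k = y'" "Sup k = z'" using k[OF tk(1)] by blast
        then have "{x<..<y} \<subseteq> k" unfolding tk(4,5) by (simp only: greaterThanLessThan_subseteq_atLeastAtMost_iff) simp
        moreover have "k \<subseteq> ball t (d t / 2)" using p(2) tk unfolding fine_def \<gamma>_def by blast
        moreover have "ball t (d t / 2) \<subseteq> ball t (d t)" using d0[of t] by (intro subset_ball) simp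
        ultimately show "x < y \<and> {x<..<y} \<subseteq> U" using dN[OF tk(2)] tk by blast
      qed (use fin in simp)
      then have "(\<Sum>(x, y)\<in>I ` \<D>N. y - x) < \<delta>" using U(4) by linarith
      moreover have "\<forall>(x, y)\<in>I ` \<D>N. a \<le> x \<and> x < y \<and> y \<le> b"
      proof -
        have "a \<le> Inf k \<and> Inf k < Sup k \<and> Sup k \<le> b" if xk: "(x, k) \<in> \<D>N" for x k
        proof -
          have "(x, k) \<in> \<D>" "Inf k < Sup k" using xk by (auto simp: \<D>N_def)
          then show ?thesis using k[of x k] by metis
        qed
        then show ?thesis by (auto simp: I_def)
      qed
      ultimately have "(\<Sum>(x, y)\<in>I ` \<D>N. \<bar>u y - u x\<bar>) < e / 2" using acd djI fin(3) by blast
      then have small: "(\<Sum>(x, k)\<in>\<D>N. \<bar>u (Sup k) - u (Inf k)\<bar>) < e / 2" by (simp add: reidx)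
      have "norm ((\<Sum>(x, k)\<in>\<D>. measure lborel k *\<^sub>R v x) - (u b - u a))
          = \<bar>\<Sum>(x, k)\<in>\<D>. (u (Sup k) - u (Inf k)) - measure lborel k * v x\<bar>"
        unfolding tele[symmetric] by (simp add: split_beta sum_subtractf)
      also have "\<dots> \<le> (\<Sum>i\<in>\<D>. \<bar>case i of (x, k) \<Rightarrow> (u (Sup k) - u (Inf k)) - measure lborel k * v x\<bar>)"
        by (rule sum_abs)
      also have "\<dots> \<le> (\<Sum>i\<in>\<D>. (case i of (x, k) \<Rightarrow> \<epsilon> * (Sup k - Inf k)) +
           (if i \<in> \<D>N then (case i of (x, k) \<Rightarrow> \<bar>u (Sup k) - u (Inf k)\<bar>) else 0))"
      proof (rule sum_mono)
        fix i assume "i \<in> \<D>"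
        obtain x k where i: "i = (x, k)" by fastforce
        with \<open>i \<in> \<D>\<close> have xk: "(x, k) \<in> \<D>" by simp
        obtain y z where yz: "k = {y..z}" "y \<le> x" "x \<le> z" "a \<le> y" "z \<le> b" "Inf k = y" "Sup k = z" "z - y < d x"
          using k[OF xk] by blast
        have ck: "measure lborel k = z - y" using yz by simp
        have "0 \<le> \<epsilon> * (z - y)" using \<epsilon> yz by simp
        moreover have "\<bar>(u z - u y) - (z - y) * v x\<bar> \<le> \<epsilon> * (z - y)" if "x \<notin> N"
          using dn[OF that _ yz(2,3,8)] yz by (simp add: mult.commute)
        ultimately show "\<bar>case i of (x, k) \<Rightarrow> (u (Sup k) - u (Inf k)) - measure lborel k * v x\<bar> \<le>
          (case i of (x, k) \<Rightarrow> \<epsilon> * (Sup k - Inf k)) +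
           (if i \<in> \<D>N then (case i of (x, k) \<Rightarrow> \<bar>u (Sup k) - u (Inf k)\<bar>) else 0)"
          using xk yz by (cases "x \<in> N"; cases "y = z") (auto simp: i ck yz(6,7) \<D>N_def v_def)
      qed
      also have "\<dots> = \<epsilon> * (b - a) + (\<Sum>(x, k)\<in>\<D>N. \<bar>u (Sup k) - u (Inf k)\<bar>)"
      proof -
        have "(\<Sum>i\<in>\<D>. if i \<in> \<D>N then (case i of (x, k) \<Rightarrow> \<bar>u (Sup k) - u (Inf k)\<bar>) else 0)
            = (\<Sum>(x, k)\<in>\<D>N. \<bar>u (Sup k) - u (Inf k)\<bar>)"
          using fin by (simp add: sum.inter_restrict[symmetric] Int_absorb1)
        then show ?thesis using len by (simp add: sum.distrib sum_distrib_left[symmetric] split_beta)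
      qed
      also have "\<dots> < e"
      proof -
        have "\<epsilon> * (b - a) \<le> \<epsilon> * (b - a + 1)" using \<epsilon> by simp
        also have "\<dots> = e / 2" using \<open>a \<le> b\<close> by (simp add: \<epsilon>_def field_simps)
        finally show ?thesis using small by linarith
      qed
      finally show ?thesis .
    qed
    ultimately show "\<exists>\<gamma>. gauge \<gamma> \<and> (\<forall>\<D>. \<D> tagged_division_of {a..b} \<and> \<gamma> fine \<D> \<longrightarrow>
          norm ((\<Sum>(x, k)\<in>\<D>. measure lborel k *\<^sub>R v x) - (u b - u a)) < e)"
      by (intro exI[of _ \<gamma>] conjI allI impI) simp_all
  qed
  then show ?thesis
    by (rule has_integral_spike[OF N, rotated]) (simp add: v_def)
qed

section \<open>Regions between two graphs\<close>

definition between :: "real \<Rightarrow> real \<Rightarrow> (real \<Rightarrow> real) \<Rightarrow> (real \<Rightarrow> real) \<Rightarrow> (real \<times> real) set" where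
  "between a b u v = {(t, x). a < t \<and> t < b \<and> u t < x \<and> x < v t}"

text \<open>
  The map \<open>\<Phi>\<close>, which interpolates linearly between \<open>u t\<close> and \<open>v t\<close>, sends an open rectangle onto the
  region and the closed rectangle onto its closure; connectedness, boundedness and the frontier
  follow from this.
\<close>

lemma between_topology:
  fixes u v :: "real \<Rightarrow> real"
  assumes ab: "a < b" and u: "continuous_on {a..b} u" and v: "continuous_on {a..b} v"
    and less: "\<And>t. a < t \<Longrightarrow> t < b \<Longrightarrow> u t < v t"
    and ends: "u a = v a" "u b = v b"
  shows "open (between a b u v)" "connected (between a b u v)" "bounded (between a b u v)"
    "frontier (between a b u v) = (\<lambda>t. (t, u t)) ` {a..b} \<union> (\<lambda>t. (t, v t)) ` {a..b}"
proof -
  let ?R = "between a b u v"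
  define \<Phi> where "\<Phi> = (\<lambda>(t, r). (t, (1 - r) * u t + r * v t))"
  have u1: "continuous_on {a<..<b} u" and v1: "continuous_on {a<..<b} v"
    using u v continuous_on_subset greaterThanLessThan_subseteq_atLeastAtMost_iff[of a b a b] by blast+
  have c\<Phi>: "continuous_on ({a..b} \<times> {0..1}) \<Phi>"
    unfolding \<Phi>_def split_beta
    by (intro continuous_intros continuous_on_compose2[OF u] continuous_on_compose2[OF v]) auto
  have le: "u t \<le> v t" if "a \<le> t" "t \<le> b" for t
    using less[of t] ends that by (cases "t = a \<or> t = b") (auto simp: less_imp_le)
  have rep: "x = (1 - (x - p) / (q - p)) * p + (x - p) / (q - p) * q" if "p \<noteq> q" for p q x :: real
  proof -
    have "(x - p) / (q - p) * (q - p) = x - p" using that by simp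
    then show ?thesis by (simp only: left_diff_distrib right_diff_distrib)
  qed
  have conv: "\<exists>r. 0 < r \<and> r < 1 \<and> x = (1 - r) * p + r * q" if "p < x" "x < q" for p q x :: real
    by (intro exI[of _ "(x - p) / (q - p)"] conjI rep) (use that in auto)
  have conv': "\<exists>r. 0 \<le> r \<and> r \<le> 1 \<and> x = (1 - r) * p + r * q" if "p \<le> x" "x \<le> q" for p q x :: real
  proof (cases "p = q")
    case True
    with that show ?thesis by (intro exI[of _ 0]) auto
  next
    case False
    then show ?thesis
      by (intro exI[of _ "(x - p) / (q - p)"] conjI rep) (use that in auto)
  qed
  have R: "?R = \<Phi> ` ({a<..<b} \<times> {0<..<1})"
  proof (intro equalityI subsetI)
    fix p assume "p \<in> ?R"
    then obtain t x where p: "p = (t, x)" "a < t" "t < b" "u t < x" "x < v t" by (auto simp: between_def)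
    from conv[OF p(4,5)] obtain r where "0 < r" "r < 1" "x = (1 - r) * u t + r * v t" by blast
    with p show "p \<in> \<Phi> ` ({a<..<b} \<times> {0<..<1})"
      by (intro image_eqI[of _ _ "(t, r)"]) (auto simp: \<Phi>_def)
  next
    fix p assume "p \<in> \<Phi> ` ({a<..<b} \<times> {0<..<1})"
    then obtain t r where tr: "p = \<Phi> (t, r)" "a < t" "t < b" "0 < r" "r < 1" by auto
    have "0 < r * (v t - u t)" "0 < (1 - r) * (v t - u t)" using less[OF tr(2,3)] tr by auto
    then show "p \<in> ?R" using tr by (auto simp: \<Phi>_def between_def algebra_simps)
  qed
  have K: "\<Phi> ` ({a..b} \<times> {0..1}) = {(t, x). a \<le> t \<and> t \<le> b \<and> u t \<le> x \<and> x \<le> v t}"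
  proof (intro equalityI subsetI)
    fix p assume "p \<in> {(t, x). a \<le> t \<and> t \<le> b \<and> u t \<le> x \<and> x \<le> v t}"
    then obtain t x where p: "p = (t, x)" "a \<le> t" "t \<le> b" "u t \<le> x" "x \<le> v t" by auto
    from conv'[OF p(4,5)] obtain r where "0 \<le> r" "r \<le> 1" "x = (1 - r) * u t + r * v t" by blast
    with p show "p \<in> \<Phi> ` ({a..b} \<times> {0..1})"
      by (intro image_eqI[of _ _ "(t, r)"]) (auto simp: \<Phi>_def)
  next
    fix p assume "p \<in> \<Phi> ` ({a..b} \<times> {0..1})"
    then obtain t r where tr: "p = \<Phi> (t, r)" "a \<le> t" "t \<le> b" "0 \<le> r" "r \<le> 1" by auto
    have "0 \<le> r * (v t - u t)" "0 \<le> (1 - r) * (v t - u t)" using le[OF tr(2,3)] tr by auto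
    then show "p \<in> {(t, x). a \<le> t \<and> t \<le> b \<and> u t \<le> x \<and> x \<le> v t}"
      using tr by (auto simp: \<Phi>_def algebra_simps)
  qed
  have "?R = ({a<..<b} \<times> UNIV \<inter> (\<lambda>p. snd p - u (fst p)) -` {0<..}) \<inter>
             ({a<..<b} \<times> UNIV \<inter> (\<lambda>p. v (fst p) - snd p) -` {0<..})"
    by (auto simp: between_def)
  also have "open \<dots>"
    by (intro open_Int continuous_open_preimage continuous_intros continuous_on_compose2[OF u1]
          continuous_on_compose2[OF v1] open_Times) auto
  finally show op: "open ?R" .
  show "connected ?R"
    unfolding R by (rule connected_continuous_image[OF continuous_on_subset[OF c\<Phi>]])
      (auto intro!: connected_Times)
  have cK: "compact (\<Phi> ` ({a..b} \<times> {0..1}))"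
    by (intro compact_continuous_image c\<Phi> compact_Times) auto
  have RK: "?R \<subseteq> \<Phi> ` ({a..b} \<times> {0..1})" unfolding R by (intro image_mono Sigma_mono) auto
  then show "bounded ?R" using cK bounded_subset compact_imp_bounded by blast
  have "closure ?R = \<Phi> ` ({a..b} \<times> {0..1})"
  proof (rule closure_unique[OF RK compact_imp_closed[OF cK]])
    fix T assume T: "?R \<subseteq> T" "closed T"
    have cl: "closure ({a<..<b} \<times> {0<..<1::real}) = {a..b} \<times> {0..1}"
      using ab by (simp add: closure_Times)
    have "\<Phi> ` closure ({a<..<b} \<times> {0<..<1}) \<subseteq> T"
      by (rule image_closure_subset) (use c\<Phi> cl T R in auto)
    then show "\<Phi> ` ({a..b} \<times> {0..1}) \<subseteq> T" by (simp add: cl)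
  qed
  then have "frontier ?R = {(t, x). a \<le> t \<and> t \<le> b \<and> u t \<le> x \<and> x \<le> v t} - ?R"
    using op by (simp add: frontier_def interior_open K)
  also have "\<dots> = (\<lambda>t. (t, u t)) ` {a..b} \<union> (\<lambda>t. (t, v t)) ` {a..b}"
  proof -
    have "x = u t \<or> x = v t" if "a \<le> t" "t \<le> b" "u t \<le> x" "x \<le> v t" "\<not> (a < t \<and> t < b \<and> u t < x \<and> x < v t)" for t x
    proof -
      from that ab consider "t = a" | "t = b" | "u t = x" | "v t = x" by fastforce
      then show ?thesis using that ends by cases auto
    qed
    then have "p \<in> (\<lambda>t. (t, u t)) ` {a..b} \<union> (\<lambda>t. (t, v t)) ` {a..b}"
      if "p \<in> {(t, x). a \<le> t \<and> t \<le> b \<and> u t \<le> x \<and> x \<le> v t} - ?R" for p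
      using that by (cases p) (fastforce simp: between_def)
    then show ?thesis using le by (auto simp: between_def)
  qed
  finally show "frontier ?R = (\<lambda>t. (t, u t)) ` {a..b} \<union> (\<lambda>t. (t, v t)) ` {a..b}" .
qed

text \<open>
  From each point outside the region and its frontier a vertical ray avoids both, so a
  bounded domain with this frontier cannot contain such a point. The domain thus lies in the
  connected region, and it fills the region since its frontier does not meet it.
\<close>

lemma bounded_domain_unique:
  fixes u v :: "real \<Rightarrow> real"
  assumes ab: "a < b" and u: "continuous_on {a..b} u" and v: "continuous_on {a..b} v"
    and less: "\<And>t. a < t \<Longrightarrow> t < b \<Longrightarrow> u t < v t"
    and ends: "u a = v a" "u b = v b"
    and G: "open G" "connected G" "bounded G"
    and fr: "frontier G = (\<lambda>t. (t, u t)) ` {a..b} \<union> (\<lambda>t. (t, v t)) ` {a..b}"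
  shows "G = between a b u v"
proof -
  let ?R = "between a b u v"
  note top = between_topology[OF ab u v less ends]
  have GC: "G \<inter> frontier G = {}" using G(1) by (simp add: frontier_def interior_open)
  have le: "u t \<le> v t" if "a \<le> t" "t \<le> b" for t
    using less[of t] ends that by (cases "t = a \<or> t = b") (auto simp: less_imp_le)
  have frontier_iff: "(t, x) \<in> frontier G \<longleftrightarrow> a \<le> t \<and> t \<le> b \<and> (x = u t \<or> x = v t)" for t x
    unfolding fr by auto
  have ray: False if "(t, x) \<in> G" and ray: "\<And>r. r \<ge> 0 \<Longrightarrow> (t, x + c * r) \<notin> frontier G" and c: "\<bar>c\<bar> = 1" for t x c
  proof -
    define S where "S = (\<lambda>r. (t, x + c * r)) ` {0..}"
    have "connected S" unfolding S_def
      by (intro connected_continuous_image continuous_intros) auto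
    moreover have "(t, x) \<in> S" by (auto simp: S_def intro!: image_eqI[of _ _ 0])
    then have "S \<inter> G \<noteq> {}" using that(1) by blast
    moreover have "S \<inter> frontier G = {}" using ray by (auto simp: S_def)
    ultimately have "S \<subseteq> G" using connected_Int_frontier[of S G] by blast
    then have "bounded S" using G(3) bounded_subset by blast
    then have "bounded (snd ` S)" by (rule bounded_snd)
    then obtain B where B: "\<And>r. r \<ge> 0 \<Longrightarrow> \<bar>x + c * r\<bar> \<le> B"
      unfolding bounded_iff S_def by auto
    have "\<bar>c * (B + \<bar>x\<bar> + 1)\<bar> \<le> \<bar>x + c * (B + \<bar>x\<bar> + 1)\<bar> + \<bar>x\<bar>" by linarith
    moreover have "B \<ge> 0" using B[of 0] by simp
    moreover have "\<bar>c * (B + \<bar>x\<bar> + 1)\<bar> = B + \<bar>x\<bar> + 1" using c \<open>B \<ge> 0\<close> by (simp add: abs_mult)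
    ultimately show False using B[of "B + \<bar>x\<bar> + 1"] by simp
  qed
  have sub: "G \<subseteq> ?R"
  proof (rule subsetI, rule ccontr)
    fix p assume p: "p \<in> G" "p \<notin> ?R"
    obtain t x where tx: "p = (t, x)" by fastforce
    have nf: "(t, x) \<notin> frontier G" using p GC tx by blast
    consider "t < a \<or> b < t" | "a \<le> t" "t \<le> b" "v t < x" | "a \<le> t" "t \<le> b" "x < u t"
    proof -
      have "a < t \<and> t < b \<and> u t < x \<and> x < v t" if "a \<le> t" "t \<le> b" "x \<le> v t" "u t \<le> x"
      proof -
        have "u t < x" "x < v t" using that nf by (auto simp: frontier_iff less_le)
        moreover have "t \<noteq> a" "t \<noteq> b" using calculation ends by auto
        ultimately show ?thesis using that by auto
      qed
      with p that show thesis unfolding tx between_def by force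
    qed
    then show False
    proof cases
      case 1
      then show ?thesis using ray[of t x 1] p by (auto simp: tx frontier_iff)
    next
      case 2
      then show ?thesis using ray[of t x 1] le[of t] p by (auto simp: tx frontier_iff)
    next
      case 3
      then show ?thesis using ray[of t x "-1"] le[of t] p by (auto simp: tx frontier_iff)
    qed
  qed
  moreover have "?R \<subseteq> G"
  proof -
    have "G \<noteq> {}" using ab fr by auto
    then have "?R \<inter> G \<noteq> {}" using sub by blast
    moreover have "?R \<inter> frontier G = {}"
    proof -
      have "frontier G = frontier ?R" by (simp only: fr top(4))
      then show ?thesis using top(1) by (auto simp: frontier_def interior_open)
    qed
    ultimately show ?thesis using connected_Int_frontier[OF top(2), of G] by blast
  qed
  ultimately show ?thesis by blast
qed

section \<open>Orientation\<close>

definition cx :: "real \<times> real \<Rightarrow> complex" where "cx p = Complex (fst p) (snd p)"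

lemma cx_comp: "(\<lambda>r. Complex (fst (c r)) (snd (c r))) = cx \<circ> c"
  by (auto simp: cx_def)

lemma cx_linepath: "cx \<circ> linepath p q = linepath (cx p) (cx q)"
  by (auto simp: cx_def linepath_def complex_eq_iff fun_eq_iff)

lemma cx_subpath: "cx \<circ> subpath a b c = subpath a b (cx \<circ> c)"
  by (simp add: subpath_def o_def)

lemma continuous_on_cx: "continuous_on S cx"
  unfolding cx_def[abs_def] by (rule continuous_on_Complex) (intro continuous_intros)+

lemma inj_cx: "inj cx" by (auto simp: inj_def cx_def prod_eq_iff)

lemma path_graph: "continuous_on {0..1} g \<Longrightarrow> path (graph_path g)"
  unfolding path_def graph_path_def by (intro continuous_intros)

text \<open>
  The linear homotopy from the arc to its secant moves points vertically. The point \<open>z\<close> lies on the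
  vertical line through an end point, which stays fixed, so the homotopy avoids \<open>z\<close>.
\<close>

lemma winding_number_vertical_homotopy:
  assumes g: "continuous_on {0..1} g" and ab: "a \<in> {0..1}" "b \<in> {0..1}" "a \<noteq> b"
    and z: "z = cx (t0, x0)" "t0 = a \<or> t0 = b" "x0 \<noteq> g t0"
  shows "winding_number (subpath a b (cx \<circ> graph_path g)) z
       = winding_number (linepath (cx (graph_path g a)) (cx (graph_path g b))) z"
proof (rule winding_number_paths_linear_eq)
  have pg: "path (cx \<circ> graph_path g)"
    using path_graph[OF g] by (intro path_continuous_image continuous_on_cx)
  show "path (subpath a b (cx \<circ> graph_path g))" using pg ab by (intro path_subpath) auto
  fix r :: real assume r: "r \<in> {0..1}"
  define \<tau> where "\<tau> = (b - a) * r + a"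
  let ?p = "subpath a b (cx \<circ> graph_path g) r" and ?q = "linepath (cx (graph_path g a)) (cx (graph_path g b)) r"
  have Re: "Re ?p = \<tau>" "Re ?q = \<tau>"
    by (simp_all add: subpath_def cx_def graph_path_def \<tau>_def linepath_def algebra_simps)
  show "z \<notin> closed_segment ?q ?p"
  proof
    assume "z \<in> closed_segment ?q ?p"
    then obtain k where k: "z = (1 - k) *\<^sub>R ?q + k *\<^sub>R ?p" by (auto simp: closed_segment_def)
    have "Re z = \<tau>" by (simp only: k plus_complex.sel scaleR_complex.sel Re) (simp add: algebra_simps)
    then have "\<tau> = t0" by (simp add: z cx_def)
    then have "r = 0 \<and> t0 = a \<or> r = 1 \<and> t0 = b"
    proof (cases "t0 = a")
      case True
      then show ?thesis using \<open>\<tau> = t0\<close> ab(3) by (simp add: \<tau>_def)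
    next
      case False
      then have "t0 = b" using z(2) by blast
      then have "(b - a) * r = (b - a) * 1" using \<open>\<tau> = t0\<close> by (simp add: \<tau>_def eq_diff_eq[symmetric] del: mult_cancel_left)
      then show ?thesis using z(2) False ab(3) by simp
    qed
    then have "?p = cx (t0, g t0)" "?q = cx (t0, g t0)" by (auto simp: subpath_def linepath_def graph_path_def)
    then have "z = cx (t0, g t0)" using k by (simp add: algebra_simps)
    then show False using z by (simp add: cx_def)
  qed
qed (use ab in auto)

text \<open>
  Splitting the arc at \<open>t0\<close>, right below or above the point, allows both halves to be straightened.
  The closed curve becomes a triangle around the point, traversed counterclockwise if the arc runs
  below the chord.
\<close>

lemma winding_number_graph_and_chord:
  assumes g: "continuous_on {0..1} g" and ab: "0 \<le> a" "a < t0" "t0 < b" "b \<le> 1"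
    and ends: "g a = m * a" "g b = m * b"
    and sep: "g t0 < x0 \<and> x0 < m * t0 \<or> m * t0 < x0 \<and> x0 < g t0"
    and notin: "(t0, x0) \<notin> path_image (graph_path g)"
  shows "winding_number (subpath a b (cx \<circ> graph_path g)) (cx (t0, x0))
     + winding_number (linepath (cx (graph_path g b)) (cx (graph_path g a))) (cx (t0, x0))
     = (if g t0 < x0 then 1 else - 1)"
proof -
  define z where "z = cx (t0, x0)"
  define A where "A = cx (a, m * a)"
  define B where "B = cx (b, m * b)"
  define w where "w = cx (t0, g t0)"
  have ne: "x0 \<noteq> g t0" "g t0 \<noteq> m * t0" using sep by auto
  have gA: "cx (graph_path g a) = A" "cx (graph_path g b) = B" "cx (graph_path g t0) = w"
    by (simp_all add: A_def B_def w_def graph_path_def ends)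
  let ?\<Gamma> = "cx \<circ> graph_path g"
  have pg: "path ?\<Gamma>"
    using path_graph[OF g] by (intro path_continuous_image continuous_on_cx)
  have zn: "z \<notin> path_image ?\<Gamma>"
    using notin inj_cx unfolding z_def path_image_compose by (simp add: inj_image_mem_iff)
  have in01: "a \<in> {0..1}" "t0 \<in> {0..1}" "b \<in> {0..1}" using ab by auto
  have 1: "winding_number (subpath a t0 ?\<Gamma>) z = winding_number (linepath A w) z"
    using winding_number_vertical_homotopy[OF g in01(1,2) _ z_def _ ne(1)] ab gA by simp
  have 2: "winding_number (subpath t0 b ?\<Gamma>) z = winding_number (linepath w B) z"
    using winding_number_vertical_homotopy[OF g in01(2,3) _ z_def _ ne(1)] ab gA by simp
  have 3: "winding_number (subpath a b ?\<Gamma>) z = winding_number (linepath A w) z + winding_number (linepath w B) z"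
    using winding_number_subpath_combine[OF pg zn in01] 1 2 by simp
  have nc: "\<not> collinear {A, w, B}"
  proof
    assume "collinear {A, w, B}"
    moreover have "A \<noteq> B" using ab by (simp add: A_def B_def cx_def)
    ultimately obtain k where k: "w = k *\<^sub>R A + (1 - k) *\<^sub>R B" unfolding collinear_3_expand by blast
    from arg_cong[OF k, of Re] have "t0 = k * a + (1 - k) * b" by (simp add: w_def A_def B_def cx_def)
    moreover from arg_cong[OF k, of Im] have "g t0 = m * (k * a + (1 - k) * b)"
      by (simp add: w_def A_def B_def cx_def algebra_simps)
    ultimately show False using ne by simp
  qed
  have int: "z \<in> interior (convex hull {A, w, B})"
  proof -
    \<comment> \<open>\<open>z\<close> divides the vertical segment from the chord to \<open>w\<close> in the ratio \<open>\<alpha>\<close>, and the foot of this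
      segment on the chord divides the chord from \<open>A\<close> to \<open>B\<close> in the ratio \<open>\<mu>\<close>.\<close>
    define \<alpha> where "\<alpha> = (x0 - m * t0) / (g t0 - m * t0)"
    define \<mu> where "\<mu> = (b - t0) / (b - a)"
    have \<alpha>: "0 < \<alpha>" "\<alpha> < 1" using sep by (auto simp: \<alpha>_def field_simps)
    have \<mu>: "0 < \<mu>" "\<mu> < 1" using ab by (auto simp: \<mu>_def field_simps)
    have t0: "\<mu> * a + (1 - \<mu>) * b = t0"
    proof -
      have "\<mu> * (b - a) = b - t0" using ab by (simp add: \<mu>_def)
      then show ?thesis by (simp add: algebra_simps)
    qed
    have x0: "\<alpha> * g t0 + (1 - \<alpha>) * (m * t0) = x0"
    proof -
      have "\<alpha> * (g t0 - m * t0) = x0 - m * t0" using ne by (simp add: \<alpha>_def)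
      then show ?thesis by (simp add: algebra_simps)
    qed
    have "((1 - \<alpha>) * \<mu>) *\<^sub>R A + \<alpha> *\<^sub>R w + ((1 - \<alpha>) * (1 - \<mu>)) *\<^sub>R B = z"
    proof (rule complex_eqI)
      have "Re (((1 - \<alpha>) * \<mu>) *\<^sub>R A + \<alpha> *\<^sub>R w + ((1 - \<alpha>) * (1 - \<mu>)) *\<^sub>R B) = (1 - \<alpha>) * (\<mu> * a + (1 - \<mu>) * b) + \<alpha> * t0"
        by (simp add: A_def B_def w_def cx_def algebra_simps)
      also have "\<dots> = t0" unfolding t0 by (simp add: algebra_simps)
      finally show "Re (((1 - \<alpha>) * \<mu>) *\<^sub>R A + \<alpha> *\<^sub>R w + ((1 - \<alpha>) * (1 - \<mu>)) *\<^sub>R B) = Re z" by (simp add: z_def cx_def)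
      have "Im (((1 - \<alpha>) * \<mu>) *\<^sub>R A + \<alpha> *\<^sub>R w + ((1 - \<alpha>) * (1 - \<mu>)) *\<^sub>R B) = \<alpha> * g t0 + (1 - \<alpha>) * (m * (\<mu> * a + (1 - \<mu>) * b))"
        by (simp add: A_def B_def w_def cx_def algebra_simps)
      also have "\<dots> = x0" unfolding t0 x0 ..
      finally show "Im (((1 - \<alpha>) * \<mu>) *\<^sub>R A + \<alpha> *\<^sub>R w + ((1 - \<alpha>) * (1 - \<mu>)) *\<^sub>R B) = Im z" by (simp add: z_def cx_def)
    qed
    moreover have "(1 - \<alpha>) * \<mu> > 0" "(1 - \<alpha>) * (1 - \<mu>) > 0" using \<alpha> \<mu> by auto
    moreover have "(1 - \<alpha>) * \<mu> + \<alpha> + (1 - \<alpha>) * (1 - \<mu>) = 1" by (simp add: algebra_simps)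
    ultimately show ?thesis unfolding interior_convex_hull_3_minimal[OF nc DIM_complex] using \<alpha>(1) by blast
  qed
  have edges: "z \<notin> closed_segment A w" "z \<notin> closed_segment w B" "z \<notin> closed_segment B A"
    using int unfolding interior_of_triangle[OF DIM_complex] by auto
  have "winding_number (linepath A w) z + (winding_number (linepath w B) z + winding_number (linepath B A) z)
      = winding_number (linepath A w +++ linepath w B +++ linepath B A) z"
    using edges by (simp add: winding_number_join path_image_join)
  also have "\<dots> = (if 0 < Im ((w - A) * cnj (w - z)) then 1 else - 1)"
    by (rule winding_number_triangle[OF int])
  also have "Im ((w - A) * cnj (w - z)) = (t0 - a) * (x0 - g t0)"
    by (simp add: w_def A_def z_def cx_def algebra_simps)
  also have "0 < \<dots> \<longleftrightarrow> g t0 < x0" using ab by (simp add: zero_less_mult_iff)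
  finally show ?thesis unfolding gA z_def[symmetric] 3 by (simp add: add.assoc)
qed

section \<open>The domain of a gap\<close>

lemma segment_on_line:
  fixes a b m :: real
  assumes "a \<le> b"
  shows "closed_segment (a, m * a) (b, m * b) = (\<lambda>t. (t, m * t)) ` {a..b}"
    and "open_segment (a, m * a) (b, m * b) = (\<lambda>t. (t, m * t)) ` {a<..<b}"
proof -
  have lin: "linear (\<lambda>t. (t, m * t))" by (intro linearI) (auto simp: algebra_simps)
  have inj: "inj (\<lambda>t. (t, m * t))" by (auto simp: inj_def)
  show "closed_segment (a, m * a) (b, m * b) = (\<lambda>t. (t, m * t)) ` {a..b}"
    using closed_segment_linear_image[OF lin, of a b] assms by (simp add: closed_segment_eq_real_ivl)
  show "open_segment (a, m * a) (b, m * b) = (\<lambda>t. (t, m * t)) ` {a<..<b}"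
    using open_segment_linear_image[OF lin inj, of a b] assms by (simp add: open_segment_eq_real_ivl)
qed

definition gap_region :: "(real \<Rightarrow> real) \<Rightarrow> real \<Rightarrow> real \<Rightarrow> real \<Rightarrow> (real \<times> real) set" where
  "gap_region g m a b =
     {(t, x). a < t \<and> t < b \<and> (g t < x \<and> x < m * t \<or> m * t < x \<and> x < g t)}"

lemma constant_side:
  fixes h :: "real \<Rightarrow> real"
  assumes h: "continuous_on {a<..<b} h" and ne: "\<And>t. a < t \<Longrightarrow> t < b \<Longrightarrow> h t \<noteq> 0"
  shows "(\<forall>t. a < t \<and> t < b \<longrightarrow> h t > 0) \<or> (\<forall>t. a < t \<and> t < b \<longrightarrow> h t < 0)"
proof (rule ccontr)
  assume "\<not> ?thesis"
  then obtain s t where "a < s" "s < b" "h s < 0" "a < t" "t < b" "h t > 0"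
    using ne by (metis linorder_neqE_linordered_idom)
  then have "h s \<in> h ` {a<..<b}" "h t \<in> h ` {a<..<b}" "h s \<le> 0" "0 \<le> h t" by auto
  moreover have "connected (h ` {a<..<b})" using h by (intro connected_continuous_image) auto
  ultimately have "0 \<in> h ` {a<..<b}"
    unfolding connected_iff_interval by blast
  with ne show False by auto
qed

text \<open>
  Both orientations of the boundary curve have the same image, so the domain is the region between
  arc and chord in either case. Its winding number with respect to the first curve is \<open>1\<close> or \<open>- 1\<close>
  according to the side on which the arc runs, and the second curve is the first one reversed, up to
  the starting point.
\<close>

lemma gap_domain_iff:
  assumes g: "continuous_on {0..1} g" and ab: "0 \<le> a" "a < b" "b \<le> 1"
    and ends: "g a = m * a" "g b = m * b"
    and ne: "\<And>t. a < t \<Longrightarrow> t < b \<Longrightarrow> g t \<noteq> m * t"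
  shows "gap_domain g (a, b) G \<sigma> \<longleftrightarrow>
           G = gap_region g m a b \<and> (\<forall>t. a < t \<and> t < b \<longrightarrow> \<sigma> = sgn (m * t - g t))"
proof -
  have gab: "continuous_on {a..b} g" using g ab by (auto intro: continuous_on_subset)
  have mab: "continuous_on {a..b} (\<lambda>t. m * t)" by (intro continuous_intros)
  let ?p = "subpath a b (graph_path g)" and ?l = "linepath (graph_path g b) (graph_path g a)"
  let ?R = "gap_region g m a b"
  let ?C = "(\<lambda>t. (t, g t)) ` {a..b} \<union> (\<lambda>t. (t, m * t)) ` {a..b}"
  have in01: "a \<in> {0..1}" "b \<in> {0..1}" using ab by auto
  have pp: "path ?p" using path_graph[OF g] in01 by (intro path_subpath)
  have ip: "path_image ?p = (\<lambda>t. (t, g t)) ` {a..b}" using ab by (simp add: path_image_subpath graph_path_def)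
  have il: "path_image ?l = (\<lambda>t. (t, m * t)) ` {a..b}"
    using segment_on_line(1)[of a b m] ab by (simp add: graph_path_def ends closed_segment_commute)
  have arcs: "arc ?p" "arc ?l"
  proof -
    show "arc ?p" unfolding arc_subpath_eq using pp ab by (auto simp: inj_on_def graph_path_def)
    show "arc ?l" using ab by (intro arc_linepath) (auto simp: graph_path_def)
  qed
  have int: "path_image ?p \<inter> path_image ?l \<subseteq> {(a, g a), (b, g b)}"
  proof -
    have "t = a \<or> t = b" if "a \<le> t" "t \<le> b" "g t = m * t" for t using ne[of t] that by fastforce
    then show ?thesis unfolding ip il by fastforce
  qed
  have ends_meet: "pathfinish ?p = pathstart ?l" "pathfinish ?l = pathstart ?p"
    by (simp_all add: graph_path_def)
  have sp1: "simple_path (?p +++ ?l)" "pathfinish (?p +++ ?l) = pathstart (?p +++ ?l)" "path_image (?p +++ ?l) = ?C"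
  proof -
    show "simple_path (?p +++ ?l)"
      using int by (intro simple_path_join_loop arcs ends_meet) (auto simp: graph_path_def)
    show "path_image (?p +++ ?l) = ?C" unfolding path_image_join[OF ends_meet(1)] ip il ..
  qed (simp add: ends_meet)
  have sp2: "simple_path (reversepath ?p +++ reversepath ?l)"
    "pathfinish (reversepath ?p +++ reversepath ?l) = pathstart (reversepath ?p +++ reversepath ?l)"
    "path_image (reversepath ?p +++ reversepath ?l) = ?C"
  proof -
    have m: "pathfinish (reversepath ?p) = pathstart (reversepath ?l)"
      "pathfinish (reversepath ?l) = pathstart (reversepath ?p)"
      using ends_meet by (simp_all only: pathfinish_reversepath pathstart_reversepath)
    show "simple_path (reversepath ?p +++ reversepath ?l)"
    proof (rule simple_path_join_loop[OF arcs[THEN arc_reversepath] m])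
      show "path_image (reversepath ?p) \<inter> path_image (reversepath ?l) \<subseteq> {pathstart (reversepath ?p), pathstart (reversepath ?l)}"
        using int unfolding path_image_reversepath by (auto simp: graph_path_def)
    qed
    show "path_image (reversepath ?p +++ reversepath ?l) = ?C"
      unfolding path_image_join[OF m(1)] path_image_reversepath ip il ..
    show "pathfinish (reversepath ?p +++ reversepath ?l) = pathstart (reversepath ?p +++ reversepath ?l)"
      using m(2) by (simp only: pathfinish_join pathstart_join)
  qed
  have cxpath: "path (cx \<circ> ?p)" "path (cx \<circ> ?l)"
    using pp by (auto intro!: path_continuous_image continuous_on_cx)
  have cxim: "cx p \<notin> path_image (cx \<circ> ?p)" "cx p \<notin> path_image (cx \<circ> ?l)" if "p \<notin> ?C" for p
    using that inj_cx unfolding path_image_compose ip il by (simp_all add: inj_image_mem_iff)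
  have notC: "(t, x) \<notin> ?C" "(t, x) \<notin> path_image (graph_path g)" if "(t, x) \<in> ?R" for t x
    using that by (auto simp: gap_region_def path_image_def graph_path_def)
  have w1: "winding_number (cx \<circ> (?p +++ ?l)) (cx (t, x)) = (if g t < x then 1 else - 1)" if "(t, x) \<in> ?R" for t x
  proof -
    have tx: "a < t" "t < b" "g t < x \<and> x < m * t \<or> m * t < x \<and> x < g t" using that by (auto simp: gap_region_def)
    have "winding_number (cx \<circ> (?p +++ ?l)) (cx (t, x)) = winding_number (cx \<circ> ?p) (cx (t, x)) + winding_number (cx \<circ> ?l) (cx (t, x))"
      unfolding path_compose_join
      by (intro winding_number_join cxpath cxim notC that) (simp add: pathfinish_compose pathstart_compose)
    then show ?thesis
      using winding_number_graph_and_chord[OF g ab(1) tx(1,2) ab(3) ends tx(3) notC(2)[OF that]]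
      by (simp add: cx_subpath cx_linepath)
  qed
  have w2: "winding_number (cx \<circ> (reversepath ?p +++ reversepath ?l)) (cx (t, x)) = (if g t < x then - 1 else 1)" if "(t, x) \<in> ?R" for t x
  proof -
    have "winding_number (cx \<circ> (reversepath ?p +++ reversepath ?l)) (cx (t, x))
        = winding_number (reversepath (cx \<circ> ?p)) (cx (t, x)) + winding_number (reversepath (cx \<circ> ?l)) (cx (t, x))"
      unfolding path_compose_join path_compose_reversepath
      using cxpath cxim[OF notC(1)[OF that]]
      by (intro winding_number_join) (simp_all add: pathfinish_compose pathstart_compose)
    also have "\<dots> = - (winding_number (cx \<circ> ?p) (cx (t, x)) + winding_number (cx \<circ> ?l) (cx (t, x)))"
      using cxpath cxim[OF notC(1)[OF that]] by (simp add: winding_number_reversepath)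
    also have "winding_number (cx \<circ> ?p) (cx (t, x)) + winding_number (cx \<circ> ?l) (cx (t, x)) = winding_number (cx \<circ> (?p +++ ?l)) (cx (t, x))"
      unfolding path_compose_join
      by (intro winding_number_join[symmetric] cxpath cxim notC that) (simp add: pathfinish_compose pathstart_compose)
    finally show ?thesis unfolding w1[OF that] by (rule trans) simp
  qed
  have top: "open ?R" "connected ?R" "bounded ?R" "frontier ?R = ?C"
    and uniq: "open G \<Longrightarrow> connected G \<Longrightarrow> bounded G \<Longrightarrow> frontier G = ?C \<Longrightarrow> G = ?R"
    and side: "(\<forall>t x. (t, x) \<in> ?R \<longrightarrow> g t < x) \<and> (\<forall>t. a < t \<and> t < b \<longrightarrow> sgn (m * t - g t) = 1) \<or>
       (\<forall>t x. (t, x) \<in> ?R \<longrightarrow> \<not> g t < x) \<and> (\<forall>t. a < t \<and> t < b \<longrightarrow> sgn (m * t - g t) = - 1)"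
  proof -
    have "continuous_on {a<..<b} (\<lambda>t. m * t - g t)"
      using gab greaterThanLessThan_subseteq_atLeastAtMost_iff[of a b a b]
      by (intro continuous_intros) (auto intro: continuous_on_subset)
    from constant_side[OF this] ne consider
      (below) "\<forall>t. a < t \<and> t < b \<longrightarrow> g t < m * t" | (above) "\<forall>t. a < t \<and> t < b \<longrightarrow> m * t < g t"
      by fastforce
    then have "(open ?R \<and> connected ?R \<and> bounded ?R \<and> frontier ?R = ?C) \<and>
      (open G \<longrightarrow> connected G \<longrightarrow> bounded G \<longrightarrow> frontier G = ?C \<longrightarrow> G = ?R) \<and>
      ((\<forall>t x. (t, x) \<in> ?R \<longrightarrow> g t < x) \<and> (\<forall>t. a < t \<and> t < b \<longrightarrow> sgn (m * t - g t) = 1) \<or>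
       (\<forall>t x. (t, x) \<in> ?R \<longrightarrow> \<not> g t < x) \<and> (\<forall>t. a < t \<and> t < b \<longrightarrow> sgn (m * t - g t) = - 1))"
    proof cases
      case below
      then have lt: "g t < m * t" if "a < t" "t < b" for t using that by blast
      then have R: "?R = between a b g (\<lambda>t. m * t)" by (fastforce simp: gap_region_def between_def)
      have "open ?R \<and> connected ?R \<and> bounded ?R \<and> frontier ?R = ?C"
        unfolding R using between_topology[OF ab(2) gab mab lt ends] by (intro conjI)
      moreover have "open G \<longrightarrow> connected G \<longrightarrow> bounded G \<longrightarrow> frontier G = ?C \<longrightarrow> G = ?R"
        unfolding R using bounded_domain_unique[OF ab(2) gab mab lt ends, of G] by blast
      moreover have "\<forall>t x. (t, x) \<in> ?R \<longrightarrow> g t < x" unfolding R by (auto simp: between_def)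
      moreover have "\<forall>t. a < t \<and> t < b \<longrightarrow> sgn (m * t - g t) = 1" using lt by auto
      ultimately show ?thesis by blast
    next
      case above
      then have lt: "m * t < g t" if "a < t" "t < b" for t using that by blast
      then have R: "?R = between a b (\<lambda>t. m * t) g" by (fastforce simp: gap_region_def between_def)
      have C: "?C = (\<lambda>t. (t, m * t)) ` {a..b} \<union> (\<lambda>t. (t, g t)) ` {a..b}" by (rule Un_commute)
      have "open ?R \<and> connected ?R \<and> bounded ?R \<and> frontier ?R = ?C"
        unfolding R C using between_topology[OF ab(2) mab gab lt ends[symmetric]] by (intro conjI)
      moreover have "open G \<longrightarrow> connected G \<longrightarrow> bounded G \<longrightarrow> frontier G = ?C \<longrightarrow> G = ?R"
        unfolding R C using bounded_domain_unique[OF ab(2) mab gab lt ends[symmetric], of G] by blast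
      moreover have "\<forall>t x. (t, x) \<in> ?R \<longrightarrow> \<not> g t < x" unfolding R by (auto simp: between_def)
      moreover have "\<forall>t. a < t \<and> t < b \<longrightarrow> sgn (m * t - g t) = - 1" using lt by auto
      ultimately show ?thesis by blast
    qed
    then show "open ?R" "connected ?R" "bounded ?R" "frontier ?R = ?C"
      "open G \<Longrightarrow> connected G \<Longrightarrow> bounded G \<Longrightarrow> frontier G = ?C \<Longrightarrow> G = ?R"
      "(\<forall>t x. (t, x) \<in> ?R \<longrightarrow> g t < x) \<and> (\<forall>t. a < t \<and> t < b \<longrightarrow> sgn (m * t - g t) = 1) \<or>
       (\<forall>t x. (t, x) \<in> ?R \<longrightarrow> \<not> g t < x) \<and> (\<forall>t. a < t \<and> t < b \<longrightarrow> sgn (m * t - g t) = - 1)"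
      by blast+
  qed
  have Rne: "\<exists>t x. (t, x) \<in> ?R"
  proof -
    have "?R \<noteq> {}" using top(4) ab by auto
    then show ?thesis by auto
  qed
  have mid: "\<exists>t. a < t \<and> t < b" using ab dense by blast
  have J1: "positive_jordan_boundary (?p +++ ?l) G \<longleftrightarrow> G = ?R \<and> (\<forall>t x. (t, x) \<in> ?R \<longrightarrow> g t < x)"
  proof -
    have "(\<forall>(t, x)\<in>?R. winding_number (cx \<circ> (?p +++ ?l)) (cx (t, x)) = 1) \<longleftrightarrow> (\<forall>t x. (t, x) \<in> ?R \<longrightarrow> g t < x)"
    proof -
      have "winding_number (cx \<circ> (?p +++ ?l)) (cx (t, x)) = 1 \<longleftrightarrow> g t < x" if "(t, x) \<in> ?R" for t x
        unfolding w1[OF that] by simp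
      then show ?thesis by blast
    qed
    then show ?thesis
      using sp1 top uniq unfolding positive_jordan_boundary_def cx_comp by (auto simp: cx_def)
  qed
  have J2: "positive_jordan_boundary (reversepath ?p +++ reversepath ?l) G \<longleftrightarrow> G = ?R \<and> (\<forall>t x. (t, x) \<in> ?R \<longrightarrow> \<not> g t < x)"
  proof -
    have "(\<forall>(t, x)\<in>?R. winding_number (cx \<circ> (reversepath ?p +++ reversepath ?l)) (cx (t, x)) = 1)
       \<longleftrightarrow> (\<forall>t x. (t, x) \<in> ?R \<longrightarrow> \<not> g t < x)"
    proof -
      have "winding_number (cx \<circ> (reversepath ?p +++ reversepath ?l)) (cx (t, x)) = 1 \<longleftrightarrow> \<not> g t < x"
        if "(t, x) \<in> ?R" for t x
        unfolding w2[OF that] by simp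
      then show ?thesis by blast
    qed
    then show ?thesis
      using sp2 top uniq unfolding positive_jordan_boundary_def cx_comp by (auto simp: cx_def)
  qed
  have "gap_domain g (a, b) G \<sigma> \<longleftrightarrow> \<sigma> = 1 \<and> G = ?R \<and> (\<forall>t x. (t, x) \<in> ?R \<longrightarrow> g t < x)
     \<or> \<sigma> = - 1 \<and> G = ?R \<and> (\<forall>t x. (t, x) \<in> ?R \<longrightarrow> \<not> g t < x)"
    using J1 J2 by (simp add: gap_domain_def reversepath_subpath)
  then show ?thesis using side Rne mid by metis
qed

section \<open>The gaps of the chord\<close>

lemma path_image_graph: "path_image (graph_path g) = (\<lambda>t. (t, g t)) ` {0..1}"
  by (simp add: path_image_def graph_path_def)

context
  fixes g :: "real \<Rightarrow> real" and s m :: real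
  assumes g: "continuous_on {0..1} g" and g0: "g 0 = 0" and s: "0 < s" "s \<le> 1"
    and m: "g s = m * s"
begin

lemma chord_eq: "chord g s = (\<lambda>t. (t, m * t)) ` {0..s}"
  using segment_on_line(1)[of 0 s m] s by (simp add: chord_def graph_path_def g0 m)

text \<open>
  An open segment contained in the chord has its end points on the chord as well, because the chord
  is closed. So \<open>(a, b)\<close> is a gap exactly if it is a maximal interval on which \<open>g t \<noteq> m * t\<close>.
\<close>

lemma chord_gaps_iff:
  "(a, b) \<in> chord_gaps g s \<longleftrightarrow> 0 \<le> a \<and> a < b \<and> b \<le> s \<and> g a = m * a \<and> g b = m * b \<and>
     (\<forall>t. a < t \<and> t < b \<longrightarrow> g t \<noteq> m * t)"
proof
  assume L: "(a, b) \<in> chord_gaps g s"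
  then have ab: "0 \<le> a" "a < b" "b \<le> s"
    and sub: "open_segment (a, g a) (b, g b) \<subseteq> chord g s - path_image (graph_path g)"
    by (auto simp: chord_gaps_def graph_path_def)
  have "closed (chord g s)" by (simp add: chord_def)
  then have "closure (open_segment (a, g a) (b, g b)) \<subseteq> chord g s"
    using sub by (intro closure_minimal) auto
  then have "closed_segment (a, g a) (b, g b) \<subseteq> chord g s"
    using ab by (simp add: closure_open_segment split: if_splits)
  then have "(a, g a) \<in> chord g s" "(b, g b) \<in> chord g s" by auto
  then have ends: "g a = m * a" "g b = m * b" by (auto simp: chord_eq)
  have "g t \<noteq> m * t" if "a < t" "t < b" for t
  proof
    assume eq: "g t = m * t"
    have "(t, m * t) \<in> open_segment (a, g a) (b, g b)"
      unfolding ends segment_on_line(2)[OF less_imp_le[OF ab(2)]] using that by (intro imageI) simp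
    then have "(t, m * t) \<notin> path_image (graph_path g)" using sub by blast
    then show False using that ab s eq by (auto simp: path_image_graph image_iff)
  qed
  with ab ends show "0 \<le> a \<and> a < b \<and> b \<le> s \<and> g a = m * a \<and> g b = m * b \<and>
     (\<forall>t. a < t \<and> t < b \<longrightarrow> g t \<noteq> m * t)" by blast
next
  assume R: "0 \<le> a \<and> a < b \<and> b \<le> s \<and> g a = m * a \<and> g b = m * b \<and>
     (\<forall>t. a < t \<and> t < b \<longrightarrow> g t \<noteq> m * t)"
  then have "open_segment (graph_path g a) (graph_path g b) = (\<lambda>t. (t, m * t)) ` {a<..<b}"
    using segment_on_line(2)[of a b m] by (simp add: graph_path_def)
  moreover have "\<dots> \<subseteq> chord g s - path_image (graph_path g)"
    using R by (auto simp: chord_eq path_image_graph)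
  ultimately show "(a, b) \<in> chord_gaps g s" using R by (simp add: chord_gaps_def)
qed

lemma gap_segment:
  assumes "(a, b) \<in> chord_gaps g s"
  shows "open_segment (graph_path g a) (graph_path g b) = (\<lambda>t. (t, m * t)) ` {a<..<b}"
  using assms segment_on_line(2)[of a b m] unfolding chord_gaps_iff by (simp add: graph_path_def)

lemma chord_gaps_disjoint:
  assumes k: "(a, b) \<in> chord_gaps g s" "(a', b') \<in> chord_gaps g s" and t: "a < t" "t < b" "a' < t" "t < b'"
  shows "a = a'" "b = b'"
proof -
  note K = k[unfolded chord_gaps_iff]
  have "\<not> (a < a' \<and> a' < b)" "\<not> (a' < a \<and> a < b')" "\<not> (a < b' \<and> b' < b)" "\<not> (a' < b \<and> b < b')"
    using K by auto
  then show "a = a'" "b = b'" using t by linarith+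
qed

lemma countable_chord_gaps: "countable (chord_gaps g s)"
proof -
  let ?I = "\<lambda>(a, b). {a<..<b :: real}"
  have "countable (?I ` chord_gaps g s)"
  proof (rule countable_disjoint_open_subsets)
    show "pairwise disjnt (?I ` chord_gaps g s)"
      unfolding pairwise_def disjnt_def
    proof (intro ballI impI, rule ccontr)
      fix A B assume "A \<in> ?I ` chord_gaps g s" "B \<in> ?I ` chord_gaps g s" "A \<noteq> B" "A \<inter> B \<noteq> {}"
      then obtain a b a' b' t where ab: "(a, b) \<in> chord_gaps g s" "(a', b') \<in> chord_gaps g s"
        "A = {a<..<b}" "B = {a'<..<b'}" "t \<in> A \<inter> B" by blast
      then have "a = a'" "b = b'" using chord_gaps_disjoint[OF ab(1,2), of t] by auto
      with ab \<open>A \<noteq> B\<close> show False by simp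
    qed
  qed auto
  moreover have "inj_on ?I (chord_gaps g s)"
  proof (rule inj_onI)
    fix i j assume ij: "i \<in> chord_gaps g s" "j \<in> chord_gaps g s" "?I i = ?I j"
    obtain a b a' b' where e: "i = (a, b)" "j = (a', b')" by fastforce
    have "a < (a + b) / 2" "(a + b) / 2 < b" using ij(1) unfolding e chord_gaps_iff by auto
    then have "(a + b) / 2 \<in> {a<..<b}" by auto
    moreover from this have "(a + b) / 2 \<in> {a'<..<b'}" using ij(3) unfolding e prod.case by blast
    ultimately show "i = j" using chord_gaps_disjoint[OF ij(1,2)[unfolded e], of "(a + b) / 2"] by (simp add: e)
  qed
  ultimately show ?thesis by (rule countable_image_inj_on)
qed

lemma ex_chord_gap:
  assumes t: "0 \<le> t" "t \<le> s" and ne: "g t \<noteq> m * t"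
  obtains a b where "(a, b) \<in> chord_gaps g s" "a < t" "t < b"
proof -
  define Z where "Z = {\<tau>\<in>{0..s}. g \<tau> - m * \<tau> = 0}"
  have gs: "continuous_on {0..s} g" using g s by (auto intro: continuous_on_subset)
  have cZ: "compact Z"
  proof -
    have "closed Z" unfolding Z_def
      by (rule continuous_closed_preimage_constant) (auto intro!: continuous_intros gs)
    moreover have "bounded Z" by (rule bounded_subset[of "{0..s}"]) (auto simp: Z_def)
    ultimately show ?thesis by (simp add: compact_eq_bounded_closed)
  qed
  have Z: "0 \<in> Z" "s \<in> Z" using s g0 m by (auto simp: Z_def)
  have "compact (Z \<inter> {0..t})" "Z \<inter> {0..t} \<noteq> {}" using cZ Z t by (auto intro: compact_Int)
  then obtain a where a: "a \<in> Z \<inter> {0..t}" "\<And>y. y \<in> Z \<inter> {0..t} \<Longrightarrow> y \<le> a"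
    using compact_attains_sup by metis
  have "compact (Z \<inter> {t..s})" "Z \<inter> {t..s} \<noteq> {}" using cZ Z t by (auto intro: compact_Int)
  then obtain b where b: "b \<in> Z \<inter> {t..s}" "\<And>y. y \<in> Z \<inter> {t..s} \<Longrightarrow> b \<le> y"
    using compact_attains_inf by metis
  have "a \<noteq> t" "b \<noteq> t" using a(1) b(1) ne by (auto simp: Z_def)
  then have ab: "a < t" "t < b" using a(1) b(1) by auto
  have "g \<tau> \<noteq> m * \<tau>" if "a < \<tau>" "\<tau> < b" for \<tau>
  proof
    assume "g \<tau> = m * \<tau>"
    then have "\<tau> \<in> Z" using that a(1) b(1) by (auto simp: Z_def)
    then show False using a(2)[of \<tau>] b(2)[of \<tau>] that a(1) b(1) by (cases "\<tau> \<le> t") auto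
  qed
  then have "(a, b) \<in> chord_gaps g s"
    using a(1) b(1) ab unfolding chord_gaps_iff by (auto simp: Z_def)
  with ab show thesis using that by blast
qed

lemma gap_domain_chord_gap:
  assumes "(a, b) \<in> chord_gaps g s"
  shows "gap_domain g (a, b) G \<sigma> \<longleftrightarrow>
           G = gap_region g m a b \<and> (\<forall>t. a < t \<and> t < b \<longrightarrow> \<sigma> = sgn (m * t - g t))"
  using assms s unfolding chord_gaps_iff by (intro gap_domain_iff[OF g]) auto

lemma chord_decomposition_holds: "chord_decomposition g s"
  unfolding chord_decomposition_def
proof (intro conjI)
  have "closed (chord g s)" by (simp add: chord_def)
  moreover have "closed (path_image (graph_path g))"
    using path_graph[OF g] by (rule closed_path_image)
  ultimately show "closed (chord g s \<inter> path_image (graph_path g))" by (rule closed_Int)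
  show "countable (chord_gaps g s)" by (rule countable_chord_gaps)
  show "disjoint_family_on (\<lambda>(a, b). open_segment (graph_path g a) (graph_path g b)) (chord_gaps g s)"
    unfolding disjoint_family_on_def
  proof (intro ballI impI, rule ccontr)
    fix i j assume ij: "i \<in> chord_gaps g s" "j \<in> chord_gaps g s" "i \<noteq> j"
      and ne: "(case i of (a, b) \<Rightarrow> open_segment (graph_path g a) (graph_path g b)) \<inter>
          (case j of (a, b) \<Rightarrow> open_segment (graph_path g a) (graph_path g b)) \<noteq> {}"
    obtain a b a' b' where e: "i = (a, b)" "j = (a', b')" by fastforce
    from ne obtain t where "t \<in> {a<..<b}" "t \<in> {a'<..<b'}"
      unfolding e prod.case gap_segment[OF ij(1)[unfolded e]] gap_segment[OF ij(2)[unfolded e]] by blast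
    then show False using chord_gaps_disjoint[OF ij(1,2)[unfolded e], of t] ij(3) by (simp add: e)
  qed
  show "(\<Union>(a, b)\<in>chord_gaps g s. open_segment (graph_path g a) (graph_path g b))
      = chord g s - path_image (graph_path g)"
  proof (intro equalityI subsetI)
    fix p assume "p \<in> chord g s - path_image (graph_path g)"
    then obtain t where t: "p = (t, m * t)" "0 \<le> t" "t \<le> s" "g t \<noteq> m * t"
      using s by (fastforce simp: chord_eq path_image_graph)
    obtain a b where ab: "(a, b) \<in> chord_gaps g s" "a < t" "t < b" using ex_chord_gap[OF t(2-4)] .
    then have "p \<in> open_segment (graph_path g a) (graph_path g b)" unfolding gap_segment[OF ab(1)] t by auto
    then show "p \<in> (\<Union>(a, b)\<in>chord_gaps g s. open_segment (graph_path g a) (graph_path g b))" using ab(1) by blast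
  qed (auto simp: chord_gaps_def)
  show "\<forall>k\<in>chord_gaps g s. \<exists>G \<sigma>. gap_domain g k G \<sigma>"
  proof
    fix k assume k: "k \<in> chord_gaps g s"
    obtain a b where e: "k = (a, b)" by fastforce
    note ab = k[unfolded e chord_gaps_iff]
    have "continuous_on {a<..<b} (\<lambda>t. m * t - g t)"
      using ab s by (intro continuous_intros continuous_on_subset[OF g]) auto
    from constant_side[OF this] ab consider
      "\<forall>t. a < t \<and> t < b \<longrightarrow> sgn (m * t - g t) = 1" | "\<forall>t. a < t \<and> t < b \<longrightarrow> sgn (m * t - g t) = - 1"
      by (metis diff_eq_eq eq_iff_diff_eq_0 sgn_neg sgn_pos)
    then obtain \<sigma> where "\<forall>t. a < t \<and> t < b \<longrightarrow> \<sigma> = sgn (m * t - g t)" by cases metis+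
    then show "\<exists>G \<sigma>. gap_domain g k G \<sigma>" using gap_domain_chord_gap[OF k[unfolded e]] e by blast
  qed
qed

end

section \<open>The area integral over rectangles\<close>

lemma abs_continuous_on_mono:
  assumes "abs_continuous_on p q u" "p \<le> a" "b \<le> q"
  shows "abs_continuous_on a b u"
  unfolding abs_continuous_on_def
proof (intro allI impI)
  fix e :: real assume "e > 0"
  with assms(1) obtain \<delta> where "\<delta> > 0" and \<delta>: "\<forall>D. finite D \<longrightarrow> (\<forall>(x, y)\<in>D. p \<le> x \<and> x < y \<and> y \<le> q) \<longrightarrow>
        disjoint_family_on (\<lambda>(x, y). {x<..<y}) D \<longrightarrow> (\<Sum>(x, y)\<in>D. y - x) < \<delta> \<longrightarrow>
        (\<Sum>(x, y)\<in>D. \<bar>u y - u x\<bar>) < e"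
    unfolding abs_continuous_on_def by blast
  have "\<forall>(x, y)\<in>D. p \<le> x \<and> x < y \<and> y \<le> q" if "\<forall>(x, y)\<in>D. a \<le> x \<and> x < y \<and> y \<le> b" for D
    using that assms(2,3) by fastforce
  with \<delta> \<open>\<delta> > 0\<close> show "\<exists>\<delta>>0. \<forall>D. finite D \<longrightarrow> (\<forall>(x, y)\<in>D. a \<le> x \<and> x < y \<and> y \<le> b) \<longrightarrow>
        disjoint_family_on (\<lambda>(x, y). {x<..<y}) D \<longrightarrow> (\<Sum>(x, y)\<in>D. y - x) < \<delta> \<longrightarrow>
        (\<Sum>(x, y)\<in>D. \<bar>u y - u x\<bar>) < e"
    by (intro exI[of _ \<delta>]) simp
qed

lemma AE_lborel_swap:
  assumes "AE p in (lborel :: (real \<times> real) measure). Q p"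
  shows "AE x in lborel. AE t in lborel. Q (t, x)"
proof -
  from assms obtain N where N: "{p. \<not> Q p} \<subseteq> N" "N \<in> null_sets (lborel :: (real \<times> real) measure)"
    by (auto simp: eventually_ae_filter)
  have "AE p in (lborel \<Otimes>\<^sub>M lborel :: (real \<times> real) measure). p \<notin> N"
    using N(2) unfolding lborel_prod by (rule AE_not_in)
  then have "AE t in lborel. AE x in lborel. (t, x) \<notin> N"
    by (rule lborel_pair.AE_pair)
  moreover have "{p \<in> space (lborel \<Otimes>\<^sub>M lborel). (fst p, snd p) \<notin> N} \<in> sets (lborel \<Otimes>\<^sub>M lborel)"
  proof -
    have "{p. p \<notin> N} = - N" by auto
    then show ?thesis using N(2) unfolding lborel_prod by (simp add: null_sets_def borel_comp)
  qed
  ultimately have "AE x in lborel. AE t in lborel. (t, x) \<notin> N"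
    using lborel_pair.AE_commute[of "\<lambda>t x. (t, x) \<notin> N"] by blast
  moreover have "Q p" if "p \<notin> N" for p using N(1) that by auto
  ultimately show ?thesis by (auto elim!: eventually_mono)
qed

text \<open>
  The fundamental theorem for a function \<open>w\<close> that agrees with the derivative only almost everywhere:
  slices of a Borel representative of \<open>partial_t f\<close> are of this kind.
\<close>

lemma AC_integral_deriv_representative:
  assumes ac: "abs_continuous_on 0 1 u" and t: "0 \<le> t1" "t1 \<le> t2" "t2 \<le> 1"
    and w: "integrable lborel w" and eq: "AE t in lborel. t \<in> {0..1} \<longrightarrow> w t = deriv u t"
  shows "(LINT t:{t1..<t2}|lborel. w t) = u t2 - u t1"
proof -
  from eq obtain N where N: "{t. \<not> (t \<in> {0..1} \<longrightarrow> w t = deriv u t)} \<subseteq> N" "N \<in> null_sets lborel"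
    by (auto simp: eventually_ae_filter)
  have "negligible N" using N(2) null_sets_completionI negligible_iff_null_sets by blast
  have "abs_continuous_on t1 t2 u" using ac t by (auto intro: abs_continuous_on_mono)
  note AC_deriv_has_integral[OF this t(2)]
  moreover have "w x = deriv u x" if "x \<in> {t1..t2} - N" for x
  proof -
    have "x \<in> {0..1}" using that t by auto
    then show ?thesis using N(1) that by blast
  qed
  ultimately have "(w has_integral u t2 - u t1) {t1..t2}"
    using has_integral_spike[OF \<open>negligible N\<close>] by blast
  moreover have si: "set_integrable lborel {t1..t2} w"
    unfolding set_integrable_def using integrable_mult_indicator[OF _ w, of "{t1..t2}"] by simp
  ultimately have "(LINT t:{t1..t2}|lborel. w t) = u t2 - u t1"
    using set_borel_integral_eq_integral(2)[OF si] by (simp add: integral_unique)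
  moreover have "(LINT t:{t1..t2}|lborel. w t) = (LINT t:{t1..<t2}|lborel. w t)"
    unfolding set_lebesgue_integral_def
    by (intro integral_cong_AE borel_measurable_scaleR borel_measurable_indicator borel_measurable_integrable[OF w])
       (use AE_lborel_singleton[of t2] in \<open>auto split: split_indicator\<close>)
  ultimately show ?thesis by simp
qed

locale area_setting =
  fixes f :: "real \<times> real \<Rightarrow> real" and c d :: real
  assumes cont: "continuous_on ({0..1} \<times> UNIV) f"
    and acl: "AE x in lborel. abs_continuous_on 0 1 (\<lambda>t. f (t, x))"
    and int: "set_integrable lebesgue ({0..1} \<times> {c..d}) (partial_t f)"
    and cd: "c \<le> d"
begin

abbreviation K :: "(real \<times> real) set" where "K \<equiv> {0..1} \<times> {c..d}"

definition F :: "real \<Rightarrow> real \<Rightarrow> real" where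
  "F t y = (LINT x:{c..y}|lborel. f (t, x))"

lemma continuous_slice:
  assumes "t \<in> {0..1}" shows "continuous_on UNIV (\<lambda>x. f (t, x))"
  by (rule continuous_on_compose2[OF cont]) (use assms in \<open>auto intro!: continuous_intros\<close>)

lemma slice_integrable:
  assumes "t \<in> {0..1}" shows "set_integrable lborel {p..q} (\<lambda>x. f (t, x))"
  using continuous_slice[OF assms]
  by (intro borel_integrable_atLeastAtMost') (auto intro: continuous_on_subset)

text \<open>
  The function \<open>partial_t f\<close> is integrable with respect to the completed measure, whereas Fubini's
  theorem is about the product measure.
\<close>

lemma borel_representative:
  obtains w where "integrable lborel w"
    "AE p in lborel. w p = indicator K p * partial_t f p"
proof -
  have i: "integrable (completion lborel) (\<lambda>p. indicator K p * partial_t f p)"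
    using int by (simp add: set_integrable_def)
  from completion_ex_borel_measurable_real[OF borel_measurable_integrable[OF i]]
  obtain w where w: "w \<in> borel_measurable lborel" "AE p in lborel. indicator K p * partial_t f p = w p" by blast
  have "integrable (completion lborel) w"
  proof (rule integrable_cong_AE_imp[OF i])
    show "w \<in> borel_measurable (completion lborel)" using w(1) by (rule measurable_completion)
    show "AE p in completion lborel. indicator K p * partial_t f p = w p"
      using w(2) by (rule AE_completion)
  qed
  then have "integrable lborel w" using integrable_completion[OF w(1)] by simp
  moreover have "AE p in lborel. w p = indicator K p * partial_t f p" using w(2) by eventually_elim simp
  ultimately show thesis using that by blast
qed

text \<open>
  Fubini's theorem with the inner integral taken along \<open>t\<close>, where it is an increment of \<open>f\<close>. The
  half-open side makes adjacent rectangles disjoint.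
\<close>

lemma area_rectangle:
  assumes t: "0 \<le> t1" "t1 \<le> t2" "t2 \<le> 1" and y: "y \<in> {c..d}"
  shows "F t2 y - F t1 y = (LINT p:{t1..<t2} \<times> {c..y}|lebesgue. partial_t f p)"
proof -
  obtain w where w: "integrable lborel w" "AE p in lborel. w p = indicator K p * partial_t f p"
    using borel_representative by blast
  let ?S = "{t1..<t2} \<times> {c..y}"
  have Sb: "?S \<in> sets borel" by (intro borel_Times) auto
  have SK: "?S \<subseteq> K" using t y by auto
  have wS: "integrable lborel (\<lambda>p. indicator ?S p * w p)"
    using integrable_mult_indicator[OF _ w(1), of ?S] Sb by simp
  have meas: "(\<lambda>p. indicator ?S p * w p) \<in> borel_measurable lborel"
    using wS by (rule borel_measurable_integrable)
  have "(LINT p:?S|lebesgue. partial_t f p) = (LINT p|lebesgue. indicator ?S p * w p)"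
    unfolding set_lebesgue_integral_def
  proof (rule integral_cong_AE)
    have "set_integrable lebesgue ?S (partial_t f)"
      by (rule set_integrable_subset[OF int _ SK]) (use Sb in auto)
    then show "(\<lambda>p. indicator ?S p *\<^sub>R partial_t f p) \<in> borel_measurable lebesgue"
      unfolding set_integrable_def by (rule borel_measurable_integrable)
    show "(\<lambda>p. indicator ?S p * w p) \<in> borel_measurable lebesgue" using meas by (rule measurable_completion)
    have "AE p in lborel. indicator ?S p *\<^sub>R partial_t f p = indicator ?S p * w p"
      using w(2) by eventually_elim (use SK in \<open>auto split: split_indicator\<close>)
    then show "AE p in lebesgue. indicator ?S p *\<^sub>R partial_t f p = indicator ?S p * w p"
      by (rule AE_completion)
  qed
  also have "\<dots> = (LINT p|lborel. indicator ?S p * w p)" using meas by (rule integral_completion)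
  also have "\<dots> = (LINT p|(lborel \<Otimes>\<^sub>M lborel). indicator ?S p * w p)" by (simp add: lborel_prod)
  also have "\<dots> = (LINT x|lborel. LINT t|lborel. indicator ?S (t, x) * w (t, x))"
    using lborel_pair.integral_snd[of "\<lambda>t x. indicator ?S (t, x) * w (t, x)"] wS
    by (simp add: split_beta' lborel_prod)
  also have "\<dots> = (LINT x|lborel. indicator {c..y} x * (f (t2, x) - f (t1, x)))"
  proof (rule integral_cong_AE)
    have "integrable (lborel \<Otimes>\<^sub>M lborel) (\<lambda>(t, x). indicator ?S (t, x) * w (t, x))"
      using wS by (simp add: split_beta' lborel_prod)
    from borel_measurable_integrable[OF lborel_pair.integrable_snd[OF this]]
    show "(\<lambda>x. LINT t|lborel. indicator ?S (t, x) * w (t, x)) \<in> borel_measurable lborel" by simp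
    have "set_integrable lborel {c..y} (\<lambda>x. f (t2, x) - f (t1, x))"
      using t by (intro set_integral_diff slice_integrable) auto
    then show "(\<lambda>x. indicator {c..y} x * (f (t2, x) - f (t1, x))) \<in> borel_measurable lborel"
      unfolding set_integrable_def by (auto dest: borel_measurable_integrable)
    have "integrable (lborel \<Otimes>\<^sub>M lborel) (\<lambda>(t, x). w (t, x))"
      using w(1) by (simp add: lborel_prod)
    from lborel_pair.AE_integrable_snd[OF this]
    have "AE x in lborel. integrable lborel (\<lambda>t. w (t, x))" by simp
    moreover note acl AE_lborel_swap[OF w(2)]
    ultimately show "AE x in lborel. (LINT t|lborel. indicator ?S (t, x) * w (t, x))
        = indicator {c..y} x * (f (t2, x) - f (t1, x))"
    proof eventually_elim
      case (elim x)
      show ?case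
      proof (cases "x \<in> {c..y}")
        case True
        then have "AE t in lborel. t \<in> {0..1} \<longrightarrow> w (t, x) = deriv (\<lambda>t. f (t, x)) t"
          by (intro eventually_mono[OF elim(3)]) (use y in \<open>auto simp: partial_t_def\<close>)
        from AC_integral_deriv_representative[OF elim(2) t elim(1) this] True
        show ?thesis by (simp add: set_lebesgue_integral_def indicator_times)
      next
        case False
        then show ?thesis by (simp add: indicator_times)
      qed
    qed
  qed
  also have "\<dots> = F t2 y - F t1 y"
  proof -
    have "(LINT x:{c..y}|lborel. f (t2, x) - f (t1, x)) = F t2 y - F t1 y"
      unfolding F_def using t by (intro set_integral_diff(2) slice_integrable) auto
    then show ?thesis by (simp add: set_lebesgue_integral_def)
  qed
  finally show ?thesis by simp
qed

lemma slice_interval_integral: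
  assumes t: "t \<in> {0..1}" and pq: "p \<in> {c..d}" "q \<in> {c..d}"
  shows "(LBINT x=p..q. f (t, x)) = F t q - F t p"
proof -
  have 1: "F t y = (LBINT x=c..y. f (t, x))" if "c \<le> y" for y
    unfolding F_def using that by (simp add: interval_integral_Icc)
  have "(LBINT x=c..p. f (t, x)) + (LBINT x=p..q. f (t, x)) = (LBINT x=c..q. f (t, x))"
  proof (rule interval_integral_sum)
    have "interval_lebesgue_integrable lborel (ereal (min c (min p q))) (ereal (max c (max p q))) (\<lambda>x. f (t, x))"
      using continuous_slice[OF t] by (intro interval_integrable_isCont) (auto simp: continuous_on_eq_continuous_at)
    then show "interval_lebesgue_integrable lborel (min (ereal c) (min (ereal p) (ereal q)))
     (max (ereal c) (max (ereal p) (ereal q))) (\<lambda>x. f (t, x))" by (simp only: ereal_max ereal_min)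
  qed
  with 1 pq show ?thesis by auto
qed

lemma F_tendsto:
  assumes t: "\<And>k. t k \<in> {0..1}" "t \<longlonglongrightarrow> s" and y: "\<And>k. y k \<in> {c..d}" "y \<longlonglongrightarrow> x"
  shows "(\<lambda>k. F (t k) (y k)) \<longlonglongrightarrow> F s x"
proof -
  have s: "s \<in> {0..1}" using closed_sequentially[OF closed_real_atLeastAtMost _ t(2)] t(1) by blast
  have x: "x \<in> {c..d}" using closed_sequentially[OF closed_real_atLeastAtMost _ y(2)] y(1) by blast
  have "compact (f ` K)"
    by (intro compact_continuous_image continuous_on_subset[OF cont] compact_Times) auto
  then obtain M where M: "\<And>p. p \<in> K \<Longrightarrow> \<bar>f p\<bar> \<le> M"
    using compact_imp_bounded bounded_iff by (metis (no_types, lifting) image_eqI real_norm_def)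
  show ?thesis
    unfolding F_def set_lebesgue_integral_def
  proof (rule integral_dominated_convergence[where w = "\<lambda>x. M * indicator {c..d} x"])
    show "(\<lambda>x'. indicator {c..x} x' *\<^sub>R f (s, x')) \<in> borel_measurable lborel"
      using slice_integrable[OF s, of c x] unfolding set_integrable_def by (rule borel_measurable_integrable)
    show "(\<lambda>x'. indicator {c..y k} x' *\<^sub>R f (t k, x')) \<in> borel_measurable lborel" for k
      using slice_integrable[OF t(1), of c "y k"] unfolding set_integrable_def by (rule borel_measurable_integrable)
    show "integrable lborel (\<lambda>x. M * indicator {c..d} x)"
      by (intro integrable_mult_right integrable_real_indicator) (auto simp: emeasure_lborel_Icc_eq)
    show "AE x' in lborel. norm (indicator {c..y k} x' *\<^sub>R f (t k, x')) \<le> M * indicator {c..d} x'" for k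
      using M[of "(t k, _)"] M[of "(0, c)"] cd t(1)[of k] y(1)[of k] by (intro AE_I2) (auto split: split_indicator)
    show "AE x' in lborel. (\<lambda>k. indicator {c..y k} x' *\<^sub>R f (t k, x')) \<longlonglongrightarrow> indicator {c..x} x' *\<^sub>R f (s, x')"
      using AE_lborel_singleton[of x]
    proof eventually_elim
      case (elim x')
      have f: "(\<lambda>k. f (t k, x')) \<longlonglongrightarrow> f (s, x')"
        by (rule continuous_on_tendsto_compose[OF cont]) (use t s in \<open>auto intro!: tendsto_intros\<close>)
      have "(\<lambda>k. indicator {c..y k} x' :: real) \<longlonglongrightarrow> indicator {c..x} x'"
      proof (cases "x' < x")
        case True
        from order_tendstoD(1)[OF y(2) this] have "\<forall>\<^sub>F k in sequentially. indicator {c..y k} x' = (indicator {c..x} x' :: real)"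
          by eventually_elim (use True in \<open>auto split: split_indicator\<close>)
        then show ?thesis by (rule tendsto_eventually)
      next
        case False
        with elim have "x < x'" by simp
        from order_tendstoD(2)[OF y(2) this] have "\<forall>\<^sub>F k in sequentially. indicator {c..y k} x' = (indicator {c..x} x' :: real)"
          by eventually_elim (use False elim in \<open>auto split: split_indicator\<close>)
        then show ?thesis by (rule tendsto_eventually)
      qed
      then show ?case using f by (intro tendsto_scaleR)
    qed
  qed
qed

end

section \<open>Countable additivity as an unconditional sum\<close>

lemma has_sum_set_integral_UN:
  fixes h :: "'a \<Rightarrow> real"
  assumes I: "countable I" and A: "\<And>i. i \<in> I \<Longrightarrow> A i \<in> sets M"
    and dj: "disjoint_family_on A I" and h: "set_integrable M (\<Union>i\<in>I. A i) h"
  shows "((\<lambda>i. LINT x:A i|M. h x) has_sum (LINT x:(\<Union>i\<in>I. A i)|M. h x)) I"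
proof -
  define e where "e = to_nat_on I"
  have e: "inj_on e I" unfolding e_def using I by (rule inj_on_to_nat_on)
  define B where "B n = (if n \<in> e ` I then A (the_inv_into I e n) else {})" for n
  have Be: "B (e i) = A i" if "i \<in> I" for i using that e by (simp add: B_def the_inv_into_f_f)
  have B0: "B n = {}" if "n \<notin> e ` I" for n using that by (simp add: B_def)
  have Bs: "B n \<in> sets M" for n
    using A e by (cases "n \<in> e ` I") (auto simp: Be B0)
  have Bdj: "B i \<inter> B j = {}" if "i \<noteq> j" for i j
  proof (cases "i \<in> e ` I \<and> j \<in> e ` I")
    case True
    then obtain i' j' where "i' \<in> I" "j' \<in> I" "i = e i'" "j = e j'" by blast
    moreover from this have "i' \<noteq> j'" using that by blast
    ultimately show ?thesis using dj Be unfolding disjoint_family_on_def by metis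
  qed (auto simp: B0)
  have UB: "(\<Union>n. B n) = (\<Union>i\<in>I. A i)"
  proof -
    have "(\<Union>n. B n) = (\<Union>n\<in>e ` I. B n)" using B0 by fast
    then show ?thesis by (simp add: Be)
  qed
  have hB: "set_integrable M (\<Union>n. B n) h" using h by (simp add: UB)
  have hBn: "set_integrable M (B n) h" for n by (rule set_integrable_subset[OF hB Bs]) auto
  have bound: "(\<Sum>n<N. norm (LINT x:B n|M. h x)) \<le> (LINT x:(\<Union>n. B n)|M. norm (h x))" for N
  proof -
    have "(\<Sum>n<N. norm (LINT x:B n|M. h x)) \<le> (\<Sum>n<N. LINT x:B n|M. norm (h x))"
      by (intro sum_mono set_integral_norm_bound hBn)
    also have "\<dots> = (LINT x:(\<Union>n<N. B n)|M. norm (h x))"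
      using Bdj Bs by (intro set_integral_finite_Union[symmetric] set_integrable_norm hBn) (auto simp: disjoint_family_on_def)
    also have "\<dots> \<le> (LINT x:(\<Union>n. B n)|M. norm (h x))"
      unfolding set_lebesgue_integral_def
    proof (rule integral_mono)
      show "integrable M (\<lambda>x. indicator (\<Union>n<N. B n) x *\<^sub>R norm (h x))"
        using set_integrable_UN[of "{..<N}" M B "\<lambda>x. norm (h x)"] set_integrable_norm[OF hBn] Bs
        by (simp add: set_integrable_def)
      show "integrable M (\<lambda>x. indicator (\<Union>n. B n) x *\<^sub>R norm (h x))"
        using set_integrable_norm[OF hB] by (simp add: set_integrable_def)
    qed (auto simp: indicator_def)
    finally show ?thesis .
  qed
  have summ: "summable (\<lambda>n. norm (LINT x:B n|M. h x))"
    by (rule summableI_nonneg_bounded[OF _ bound]) simp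
  have "summable (\<lambda>n. LINT x:B n|M. h x)" using summ by (rule summable_norm_cancel)
  then have "(\<lambda>n. LINT x:B n|M. h x) sums (LINT x:(\<Union>n. B n)|M. h x)"
    using lebesgue_integral_countable_add[OF Bs Bdj hB] by (simp add: sums_iff)
  with summ have "((\<lambda>n. LINT x:B n|M. h x) has_sum (LINT x:(\<Union>n. B n)|M. h x)) UNIV"
    by (rule norm_summable_imp_has_sum)
  then have "((\<lambda>n. LINT x:B n|M. h x) has_sum (LINT x:(\<Union>n. B n)|M. h x)) (e ` I)"
    by (subst has_sum_cong_neutral[where T = UNIV and g = "\<lambda>n. LINT x:B n|M. h x"]) (auto simp: B0 set_lebesgue_integral_def)
  then have "((\<lambda>i. LINT x:B (e i)|M. h x) has_sum (LINT x:(\<Union>n. B n)|M. h x)) I"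
    unfolding has_sum_reindex[OF e] by (simp add: o_def)
  moreover have "((\<lambda>i. LINT x:B (e i)|M. h x) has_sum S) I \<longleftrightarrow> ((\<lambda>i. LINT x:A i|M. h x) has_sum S) I" for S
    by (rule has_sum_cong) (simp add: Be)
  ultimately show ?thesis by (simp add: UB)
qed

section \<open>Step functions\<close>

lemma AE_not_on_graph:
  fixes u :: "real \<Rightarrow> real"
  assumes u: "continuous_on {0..s} u"
  shows "AE p in lebesgue. \<not> (fst p \<in> {0..s} \<and> snd p = u (fst p))"
proof -
  define G where "G = (\<lambda>t. (t, u t)) ` {0..s}"
  have "compact G" unfolding G_def by (intro compact_continuous_image continuous_intros u) auto
  then have Gs: "G \<in> sets (lborel \<Otimes>\<^sub>M lborel)" unfolding lborel_prod by (simp add: compact_imp_closed)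
  have "emeasure (lborel \<Otimes>\<^sub>M lborel) G = (\<integral>\<^sup>+t. emeasure lborel (Pair t -` G) \<partial>lborel)"
    by (rule lborel.emeasure_pair_measure_alt[OF Gs])
  also have "\<dots> = (\<integral>\<^sup>+t. 0 \<partial>(lborel :: real measure))"
  proof (rule nn_integral_cong)
    fix t
    have "Pair t -` G \<subseteq> {u t}" by (auto simp: G_def)
    then have "Pair t -` G = {} \<or> Pair t -` G = {u t}" by blast
    then show "emeasure lborel (Pair t -` G) = 0" by auto
  qed
  finally have "G \<in> null_sets lborel" using Gs unfolding lborel_prod by (simp add: null_sets_def)
  then have "AE p in lborel. p \<notin> G" by (rule AE_not_in)
  then have "AE p in lebesgue. p \<notin> G" by (rule AE_completion)
  then show ?thesis by eventually_elim (auto simp: G_def image_iff)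
qed

definition under :: "real \<Rightarrow> real \<Rightarrow> (real \<Rightarrow> real) \<Rightarrow> (real \<times> real) set" where
  "under c s u = {(t, x). 0 \<le> t \<and> t < s \<and> c \<le> x \<and> x \<le> u t}"

lemma sets_under:
  assumes u: "continuous_on {0..s} u"
  shows "under c s u \<in> sets borel"
proof -
  have "under c s u = {p\<in>{0..s} \<times> UNIV. snd p \<le> u (fst p)} \<inter> ({..<s} \<times> {c..})"
    by (auto simp: under_def)
  also have "closed {p\<in>{0..s} \<times> UNIV. snd p \<le> u (fst p)}"
    by (intro continuous_on_closed_Collect_le continuous_intros continuous_on_compose2[OF u] closed_Times) auto
  then have "{p\<in>{0..s} \<times> UNIV. snd p \<le> u (fst p)} \<inter> ({..<s} \<times> {c..}) \<in> sets borel"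
    by (intro sets.Int borel_Times) auto
  finally show ?thesis .
qed

lemma telescoping_steps:
  fixes F :: "real \<Rightarrow> real \<Rightarrow> real"
  shows "(\<Sum>n=1..M. F (\<tau> n) (h n) - F (\<tau> n) (h (n - 1))) =
     F (\<tau> (Suc M)) (h M) - F (\<tau> 0) (h 0) - (\<Sum>n<Suc M. F (\<tau> (Suc n)) (h n) - F (\<tau> n) (h n))"
  by (induction M) auto

lemma step_index:
  fixes \<tau> :: "nat \<Rightarrow> real"
  assumes "\<tau> 0 \<le> t" "t < \<tau> (Suc M)"
  shows "\<exists>n\<le>M. \<tau> n \<le> t \<and> t < \<tau> (Suc n)"
  using assms
proof (induction M)
  case (Suc M)
  then show ?case by (cases "t < \<tau> (Suc M)") (auto intro: le_SucI)
qed auto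

lemma steps_mono:
  fixes \<tau> :: "nat \<Rightarrow> 'a::preorder"
  assumes mono: "\<And>n. n \<le> M \<Longrightarrow> \<tau> n \<le> \<tau> (Suc n)" and "i \<le> j" "j \<le> Suc M"
  shows "\<tau> i \<le> \<tau> j"
  using assms(2,3)
proof (induction j rule: dec_induct)
  case (step j)
  then have "\<tau> i \<le> \<tau> j" "j \<le> M" by auto
  then show ?case using mono[of j] order_trans by blast
qed simp

lemma step_indicator:
  fixes \<tau> h :: "nat \<Rightarrow> real"
  assumes mono: "\<And>n. n \<le> M \<Longrightarrow> \<tau> n \<le> \<tau> (Suc n)"
    and n: "n \<le> M" "\<tau> n \<le> t" "t < \<tau> (Suc n)"
  shows "(\<Sum>j<Suc M. indicator ({\<tau> j..<\<tau> (Suc j)} \<times> {c..h j}) (t, x)) = (indicator {c..h n} x :: real)"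
proof -
  note le = steps_mono[of M \<tau>, OF mono]
  have "indicator ({\<tau> j..<\<tau> (Suc j)} \<times> {c..h j}) (t, x) = (if j = n then indicator {c..h n} x else 0 :: real)"
    if "j \<in> {..<Suc M}" for j
  proof -
    consider "j = n" | "j < n" | "n < j" by linarith
    then show ?thesis
    proof cases
      case 2
      then have "\<tau> (Suc j) \<le> \<tau> n" using n by (intro le) auto
      then show ?thesis using 2 n by (auto simp: indicator_def)
    next
      case 3
      then have "\<tau> (Suc n) \<le> \<tau> j" using that by (intro le) auto
      then show ?thesis using 3 n by (auto simp: indicator_def)
    qed (use n in \<open>auto simp: indicator_def\<close>)
  qed
  then have "(\<Sum>j<Suc M. indicator ({\<tau> j..<\<tau> (Suc j)} \<times> {c..h j}) (t, x))
      = (\<Sum>j<Suc M. if j = n then indicator {c..h n} x else 0 :: real)"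
    by (rule sum.cong[OF refl])
  then show ?thesis using n(1) by simp
qed

lemma step_indicator_outside:
  fixes \<tau> h :: "nat \<Rightarrow> real"
  assumes mono: "\<And>n. n \<le> M \<Longrightarrow> \<tau> n \<le> \<tau> (Suc n)" and t: "t < \<tau> 0 \<or> \<tau> (Suc M) \<le> t"
  shows "(\<Sum>j<Suc M. indicator ({\<tau> j..<\<tau> (Suc j)} \<times> {c..h j}) (t, x)) = (0 :: real)"
proof -
  note le = steps_mono[of M \<tau>, OF mono]
  have "\<not> (\<tau> j \<le> t \<and> t < \<tau> (Suc j))" if "j < Suc M" for j
    using le[of 0 j] le[of "Suc j" "Suc M"] that t by auto
  then show ?thesis by (intro sum.neutral) (auto simp: indicator_def)
qed

context area_setting
begin

text \<open>
  The sum on the left is the integral of \<open>f\<close> with respect to \<open>x\<close> along the vertical parts of the step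
  curve, each of which is a difference of values of \<open>F\<close> with the same first argument. Summation by
  parts replaces them by differences with the same second argument, and these are integrals over
  the rectangles below the steps.
\<close>

lemma step_path_integral:
  fixes \<tau> h :: "nat \<Rightarrow> real"
  assumes mono: "\<And>n. n \<le> M \<Longrightarrow> \<tau> n \<le> \<tau> (Suc n)" and \<tau>: "\<And>n. n \<le> Suc M \<Longrightarrow> \<tau> n \<in> {0..1}"
    and h: "\<And>n. n \<le> M \<Longrightarrow> h n \<in> {c..d}"
  shows "(\<Sum>n=1..M. LBINT x=h (n - 1)..h n. f (\<tau> n, x)) = F (\<tau> (Suc M)) (h M) - F (\<tau> 0) (h 0) -
     (LINT p|lebesgue. (\<Sum>n<Suc M. indicator ({\<tau> n..<\<tau> (Suc n)} \<times> {c..h n}) p) * partial_t f p)"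
proof -
  have "(\<Sum>n=1..M. LBINT x=h (n - 1)..h n. f (\<tau> n, x)) = (\<Sum>n=1..M. F (\<tau> n) (h n) - F (\<tau> n) (h (n - 1)))"
    using \<tau> h by (intro sum.cong slice_interval_integral) auto
  also have "\<dots> = F (\<tau> (Suc M)) (h M) - F (\<tau> 0) (h 0) - (\<Sum>n<Suc M. F (\<tau> (Suc n)) (h n) - F (\<tau> n) (h n))"
    by (rule telescoping_steps)
  also have "(\<Sum>n<Suc M. F (\<tau> (Suc n)) (h n) - F (\<tau> n) (h n))
     = (\<Sum>n<Suc M. LINT p:{\<tau> n..<\<tau> (Suc n)} \<times> {c..h n}|lebesgue. partial_t f p)"
    using \<tau> h mono by (intro sum.cong area_rectangle) (auto simp: less_Suc_eq_le)
  also have "\<dots> = (LINT p|lebesgue. (\<Sum>n<Suc M. indicator ({\<tau> n..<\<tau> (Suc n)} \<times> {c..h n}) p) * partial_t f p)"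
    unfolding sum_distrib_right set_lebesgue_integral_def real_scaleR_def
  proof (rule Bochner_Integration.integral_sum[symmetric])
    fix n assume "n \<in> {..<Suc M}"
    then have n: "n \<le> M" by auto
    have "set_integrable lebesgue ({\<tau> n..<\<tau> (Suc n)} \<times> {c..h n}) (partial_t f)"
    proof (rule set_integrable_subset[OF int])
      show "{\<tau> n..<\<tau> (Suc n)} \<times> {c..h n} \<in> sets lebesgue"
        using borel_Times[of "{\<tau> n..<\<tau> (Suc n)}" "{c..h n}"] by simp
      show "{\<tau> n..<\<tau> (Suc n)} \<times> {c..h n} \<subseteq> K" using \<tau>[of n] \<tau>[of "Suc n"] h[OF n] n by auto
    qed
    then show "integrable lebesgue (\<lambda>p. indicator ({\<tau> n..<\<tau> (Suc n)} \<times> {c..h n}) p * partial_t f p)"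
      by (simp add: set_integrable_def)
  qed
  finally show ?thesis .
qed

lemma set_integrable_under:
  assumes "continuous_on {0..s} u" "\<And>t. t \<in> {0..s} \<Longrightarrow> u t \<in> {c..d}" "s \<le> 1"
  shows "set_integrable lebesgue (under c s u) (partial_t f)"
proof (rule set_integrable_subset[OF int])
  show "under c s u \<in> sets lebesgue" using sets_under[OF assms(1)] by simp
  show "under c s u \<subseteq> K" using assms(2,3) by (fastforce simp: under_def)
qed

text \<open>
  Off the graph of \<open>u\<close>, which is a null set, the indicator functions \<open>\<phi> k\<close> of the regions below the
  step functions are eventually constant, and they are bounded by the indicator of \<open>K\<close>; so the area
  terms converge by dominated convergence.
\<close>

lemma step_path_integral_tendsto:
  fixes \<tau> h :: "nat \<Rightarrow> nat \<Rightarrow> real" and M :: "nat \<Rightarrow> nat"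
  assumes s: "0 < s" "s \<le> 1"
    and u: "continuous_on {0..s} u" and ucd: "\<And>t. t \<in> {0..s} \<Longrightarrow> u t \<in> {c..d}"
    and \<tau>0: "\<And>k. \<tau> k 0 = 0" and mono: "\<And>k n. n \<le> M k \<Longrightarrow> \<tau> k n \<le> \<tau> k (Suc n)"
    and \<tau>s: "\<And>k n. n \<le> Suc (M k) \<Longrightarrow> \<tau> k n \<in> {0..s}" and lim: "(\<lambda>k. \<tau> k (Suc (M k))) \<longlonglongrightarrow> s"
    and hcd: "\<And>k n. n \<le> M k \<Longrightarrow> h k n \<in> {c..d}"
    and conv: "\<And>e. e > 0 \<Longrightarrow> \<forall>\<^sub>F k in sequentially. \<forall>n\<le>M k. \<forall>t. \<tau> k n \<le> t \<and> t \<le> \<tau> k (Suc n) \<longrightarrow> \<bar>h k n - u t\<bar> < e"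
  shows "(\<lambda>k. \<Sum>n=1..M k. LBINT x=h k (n - 1)..h k n. f (\<tau> k n, x)) \<longlonglongrightarrow>
     F s (u s) - F 0 (u 0) - (LINT p:under c s u|lebesgue. partial_t f p)"
proof -
  define \<phi> where "\<phi> k p = (\<Sum>n<Suc (M k). indicator ({\<tau> k n..<\<tau> k (Suc n)} \<times> {c..h k n}) p :: real)" for k p
  have \<tau>1: "\<tau> k n \<in> {0..1}" if "n \<le> Suc (M k)" for k n using \<tau>s[OF that] s by auto
  have eq: "(\<Sum>n=1..M k. LBINT x=h k (n - 1)..h k n. f (\<tau> k n, x)) =
      F (\<tau> k (Suc (M k))) (h k (M k)) - F 0 (h k 0) - (LINT p|lebesgue. \<phi> k p * partial_t f p)" for k
    unfolding \<phi>_def \<tau>0[of k, symmetric] using mono \<tau>1 hcd by (rule step_path_integral)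
  have h0: "(\<lambda>k. h k 0) \<longlonglongrightarrow> u 0"
  proof (rule tendstoI)
    fix e :: real assume "e > 0"
    from conv[OF this] show "\<forall>\<^sub>F k in sequentially. dist (h k 0) (u 0) < e"
      by eventually_elim (use \<tau>0 mono[of 0] in \<open>auto simp: dist_real_def\<close>)
  qed
  have hM: "(\<lambda>k. h k (M k)) \<longlonglongrightarrow> u s"
  proof -
    have "(\<lambda>k. u (\<tau> k (Suc (M k)))) \<longlonglongrightarrow> u s"
      by (rule continuous_on_tendsto_compose[OF u lim]) (use s \<tau>s in auto)
    moreover have "(\<lambda>k. h k (M k) - u (\<tau> k (Suc (M k)))) \<longlonglongrightarrow> 0"
    proof (rule tendstoI)
      fix e :: real assume "e > 0"
      from conv[OF this] show "\<forall>\<^sub>F k in sequentially. dist (h k (M k) - u (\<tau> k (Suc (M k)))) 0 < e"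
        by eventually_elim (use mono in \<open>auto simp: dist_real_def\<close>)
    qed
    ultimately show ?thesis using tendsto_add by fastforce
  qed
  have F1: "(\<lambda>k. F (\<tau> k (Suc (M k))) (h k (M k))) \<longlonglongrightarrow> F s (u s)"
    using \<tau>1 hcd lim hM by (intro F_tendsto) auto
  have F2: "(\<lambda>k. F 0 (h k 0)) \<longlonglongrightarrow> F 0 (u 0)"
    using hcd h0 by (intro F_tendsto) auto
  have \<phi>01: "0 \<le> \<phi> k p \<and> \<phi> k p \<le> indicator K p" for k p
  proof -
    obtain t x where p: "p = (t, x)" by fastforce
    show ?thesis
    proof (cases "\<tau> k 0 \<le> t \<and> t < \<tau> k (Suc (M k))")
      case True
      then obtain n where n: "n \<le> M k" "\<tau> k n \<le> t" "t < \<tau> k (Suc n)" using step_index by metis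
      have "\<phi> k p = indicator {c..h k n} x" unfolding \<phi>_def p using mono n by (rule step_indicator)
      then show ?thesis using True hcd[OF n(1)] \<tau>0[of k] \<tau>1[of "Suc (M k)" k] by (auto simp: p indicator_def)
    next
      case False
      have "\<phi> k p = 0" unfolding \<phi>_def p by (rule step_indicator_outside) (use mono False in auto)
      then show ?thesis by simp
    qed
  qed
  have \<phi>meas: "\<phi> k \<in> borel_measurable lebesgue" for k
    unfolding \<phi>_def
  proof (intro borel_measurable_sum borel_measurable_indicator)
    show "{\<tau> k n..<\<tau> k (Suc n)} \<times> {c..h k n} \<in> sets lebesgue" for n
      using borel_Times[of "{\<tau> k n..<\<tau> k (Suc n)}" "{c..h k n}"] by simp
  qed
  have Pm: "(\<lambda>p. indicator K p * partial_t f p) \<in> borel_measurable lebesgue" and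
    Pi: "integrable lebesgue (\<lambda>p. \<bar>indicator K p * partial_t f p\<bar>)"
    using int unfolding set_integrable_def by auto
  have \<phi>K: "\<phi> k p * partial_t f p = \<phi> k p * (indicator K p * partial_t f p)" for k p
    using \<phi>01[of k p] by (auto simp: indicator_def split: if_splits)
  have I: "(\<lambda>k. LINT p|lebesgue. \<phi> k p * partial_t f p) \<longlonglongrightarrow> (LINT p:under c s u|lebesgue. partial_t f p)"
    unfolding set_lebesgue_integral_def
  proof (rule integral_dominated_convergence[OF _ _ Pi])
    show "(\<lambda>p. indicator (under c s u) p *\<^sub>R partial_t f p) \<in> borel_measurable lebesgue"
      using set_integrable_under[OF u ucd s(2)] unfolding set_integrable_def by (rule borel_measurable_integrable)
    show "(\<lambda>p. \<phi> k p * partial_t f p) \<in> borel_measurable lebesgue" for k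
      unfolding \<phi>K using \<phi>meas Pm by (rule borel_measurable_times)
    show "AE p in lebesgue. norm (\<phi> k p * partial_t f p) \<le> \<bar>indicator K p * partial_t f p\<bar>" for k
      using \<phi>01[of k] by (intro AE_I2) (auto simp: abs_mult intro!: mult_right_mono)
    show "AE p in lebesgue. (\<lambda>k. \<phi> k p * partial_t f p) \<longlonglongrightarrow> indicator (under c s u) p *\<^sub>R partial_t f p"
      using AE_not_on_graph[OF u]
    proof eventually_elim
      case (elim p)
      obtain t x where p: "p = (t, x)" by fastforce
      have "\<forall>\<^sub>F k in sequentially. \<phi> k p = indicator (under c s u) p"
      proof (cases "0 \<le> t \<and> t < s")
        case True
        then have "x \<noteq> u t" using elim by (auto simp: p)
        then have "\<bar>x - u t\<bar> > 0" by simp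
        from conv[OF this] order_tendstoD(1)[OF lim, of t] True
        have "\<forall>\<^sub>F k in sequentially. (\<forall>n\<le>M k. \<forall>t'. \<tau> k n \<le> t' \<and> t' \<le> \<tau> k (Suc n) \<longrightarrow> \<bar>h k n - u t'\<bar> < \<bar>x - u t\<bar>) \<and> t < \<tau> k (Suc (M k))"
          by (auto intro: eventually_conj)
        then show ?thesis
        proof eventually_elim
          case (elim k)
          have "\<tau> k 0 \<le> t" using True \<tau>0 by simp
          then obtain n where n: "n \<le> M k" "\<tau> k n \<le> t" "t < \<tau> k (Suc n)" using step_index elim by metis
          have "\<bar>h k n - u t\<bar> < \<bar>x - u t\<bar>" using elim n by auto
          then have "x \<le> h k n \<longleftrightarrow> x \<le> u t" by linarith
          moreover have "\<phi> k p = indicator {c..h k n} x" unfolding \<phi>_def p using mono n by (rule step_indicator)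
          ultimately show ?case using True by (auto simp: p under_def indicator_def)
        qed
      next
        case False
        have "\<phi> k p = 0" for k unfolding \<phi>_def p
          by (rule step_indicator_outside) (use mono False \<tau>0[of k] \<tau>s[of "Suc (M k)" k] in auto)
        then show ?thesis using False by (auto simp: p under_def)
      qed
      then have "(\<lambda>k. \<phi> k p) \<longlonglongrightarrow> indicator (under c s u) p" by (rule tendsto_eventually)
      then show ?case by (simp add: tendsto_mult_right)
    qed
  qed
  show ?thesis unfolding eq by (intro tendsto_diff F1 F2 I)
qed

end

section \<open>The signed areas of the gaps\<close>

text \<open>
  Let \<open>h\<close> be \<open>partial_t f\<close> times the difference of the indicators of the regions below the chord and
  below the graph. A point off both curves where \<open>h\<close> does not vanish lies strictly between them, hence
  in the region of exactly one gap, and there \<open>h\<close> is \<open>\<sigma> k\<close> times \<open>partial_t f\<close>. The integral of \<open>h\<close> is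
  thus the sum of its integrals over the gaps.
\<close>

lemma (in area_setting) gap_areas_has_sum:
  assumes g: "continuous_on {0..1} g" and gcd: "\<And>t. t \<in> {0..1} \<Longrightarrow> g t \<in> {c..d}" and g0: "g 0 = 0"
    and s: "0 < s" "s \<le> 1" and m: "g s = m * s"
    and G: "\<forall>k\<in>chord_gaps g s. gap_domain g k (G k) (\<sigma> k)"
  shows "((\<lambda>k. \<sigma> k * (LINT p:G k|lebesgue. partial_t f p)) has_sum
      (LINT p:under c s (\<lambda>t. m * t)|lebesgue. partial_t f p) - (LINT p:under c s g|lebesgue. partial_t f p))
      (chord_gaps g s)"
proof -
  let ?I = "chord_gaps g s" and ?P = "partial_t f"
  define A where "A = (\<lambda>(a, b). gap_region g m a b)"
  define UL where "UL = under c s (\<lambda>t. m * t)"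
  define UG where "UG = under c s g"
  have GA: "G k = A k" and \<sigma>: "\<And>t x. (t, x) \<in> A k \<Longrightarrow> \<sigma> k = sgn (m * t - g t)" if k: "k \<in> ?I" for k
  proof -
    obtain a b where e: "k = (a, b)" by fastforce
    have "gap_domain g (a, b) (G k) (\<sigma> k)" using G k e by auto
    then have *: "G k = gap_region g m a b \<and> (\<forall>t. a < t \<and> t < b \<longrightarrow> \<sigma> k = sgn (m * t - g t))"
      using gap_domain_chord_gap[OF g g0 s m] k e by blast
    then show "G k = A k" by (simp add: A_def e)
    show "\<sigma> k = sgn (m * t - g t)" if "(t, x) \<in> A k" for t x
      using * that by (auto simp: A_def e gap_region_def)
  qed
  have inI: "0 \<le> a \<and> b \<le> s" if "(a, b) \<in> ?I" for a b
    using that chord_gaps_iff[OF g g0 s m] by blast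
  have gs: "continuous_on {0..s} g" and ms: "continuous_on {0..s} (\<lambda>t. m * t)"
    by (rule continuous_on_subset[OF g], use s in simp, intro continuous_intros)
  have gcd': "g t \<in> {c..d}" if "t \<in> {0..s}" for t using gcd that s by auto
  have mcd: "m * t \<in> {c..d}" if "t \<in> {0..s}" for t
  proof -
    have "m * t = (1 - t / s) * g 0 + (t / s) * g s" using s by (simp add: g0 m)
    moreover have "0 \<le> t / s" "t / s \<le> 1" using that s by auto
    ultimately show ?thesis
      using convexD_alt[of "{c..d}" "g 0" "g s" "t / s"] gcd s by simp
  qed
  have op: "open (A k)" if "k \<in> ?I" for k
  proof -
    obtain a b where e: "k = (a, b)" by fastforce
    have "gap_domain g (a, b) (G k) (\<sigma> k)" using G that e by auto
    then have "open (G k)" unfolding gap_domain_def positive_jordan_boundary_def prod.case by blast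
    then show ?thesis by (simp add: GA[OF that])
  qed
  define h where "h p = (indicator UL p - indicator UG p) * ?P p" for p
  have intL: "set_integrable lebesgue UL ?P" and intG: "set_integrable lebesgue UG ?P"
    unfolding UL_def UG_def
    by (rule set_integrable_under[OF ms mcd s(2)], assumption, rule set_integrable_under[OF gs gcd' s(2)])
  have h: "integrable lebesgue h" and hint: "(LINT p|lebesgue. h p) = (LINT p:UL|lebesgue. ?P p) - (LINT p:UG|lebesgue. ?P p)"
    using intL intG unfolding h_def set_integrable_def set_lebesgue_integral_def left_diff_distrib by simp_all
  have opU: "open (\<Union>k\<in>?I. A k)" using op by blast
  have hU: "set_integrable lebesgue (\<Union>k\<in>?I. A k) h"
    unfolding set_integrable_def using opU h by (intro integrable_mult_indicator) auto
  have dj: "disjoint_family_on A ?I"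
    unfolding disjoint_family_on_def
  proof (intro ballI impI, rule ccontr)
    fix i j assume ij: "i \<in> ?I" "j \<in> ?I" "i \<noteq> j" "A i \<inter> A j \<noteq> {}"
    obtain a b a' b' where e: "i = (a, b)" "j = (a', b')" by fastforce
    from ij(4) obtain t where "a < t" "t < b" "a' < t" "t < b'" by (auto simp: e A_def gap_region_def)
    then show False using chord_gaps_disjoint[OF g g0 s m ij(1,2)[unfolded e], of t] ij(3) by (simp add: e)
  qed
  have "((\<lambda>k. LINT p:A k|lebesgue. h p) has_sum (LINT p:(\<Union>k\<in>?I. A k)|lebesgue. h p)) ?I"
    using op by (intro has_sum_set_integral_UN countable_chord_gaps[OF g g0 s m] dj hU) auto
  moreover have "(LINT p:(\<Union>k\<in>?I. A k)|lebesgue. h p) = (LINT p|lebesgue. h p)"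
    unfolding set_lebesgue_integral_def
  proof (rule integral_cong_AE)
    show "(\<lambda>p. indicator (\<Union>k\<in>?I. A k) p *\<^sub>R h p) \<in> borel_measurable lebesgue"
      using hU unfolding set_integrable_def by (rule borel_measurable_integrable)
    show "h \<in> borel_measurable lebesgue" using h by (rule borel_measurable_integrable)
    show "AE p in lebesgue. indicator (\<Union>k\<in>?I. A k) p *\<^sub>R h p = h p"
      using AE_not_on_graph[OF gs] AE_not_on_graph[OF ms]
    proof eventually_elim
      case (elim p)
      obtain t x where p: "p = (t, x)" by fastforce
      show ?case
      proof (cases "h p = 0")
        case False
        then have "(p \<in> UL) \<noteq> (p \<in> UG)" by (auto simp: h_def indicator_def)
        then have t: "0 \<le> t" "t \<le> s" and x: "g t < x \<and> x < m * t \<or> m * t < x \<and> x < g t"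
          using elim by (auto simp: p UL_def UG_def under_def)
        from x have "g t \<noteq> m * t" by auto
        then obtain a b where "(a, b) \<in> ?I" "a < t" "t < b"
          using ex_chord_gap[OF g g0 s m t] by blast
        then have "p \<in> (\<Union>k\<in>?I. A k)"
          using x by (auto simp: A_def gap_region_def p)
        then show ?thesis by simp
      qed simp
    qed
  qed
  moreover have "(LINT p:A k|lebesgue. h p) = \<sigma> k * (LINT p:G k|lebesgue. ?P p)" if k: "k \<in> ?I" for k
  proof -
    obtain a b where e: "k = (a, b)" by fastforce
    have "h p = \<sigma> k * ?P p" if pA: "p \<in> A k" for p
    proof -
      obtain t x where p: "p = (t, x)" by fastforce
      from pA have tx: "a < t" "t < b" "g t < x \<and> x < m * t \<or> m * t < x \<and> x < g t"
        by (auto simp: A_def e gap_region_def p)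
      have t: "0 \<le> t" "t < s" using inI k tx unfolding e by force+
      then have "c \<le> g t" "c \<le> m * t" using gcd'[of t] mcd[of t] by auto
      then have "indicator UL p - indicator UG p = sgn (m * t - g t)"
        using tx t by (auto simp: p UL_def UG_def under_def indicator_def)
      then show ?thesis using \<sigma>[OF k] pA by (simp add: h_def p)
    qed
    then have "(LINT p:A k|lebesgue. h p) = (LINT p:A k|lebesgue. \<sigma> k * ?P p)"
      unfolding set_lebesgue_integral_def by (intro Bochner_Integration.integral_cong) (auto simp: indicator_def)
    then show ?thesis by (simp add: GA[OF k])
  qed
  ultimately show ?thesis
    unfolding hint UL_def UG_def using has_sum_cong[of ?I "\<lambda>k. LINT p:A k|lebesgue. h p"] by force
qed

section \<open>The integral along the path\<close>

lemma dyadic_mean_bounds: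
  assumes g: "continuous_on {0..1} g" and n: "n < 2 ^ k"
    and b: "\<And>\<tau>. dyadic k n \<le> \<tau> \<Longrightarrow> \<tau> \<le> dyadic k (Suc n) \<Longrightarrow> lo \<le> g \<tau> \<and> g \<tau> \<le> hi"
  shows "lo \<le> dyadic_mean g k n \<and> dyadic_mean g k n \<le> hi"
proof -
  let ?a = "dyadic k n" and ?b = "dyadic k (Suc n)"
  have len: "?b - ?a = 1 / 2 ^ k" by (simp add: dyadic_def diff_divide_distrib[symmetric])
  have "real (Suc n) \<le> 2 ^ k" using n by (metis Suc_leI of_nat_le_iff of_nat_numeral of_nat_power)
  then have ab: "0 \<le> ?a" "?a \<le> ?b" "?b \<le> 1" by (auto simp: dyadic_def divide_right_mono)
  then have gab: "continuous_on {?a..?b} g" by (auto intro: continuous_on_subset[OF g])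
  have "(LBINT \<tau>=?a..?b. g \<tau>) = integral {?a..?b} g"
    using ab gab by (intro interval_integral_eq_integral borel_integrable_atLeastAtMost') auto
  moreover have "integral {?a..?b} (\<lambda>_. lo) \<le> integral {?a..?b} g" "integral {?a..?b} g \<le> integral {?a..?b} (\<lambda>_. hi)"
    by (rule integral_le; use b gab in \<open>auto intro: integrable_continuous_real\<close>)+
  ultimately have "lo / 2 ^ k \<le> (LBINT \<tau>=?a..?b. g \<tau>)" "(LBINT \<tau>=?a..?b. g \<tau>) \<le> hi / 2 ^ k"
    using ab by (simp_all add: len)
  then show ?thesis by (simp add: dyadic_mean_def field_simps)
qed

text \<open>
  The condition on \<open>n\<close> depends only on \<open>n div 2\<close>, which has to be the number of one of the
  \<open>\<lfloor>s * 2 ^ k\<rfloor>\<close> dyadic intervals of level \<open>k\<close> that fit into \<open>[0, s]\<close>.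
\<close>

lemma dyadic_indices_eq:
  assumes "0 < s" "s \<le> 1"
  shows "dyadic_indices 0 s (Suc k) = {..<2 * nat \<lfloor>s * 2 ^ k\<rfloor>}"
proof -
  have "nat \<lfloor>s * 2 ^ k\<rfloor> \<le> 2 ^ k"
  proof -
    have "s * 2 ^ k \<le> 2 ^ k" using assms by simp
    then have "\<lfloor>s * 2 ^ k\<rfloor> \<le> \<lfloor>(2 :: real) ^ k\<rfloor>" by (rule floor_mono)
    also have "\<lfloor>(2 :: real) ^ k\<rfloor> = int (2 ^ k)" by (metis floor_of_nat of_nat_numeral of_nat_power)
    finally show ?thesis by linarith
  qed
  then have *: "n \<le> 2 * 2 ^ k" if "n < 2 * nat \<lfloor>s * 2 ^ k\<rfloor>" for n using that by linarith
  have "{dyadic k (n div 2)..dyadic k (n div 2 + 1)} \<subseteq> {0..s} \<longleftrightarrow> n < 2 * nat \<lfloor>s * 2 ^ k\<rfloor>" for n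
  proof -
    have "dyadic k (n div 2) \<le> dyadic k (n div 2 + 1)" "0 \<le> dyadic k (n div 2)" by (auto simp: dyadic_def divide_right_mono)
    then have "{dyadic k (n div 2)..dyadic k (n div 2 + 1)} \<subseteq> {0..s} \<longleftrightarrow> dyadic k (n div 2 + 1) \<le> s" by auto
    also have "\<dots> \<longleftrightarrow> real (n div 2 + 1) \<le> s * 2 ^ k" by (simp add: dyadic_def field_simps)
    also have "\<dots> \<longleftrightarrow> n div 2 + 1 \<le> nat \<lfloor>s * 2 ^ k\<rfloor>"
      using assms by (simp add: le_nat_iff le_floor_iff)
    also have "\<dots> \<longleftrightarrow> n < 2 * nat \<lfloor>s * 2 ^ k\<rfloor>" by linarith
    finally show ?thesis .
  qed
  then show ?thesis using * by (auto simp: dyadic_indices_def)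
qed

lemma path_sum_eq:
  assumes "0 < s" "s \<le> 1" and N: "nat \<lfloor>s * 2 ^ k\<rfloor> \<ge> 1"
  shows "path_sum f g 0 s (Suc k) =
    (\<Sum>n=1..2 * nat \<lfloor>s * 2 ^ k\<rfloor> - 1.
       LBINT x=dyadic_mean g (Suc k) (n - 1)..dyadic_mean g (Suc k) n. f (dyadic (Suc k) n, x))"
proof -
  let ?M = "2 * nat \<lfloor>s * 2 ^ k\<rfloor>"
  have "Min {..<m} = 0 \<and> Max {..<m} = m - 1 \<and> {..<m} \<noteq> {}" if "m \<ge> 1" for m :: nat
    using that by (auto intro!: Min_eqI Max_eqI simp: lessThan_empty_iff)
  from this[of ?M] N have "Min {..<?M} = 0" "Max {..<?M} = ?M - 1" "{..<?M} \<noteq> {}" by linarith+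
  then show ?thesis unfolding path_sum_def dyadic_indices_eq[OF assms(1,2)] by simp
qed

text \<open>
  By uniform continuity the step functions of dyadic means converge uniformly to \<open>g\<close>. Their domains
  end at the largest dyadic point of the preceding level in \<open>[0, s]\<close>, which tends to \<open>s\<close>.
\<close>

lemma (in area_setting) path_sum_tendsto:
  assumes g: "continuous_on {0..1} g" and gcd: "\<And>t. t \<in> {0..1} \<Longrightarrow> g t \<in> {c..d}"
    and s: "0 < s" "s \<le> 1"
  shows "path_sum f g 0 s \<longlonglongrightarrow> F s (g s) - F 0 (g 0) - (LINT p:under c s g|lebesgue. partial_t f p)"
proof -
  obtain k0 :: nat where "1 / s < 2 ^ k0" using real_arch_pow[of 2 "1 / s"] by auto
  then have k0: "1 \<le> s * 2 ^ k0" using s by (simp add: field_simps)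
  \<comment> \<open>From level \<open>k0\<close> on at least one dyadic interval fits into \<open>[0, s]\<close>, so that the sums are not empty.\<close>
  define N where "N j = nat \<lfloor>s * 2 ^ (j + k0)\<rfloor>" for j
  have N1: "N j \<ge> 1" for j
  proof -
    have "s * 2 ^ k0 \<le> s * 2 ^ (j + k0)" using s by (simp add: power_add)
    then have "1 \<le> \<lfloor>s * 2 ^ (j + k0)\<rfloor>" using k0 by (simp add: le_floor_iff)
    then show ?thesis unfolding N_def by linarith
  qed
  have Nle: "real (N j) \<le> s * 2 ^ (j + k0)" "s * 2 ^ (j + k0) < real (N j) + 1" for j
    using s by (auto simp: N_def of_nat_nat)
  define \<tau> where "\<tau> j n = dyadic (Suc (j + k0)) n" for j n
  define h where "h j n = dyadic_mean g (Suc (j + k0)) n" for j n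
  define M where "M j = 2 * N j - 1" for j
  have SM: "Suc (M j) = 2 * N j" for j using N1[of j] by (simp add: M_def)
  have \<tau>SM: "\<tau> j (Suc (M j)) = real (N j) / 2 ^ (j + k0)" for j unfolding SM by (simp add: \<tau>_def dyadic_def)
  have \<tau>mono: "\<tau> j n \<le> \<tau> j n'" if "n \<le> n'" for j n n' using that by (simp add: \<tau>_def dyadic_def divide_right_mono)
  have \<tau>s: "\<tau> j (Suc (M j)) \<le> s" for j unfolding \<tau>SM using Nle(1)[of j] by (simp add: field_simps)
  have \<tau>in: "\<tau> j n \<in> {0..s}" if "n \<le> Suc (M j)" for j n
    using \<tau>mono[OF that, of j] \<tau>s[of j] by (auto simp: \<tau>_def dyadic_def)
  have n2: "n < 2 ^ Suc (j + k0)" if "n \<le> M j" for j n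
  proof -
    have "real (N j) \<le> 2 ^ (j + k0)"
      using Nle(1)[of j] s by (meson mult_left_le_one_le order_trans zero_le_numeral zero_le_power less_imp_le)
    then have "N j \<le> 2 ^ (j + k0)" by (metis of_nat_le_iff of_nat_numeral of_nat_power)
    then show ?thesis using that SM[of j] by simp
  qed
  have small: "(\<lambda>j. 1 / 2 ^ (j + k0) :: real) \<longlonglongrightarrow> 0"
    using LIMSEQ_ignore_initial_segment[OF LIMSEQ_inverse_realpow_zero[of 2], of k0] by (simp add: inverse_eq_divide)
  have "(\<lambda>j. \<Sum>n=1..M j. LBINT x=h j (n - 1)..h j n. f (\<tau> j n, x)) \<longlonglongrightarrow>
     F s (g s) - F 0 (g 0) - (LINT p:under c s g|lebesgue. partial_t f p)"
  proof (rule step_path_integral_tendsto[OF s])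
    show "continuous_on {0..s} g" using g s by (auto intro: continuous_on_subset)
    show "g t \<in> {c..d}" if "t \<in> {0..s}" for t using gcd that s by auto
    show "\<tau> j 0 = 0" for j by (simp add: \<tau>_def dyadic_def)
    show "\<tau> j n \<le> \<tau> j (Suc n)" for j n by (rule \<tau>mono) simp
    show "\<tau> j n \<in> {0..s}" if "n \<le> Suc (M j)" for j n using \<tau>in[OF that] .
    show "(\<lambda>j. \<tau> j (Suc (M j))) \<longlonglongrightarrow> s"
    proof (rule Lim_transform_bound[of "\<lambda>j. \<tau> j (Suc (M j)) - s", THEN LIM_zero_cancel, OF _ small])
      show "\<forall>\<^sub>F j in sequentially. norm (\<tau> j (Suc (M j)) - s) \<le> norm (1 / 2 ^ (j + k0) :: real)"
      proof (intro always_eventually allI)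
        fix j
        have "s - 1 / 2 ^ (j + k0) \<le> \<tau> j (Suc (M j))"
        proof -
          have "s = s * 2 ^ (j + k0) / 2 ^ (j + k0)" by simp
          also have "\<dots> \<le> (real (N j) + 1) / 2 ^ (j + k0)"
            using Nle(2)[of j] by (intro divide_right_mono) auto
          finally show ?thesis unfolding \<tau>SM by (simp add: add_divide_distrib)
        qed
        then show "norm (\<tau> j (Suc (M j)) - s) \<le> norm (1 / 2 ^ (j + k0) :: real)"
          using \<tau>s[of j] by (simp add: abs_le_iff)
      qed
    qed
    show "h j n \<in> {c..d}" if n: "n \<le> M j" for j n
    proof -
      have "c \<le> g t \<and> g t \<le> d" if "dyadic (Suc (j + k0)) n \<le> t" "t \<le> dyadic (Suc (j + k0)) (Suc n)" for t
        using gcd[of t] that \<tau>in[of n j] \<tau>in[of "Suc n" j] n s by (auto simp: \<tau>_def)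
      from dyadic_mean_bounds[OF g n2[OF n] this] show ?thesis by (auto simp: h_def)
    qed
    show "\<forall>\<^sub>F j in sequentially. \<forall>n\<le>M j. \<forall>t. \<tau> j n \<le> t \<and> t \<le> \<tau> j (Suc n) \<longrightarrow> \<bar>h j n - g t\<bar> < e" if "e > 0" for e
    proof -
      have "uniformly_continuous_on {0..1} g" using g by (intro compact_uniformly_continuous) auto
      then obtain \<delta> where \<delta>: "\<delta> > 0" "\<And>t t'. t \<in> {0..1} \<Longrightarrow> t' \<in> {0..1} \<Longrightarrow> \<bar>t' - t\<bar> < \<delta> \<Longrightarrow> \<bar>g t' - g t\<bar> < e / 2"
        unfolding uniformly_continuous_on_def dist_real_def using \<open>e > 0\<close> half_gt_zero by metis
      from order_tendstoD(2)[OF small \<delta>(1)] show ?thesis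
      proof eventually_elim
        case (elim j)
        show ?case
        proof (intro allI impI)
          fix n t assume n: "n \<le> M j" and t: "\<tau> j n \<le> t \<and> t \<le> \<tau> j (Suc n)"
          have len: "\<tau> j (Suc n) - \<tau> j n \<le> 1 / 2 ^ (j + k0)"
            by (simp add: \<tau>_def dyadic_def diff_divide_distrib[symmetric] field_simps)
          have 01: "0 \<le> \<tau> j n" "\<tau> j (Suc n) \<le> 1" using \<tau>in[of n j] \<tau>in[of "Suc n" j] n s by auto
          have "g t - e / 2 \<le> g t' \<and> g t' \<le> g t + e / 2"
            if "dyadic (Suc (j + k0)) n \<le> t'" "t' \<le> dyadic (Suc (j + k0)) (Suc n)" for t'
          proof -
            have t': "\<tau> j n \<le> t'" "t' \<le> \<tau> j (Suc n)" using that by (auto simp: \<tau>_def)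
            then have "\<bar>t' - t\<bar> < \<delta>" using t len elim by (simp add: abs_if)
            then have "\<bar>g t' - g t\<bar> < e / 2" using t t' 01 by (intro \<delta>(2)) auto
            then show ?thesis by (simp add: abs_if split: if_splits)
          qed
          from dyadic_mean_bounds[OF g n2[OF n] this] have "\<bar>h j n - g t\<bar> \<le> e / 2"
            unfolding h_def by linarith
          then show "\<bar>h j n - g t\<bar> < e" using \<open>e > 0\<close> by simp
        qed
      qed
    qed
  qed
  moreover have "path_sum f g 0 s (j + Suc k0) = (\<Sum>n=1..M j. LBINT x=h j (n - 1)..h j n. f (\<tau> j n, x))" for j
    using path_sum_eq[OF s, of "j + k0" f g] N1[of j] by (simp add: M_def N_def h_def \<tau>_def)
  ultimately show ?thesis using LIMSEQ_offset[of "path_sum f g 0 s" "Suc k0"] by simp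
qed

section \<open>The integral along the chord\<close>

context area_setting
begin

text \<open>
  The substitution \<open>x = m * t\<close> turns the vertical piece of the step curve into an integral over \<open>[p, q]\<close>
  in which the first argument of \<open>f\<close> is frozen at \<open>q\<close>.
\<close>

lemma chord_step_estimate:
  assumes t: "0 \<le> p" "p \<le> q" "q \<le> 1"
    and close: "\<And>t. p \<le> t \<Longrightarrow> t \<le> q \<Longrightarrow> \<bar>f (q, m * t) - f (t, m * t)\<bar> \<le> e"
  shows "\<bar>(LBINT x=m * p..m * q. f (q, x)) - m * integral {p..q} (\<lambda>t. f (t, m * t))\<bar> \<le> \<bar>m\<bar> * e * (q - p)"
proof -
  have c1: "continuous_on {p..q} (\<lambda>t. f (q, m * t))"
    by (rule continuous_on_compose2[OF cont]) (use t in \<open>auto intro!: continuous_intros\<close>)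
  have c2: "continuous_on {p..q} (\<lambda>t. f (t, m * t))"
    by (rule continuous_on_compose2[OF cont]) (use t in \<open>auto intro!: continuous_intros\<close>)
  have "(LBINT x=m * p..m * q. f (q, x)) = (LBINT t=p..q. m *\<^sub>R f (q, m * t))"
  proof (rule interval_integral_substitution_finite[symmetric])
    show "continuous_on ((*) m ` {p..q}) (\<lambda>x. f (q, x))"
      using continuous_slice[of q] t by (auto intro: continuous_on_subset)
  qed (use t in \<open>auto intro!: derivative_eq_intros\<close>)
  also have "\<dots> = integral {p..q} (\<lambda>t. m *\<^sub>R f (q, m * t))"
    using t by (intro interval_integral_eq_integral borel_integrable_atLeastAtMost' continuous_intros c1) auto
  finally have "(LBINT x=m * p..m * q. f (q, x)) - m * integral {p..q} (\<lambda>t. f (t, m * t))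
     = m * (integral {p..q} (\<lambda>t. f (q, m * t) - f (t, m * t)))"
    using c1 c2 by (simp add: integral_diff integrable_continuous_real right_diff_distrib)
  moreover have "norm (integral {p..q} (\<lambda>t. f (q, m * t) - f (t, m * t))) \<le> e * (q - p)"
    using t close by (intro integral_bound continuous_intros c1 c2) auto
  ultimately show ?thesis by (simp add: abs_mult mult.assoc mult_left_mono)
qed

text \<open>
  The step functions inscribed in the line converge to it uniformly, which gives the left-hand side
  as the limit of their sums; by uniform continuity of \<open>f\<close> the same sums converge to the integral
  along the line.
\<close>

lemma chord_integral:
  assumes s: "0 < s" "s \<le> 1" and ends: "0 \<in> {c..d}" "m * s \<in> {c..d}"
  shows "F s (m * s) - F 0 0 - (LINT p:under c s (\<lambda>t. m * t)|lebesgue. partial_t f p)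
     = m * (LBINT t=0..s. f (t, m * t))"
proof -
  \<comment> \<open>The partition of \<open>[0, s]\<close> into \<open>Suc k\<close> equal parts, with \<open>s\<close> repeated at the end: the sum over a step
    function with \<open>Suc (Suc k)\<close> steps has only \<open>Suc k\<close> jumps, and these are to reach from \<open>0\<close> to \<open>s\<close>.\<close>
  define \<tau> where "\<tau> k n = min s (s * real n / real (Suc k))" for k n :: nat
  have \<tau>0: "\<tau> k 0 = 0" for k using s by (simp add: \<tau>_def)
  have \<tau>end: "\<tau> k (Suc k) = s" "\<tau> k (Suc (Suc k)) = s" for k using s by (auto simp: \<tau>_def field_simps)
  have mono: "\<tau> k n \<le> \<tau> k (Suc n)" for k n
    using s unfolding \<tau>_def by (intro min.mono divide_right_mono mult_left_mono) auto
  have \<tau>s: "\<tau> k n \<in> {0..s}" for k n using s by (simp add: \<tau>_def)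
  have step: "\<tau> k (Suc n) - \<tau> k n \<le> s / real (Suc k)" for k n
  proof -
    have "s * real (Suc n) / real (Suc k) = s * real n / real (Suc k) + s / real (Suc k)"
      by (simp add: add_divide_distrib distrib_left)
    moreover have "0 < s / real (Suc k)" using s by simp
    ultimately show ?thesis unfolding \<tau>_def min_def by simp
  qed
  have mcd: "m * t \<in> {c..d}" if "t \<in> {0..s}" for t
  proof -
    have "m * t = (1 - t / s) * 0 + (t / s) * (m * s)" using s by simp
    moreover have "0 \<le> t / s" "t / s \<le> 1" using that s by auto
    ultimately show ?thesis
      using convexD_alt[of "{c..d}" 0 "m * s" "t / s"] ends by simp
  qed
  have small: "(\<lambda>k. s / real (Suc k)) \<longlonglongrightarrow> 0" by (rule LIMSEQ_Suc[OF lim_const_over_n])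
  define S where "S k = (\<Sum>n=1..Suc k. LBINT x=m * \<tau> k (n - 1)..m * \<tau> k n. f (\<tau> k n, x))" for k
  define J where "J = integral {0..s} (\<lambda>t. f (t, m * t))"
  have "S \<longlonglongrightarrow> F s (m * s) - F 0 (m * 0) - (LINT p:under c s (\<lambda>t. m * t)|lebesgue. partial_t f p)"
    unfolding S_def
  proof (rule step_path_integral_tendsto[OF s, where M = Suc])
    show "continuous_on {0..s} (\<lambda>t. m * t)" by (intro continuous_intros)
    show "\<forall>\<^sub>F k in sequentially. \<forall>n\<le>Suc k. \<forall>t. \<tau> k n \<le> t \<and> t \<le> \<tau> k (Suc n) \<longrightarrow> \<bar>m * \<tau> k n - m * t\<bar> < e"
      if "e > 0" for e
    proof -
      have "(\<lambda>k. \<bar>m\<bar> * (s / real (Suc k))) \<longlonglongrightarrow> 0" using tendsto_mult_right_zero[OF small] .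
      from order_tendstoD(2)[OF this that] show ?thesis
      proof eventually_elim
        case (elim k)
        show ?case
        proof (intro allI impI)
          fix n t assume t: "\<tau> k n \<le> t \<and> t \<le> \<tau> k (Suc n)"
          have "\<bar>m * \<tau> k n - m * t\<bar> = \<bar>m\<bar> * (t - \<tau> k n)"
            using t by (simp add: right_diff_distrib[symmetric] abs_mult)
          also have "\<dots> \<le> \<bar>m\<bar> * (s / real (Suc k))" using t step[of k n] by (intro mult_left_mono) auto
          finally show "\<bar>m * \<tau> k n - m * t\<bar> < e" using elim by simp
        qed
      qed
    qed
  qed (use \<tau>0 mono \<tau>s \<tau>end mcd in auto)
  moreover have "S \<longlonglongrightarrow> m * J"
  proof (rule LIM_zero_cancel, rule tendstoI)
    fix e :: real assume "e > 0"
    define \<epsilon> where "\<epsilon> = e / (2 * (\<bar>m\<bar> + 1))"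
    have \<epsilon>: "\<epsilon> > 0" using \<open>e > 0\<close> by (simp add: \<epsilon>_def)
    have "uniformly_continuous_on K f"
      by (intro compact_uniformly_continuous continuous_on_subset[OF cont] compact_Times) auto
    then obtain \<delta> where \<delta>: "\<delta> > 0" "\<And>p p'. p \<in> K \<Longrightarrow> p' \<in> K \<Longrightarrow> dist p' p < \<delta> \<Longrightarrow> dist (f p') (f p) < \<epsilon>"
      unfolding uniformly_continuous_on_def using \<epsilon> by metis
    from order_tendstoD(2)[OF small \<delta>(1)]
    show "\<forall>\<^sub>F k in sequentially. dist (S k - m * J) 0 < e"
    proof eventually_elim
      case (elim k)
      have cJ: "continuous_on {0..s} (\<lambda>t. f (t, m * t))"
        by (rule continuous_on_compose2[OF cont]) (use s in \<open>auto intro!: continuous_intros\<close>)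
      have est: "\<bar>(LBINT x=m * \<tau> k (n - 1)..m * \<tau> k n. f (\<tau> k n, x)) - m * integral {\<tau> k (n - 1)..\<tau> k n} (\<lambda>t. f (t, m * t))\<bar>
           \<le> \<bar>m\<bar> * \<epsilon> * (\<tau> k n - \<tau> k (n - 1))" if "n \<in> {1..Suc k}" for n
      proof (rule chord_step_estimate)
        have n: "Suc (n - 1) = n" using that by simp
        show "0 \<le> \<tau> k (n - 1)" "\<tau> k n \<le> 1" using \<tau>s[of k n] \<tau>s[of k "n - 1"] s by auto
        show "\<tau> k (n - 1) \<le> \<tau> k n" using mono[of k "n - 1"] n by simp
        fix t assume t: "\<tau> k (n - 1) \<le> t" "t \<le> \<tau> k n"
        have "\<bar>\<tau> k n - t\<bar> < \<delta>" using t step[of k "n - 1"] n elim by simp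
        moreover have "t \<in> {0..s}" using t \<tau>s[of k n] \<tau>s[of k "n - 1"] by auto
        ultimately have "dist (f (\<tau> k n, m * t)) (f (t, m * t)) < \<epsilon>"
          using mcd[of t] \<tau>s[of k n] s by (intro \<delta>(2)) (auto simp: dist_Pair_Pair dist_real_def)
        then show "\<bar>f (\<tau> k n, m * t) - f (t, m * t)\<bar> \<le> \<epsilon>" by (simp add: dist_real_def)
      qed
      have comb: "(\<Sum>n=1..N. integral {\<tau> k (n - 1)..\<tau> k n} (\<lambda>t. f (t, m * t))) = integral {0..\<tau> k N} (\<lambda>t. f (t, m * t))" for N
      proof (induction N)
        case 0
        then show ?case by (simp add: \<tau>0)
      next
        case (Suc N)
        have "integral {0..\<tau> k N} (\<lambda>t. f (t, m * t)) + integral {\<tau> k N..\<tau> k (Suc N)} (\<lambda>t. f (t, m * t))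
            = integral {0..\<tau> k (Suc N)} (\<lambda>t. f (t, m * t))"
          using \<tau>s[of k N] \<tau>s[of k "Suc N"] mono[of k N] cJ
          by (intro Henstock_Kurzweil_Integration.integral_combine integrable_continuous_real) (auto intro: continuous_on_subset)
        with Suc show ?case by simp
      qed
      have tele: "(\<Sum>n=1..N. \<tau> k n - \<tau> k (n - 1)) = \<tau> k N" for N
        by (induction N) (auto simp: \<tau>0)
      have "S k - m * J = (\<Sum>n=1..Suc k. (LBINT x=m * \<tau> k (n - 1)..m * \<tau> k n. f (\<tau> k n, x))
           - m * integral {\<tau> k (n - 1)..\<tau> k n} (\<lambda>t. f (t, m * t)))"
        using comb[of "Suc k"] by (simp only: S_def J_def sum_subtractf sum_distrib_left[symmetric] \<tau>end)
      then have "\<bar>S k - m * J\<bar> \<le> (\<Sum>n=1..Suc k. \<bar>m\<bar> * \<epsilon> * (\<tau> k n - \<tau> k (n - 1)))"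
        using est by (simp only:) (intro order_trans[OF sum_abs] sum_mono)
      also have "\<dots> = \<bar>m\<bar> * \<epsilon> * s" using tele[of "Suc k"] by (simp only: sum_distrib_left[symmetric] \<tau>end)
      also have "\<dots> \<le> \<bar>m\<bar> * \<epsilon> * 1" using s \<epsilon> by (intro mult_left_mono) auto
      also have "\<dots> < e"
      proof -
        have "\<bar>m\<bar> * \<epsilon> * 2 = e * (\<bar>m\<bar> / (\<bar>m\<bar> + 1))" by (simp add: \<epsilon>_def field_simps)
        also have "\<dots> \<le> e * 1" using \<open>e > 0\<close> by (intro mult_left_mono) auto
        finally show ?thesis using \<open>e > 0\<close> by simp
      qed
      finally show ?case by simp
    qed
  qed
  ultimately have "F s (m * s) - F 0 (m * 0) - (LINT p:under c s (\<lambda>t. m * t)|lebesgue. partial_t f p) = m * J"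
    by (rule LIMSEQ_unique)
  moreover have "J = (LBINT t=0..s. f (t, m * t))"
  proof -
    have "continuous_on {0..s} (\<lambda>t. f (t, m * t))"
      by (rule continuous_on_compose2[OF cont]) (use s in \<open>auto intro!: continuous_intros\<close>)
    then show ?thesis unfolding J_def using s interval_integral_eq_integral[of 0 s "\<lambda>t. f (t, m * t)"]
      by (simp add: borel_integrable_atLeastAtMost' zero_ereal_def)
  qed
  ultimately show ?thesis by simp
qed

end

section \<open>The area formula\<close>

text \<open>
  The two limits for graph and chord have the terms with \<open>F\<close> in common, since
  both curves start at the origin and end at \<open>(s, g s)\<close>.
\<close>

lemma area_formula_continuous:
  assumes g: "continuous_on {0..1} g" and g0: "g 0 = 0" and gcd: "g ` {0..1} \<subseteq> {c..d}"
    and s: "s \<in> {0<..1}" and f: "integrand \<beta> c d f"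
  shows "chord_decomposition g s \<and> area_formula f g s"
proof
  define m where "m = g s / s"
  have s01: "0 < s" "s \<le> 1" using s by auto
  have m: "g s = m * s" using s01 by (simp add: m_def)
  have gcd': "g t \<in> {c..d}" if "t \<in> {0..1}" for t using gcd that by blast
  show "chord_decomposition g s" by (rule chord_decomposition_holds[OF g g0 s01 m])
  interpret area_setting f c d
    using f gcd'[of 0] by unfold_locales (auto simp: integrand_def ACL_def)
  let ?I = "\<lambda>u. LINT p:under c s u|lebesgue. partial_t f p"
  have lim: "path_sum f g 0 s \<longlonglongrightarrow> F s (g s) - F 0 0 - ?I g"
    using path_sum_tendsto[OF g gcd' s01] by (simp add: g0)
  have chord: "F s (g s) - F 0 0 - ?I (\<lambda>t. m * t) = m * (LBINT t=0..s. f (t, m * t))"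
    using chord_integral[OF s01, of m] gcd'[of 0] gcd'[of s] s01 by (simp add: g0 m)
  show "area_formula f g s"
    unfolding area_formula_def
  proof (intro conjI allI impI)
    show "convergent (path_sum f g 0 s)" using lim by (rule convergentI)
    fix G \<sigma> assume G: "\<forall>k\<in>chord_gaps g s. gap_domain g k (G k) (\<sigma> k)"
    have sum: "((\<lambda>k. \<sigma> k * (LINT p:G k|lebesgue. partial_t f p)) has_sum ?I (\<lambda>t. m * t) - ?I g) (chord_gaps g s)"
      by (rule gap_areas_has_sum[OF g gcd' g0 s01 m G])
    then show "(\<lambda>k. \<sigma> k * (LINT p:G k|lebesgue. partial_t f p)) summable_on chord_gaps g s"
      by (rule has_sum_imp_summable)
    have "path_integral f g 0 s = F s (g s) - F 0 0 - ?I g"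
      unfolding path_integral_def using lim by (rule limI)
    also have "\<dots> = (?I (\<lambda>t. m * t) - ?I g) + m * (LBINT t=0..s. f (t, m * t))"
      using chord by linarith
    finally show "path_integral f g 0 s =
      (\<Sum>\<^sub>\<infinity>k\<in>chord_gaps g s. \<sigma> k * (LINT p:G k|lebesgue. partial_t f p)) +
      g s / s * (LBINT t=0..s. f (t, g s / s * t))"
      using infsumI[OF sum] by (simp add: m_def)
  qed
qed

theorem theorem2p5:
  fixes \<beta> :: real
  assumes "0 < \<beta>" "\<beta> \<le> 1"
  shows
    "(\<forall>(\<alpha> :: real) g c d s f.
        0 < \<alpha> \<and> \<alpha> \<le> 1 \<and> g \<in> GH \<beta> \<inter> holder_class \<alpha> \<and> g 0 = 0 \<and>
        g ` {0..1} \<subseteq> {c..d} \<and> s \<in> {0<..1} \<and> integrand \<beta> c d f \<longrightarrow>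
        chord_decomposition g s \<and> area_formula f g s) \<and>
     (\<beta> > 1 / 2 \<longrightarrow>
        (\<forall>W. wiener_measure W \<longrightarrow>
           (AE g in W. \<forall>c d s f.
              g ` {0..1} \<subseteq> {c..d} \<and> s \<in> {0<..1} \<and> integrand \<beta> c d f \<longrightarrow>
              chord_decomposition g s \<and> area_formula f g s)))"
proof (intro conjI allI impI)
  fix \<alpha> c d s :: real and g :: "real \<Rightarrow> real" and f :: "real \<times> real \<Rightarrow> real"
  assume "0 < \<alpha> \<and> \<alpha> \<le> 1 \<and> g \<in> GH \<beta> \<inter> holder_class \<alpha> \<and> g 0 = 0 \<and>
        g ` {0..1} \<subseteq> {c..d} \<and> s \<in> {0<..1} \<and> integrand \<beta> c d f"
  then have "chord_decomposition g s \<and> area_formula f g s"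
    by (intro area_formula_continuous[of g c d s \<beta> f]) (auto simp: GH_def)
  then show "chord_decomposition g s" "area_formula f g s" by blast+
next
  fix W assume W: "wiener_measure W"
  then have "sets W = sets (restrict_space (Pi\<^sub>M {0..1} (\<lambda>_. borel)) {g. continuous_on {0..1} g})"
    by (simp add: wiener_measure_def)
  then have "space W = space (restrict_space (Pi\<^sub>M {0..1} (\<lambda>_. borel :: real measure)) {g. continuous_on {0..1} g})"
    by (rule sets_eq_imp_space_eq)
  then have cont: "continuous_on {0..1} g" if "g \<in> space W" for g
    using that by (auto simp: space_restrict_space)
  have "AE g in W. g 0 = 0" using W by (simp add: wiener_measure_def)
  with AE_space show "AE g in W. \<forall>c d s f.
              g ` {0..1} \<subseteq> {c..d} \<and> s \<in> {0<..1} \<and> integrand \<beta> c d f \<longrightarrow>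
              chord_decomposition g s \<and> area_formula f g s"
  proof eventually_elim
    case (elim g)
    show ?case
      using area_formula_continuous[OF cont[OF elim(1)] elim(2)] by blast
  qed
qed

end
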